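(* Up to dilations, the set of probability measures $\mu_w$ is closed under classical convolution and under free convolution. Precisely, for all symmetric measurable functions $w,w':[0,1]^2\to[-1,1]$ and all $s,t>0$, there exist symmetric measurable functions $w^*,\overline w^*:[0,1]^2\to[-1,1]$ and $r,\overline r>0$ such that $$(s\mu_w)*(t\mu_{w'})=r\mu_{w^*}\qquad\text{and}\qquad (s\mu_w)\boxplus(t\mu_{w'})=\overline r\,\mu_{\overline w^*}.$$
   Context: For a symmetric measurable $w:[0,1]^2\to[-1,1]$, $\mu_w$ is the probability measure on $\mathbb R$ with moments $$\int x^p\,\mathrm d\mu_w=\sum_{\pi\in P_2(p)}\int_{[0,1]^{V(f_\pi)}}\prod_{(u,v)\in E(f_\pi)}w(x_u,x_v)\,\mathrm dx,\qquad p\ge1.$$ Here $P_2(p)$ is the set of pair partitions of $[p]$ (sums over $P_2(p)$ are $0$ for $p$ odd); two blocks of a partition cross if there are $i<k<j<l$ with $\{i,j\}$ contained in one of them and $\{k,l\}$ in the other; the intersection graph $f_\pi=(V(f_\pi),E(f_\pi))$ has the blocks of $\pi$ as vertices, with an edge between two distinct blocks iff they cross (each edge counted once). For $t>0$, the dilation $t\mu$ of a measure $\mu$ is $t\mu(A)=\mu(t^{-1}A)$ for Borel sets $A$. The symbol $*$ denotes classical convolution of probability measures, and $\boxplus$ denotes (additive) free convolution, i.e. the law of the sum of two freely independent self-adjoint random variables with the given laws; for measures with finite moments of all orders, the free cumulants of $\mu\boxplus\nu$ are the sums of those of $\mu$ and $\nu$. *)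

theory Defs
  imports "HOL-Probability.Probability" "HOL-Library.Poly_Mapping"
begin

section \<open>The measures \<open>\<mu>\<^sub>w\<close>\<close>

text \<open>
  A function on the unit square is represented by a total function, all of whose values outside
  the square are irrelevant.
\<close>

definition unit_kernel :: "(real \<Rightarrow> real \<Rightarrow> real) \<Rightarrow> bool" where
  "unit_kernel w \<longleftrightarrow>
     case_prod w \<in> borel_measurable (restrict_space borel ({0..1} \<times> {0..1})) \<and>
     (\<forall>x\<in>{0..1}. \<forall>y\<in>{0..1}. w x y = w y x) \<and>
     (\<forall>x\<in>{0..1}. \<forall>y\<in>{0..1}. w x y \<in> {-1..1})"

definition pair_partitions :: "nat \<Rightarrow> nat set set set" where
  "pair_partitions p = {\<pi>. partition_on {1..p} \<pi> \<and> (\<forall>B\<in>\<pi>. card B = 2)}"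

definition blocks_cross :: "nat set \<Rightarrow> nat set \<Rightarrow> bool" where
  "blocks_cross U V \<longleftrightarrow> (\<exists>i k j l. i < k \<and> k < j \<and> j < l \<and>
     ({i, j} \<subseteq> U \<and> {k, l} \<subseteq> V \<or> {i, j} \<subseteq> V \<and> {k, l} \<subseteq> U))"

text \<open>
  The edges of the intersection graph of a partition. Each undirected edge is represented by
  exactly one ordered pair, the block with the smaller minimum coming first; distinct blocks are
  disjoint, so their minima differ. The choice of orientation is immaterial for symmetric kernels.
\<close>

definition crossing_edges :: "nat set set \<Rightarrow> (nat set \<times> nat set) set" where
  "crossing_edges \<pi> = {(U, V). U \<in> \<pi> \<and> V \<in> \<pi> \<and> Min U < Min V \<and> blocks_cross U V}"

definition kernel_moment :: "(real \<Rightarrow> real \<Rightarrow> real) \<Rightarrow> nat \<Rightarrow> real" where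
  "kernel_moment w p =
     (\<Sum>\<pi>\<in>pair_partitions p.
        \<integral>x. (\<Prod>(U, V)\<in>crossing_edges \<pi>. w (x U) (x V))
          \<partial>(\<Pi>\<^sub>M B\<in>\<pi>. restrict_space lborel {0..1}))"

definition kernel_measure :: "(real \<Rightarrow> real \<Rightarrow> real) \<Rightarrow> real measure" where
  "kernel_measure w = (THE M. real_distribution M \<and>
     (\<forall>p\<ge>1. integrable M (\<lambda>x. x ^ p) \<and> (\<integral>x. x ^ p \<partial>M) = kernel_moment w p))"

definition dilation :: "real \<Rightarrow> real measure \<Rightarrow> real measure" where
  "dilation t M = distr M borel (\<lambda>x. t * x)"


section \<open>The free algebra on two generators\<close>

text \<open>
  The free monoid on two letters. It is written additively because this is the
  (not necessarily commutative) monoid structure on exponents from which \<^typ>\<open>'a \<Rightarrow>\<^sub>0 'b\<close>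
  obtains its ring structure.
\<close>

datatype free_monoid = Letters (letters: "bool list")

instantiation free_monoid :: monoid_add
begin

definition zero_free_monoid :: free_monoid where
  "zero_free_monoid = Letters []"

definition plus_free_monoid :: "free_monoid \<Rightarrow> free_monoid \<Rightarrow> free_monoid" where
  "plus_free_monoid u v = Letters (letters u @ letters v)"

instance
  by standard (simp_all add: zero_free_monoid_def plus_free_monoid_def)

end

type_synonym free_algebra = "free_monoid \<Rightarrow>\<^sub>0 complex"

definition scalar :: "complex \<Rightarrow> free_algebra" where
  "scalar c = Poly_Mapping.single 0 c"

definition generator :: "bool \<Rightarrow> free_algebra" where
  "generator b = Poly_Mapping.single (Letters [b]) 1"

text \<open>The antilinear involution reversing products and fixing both generators.\<close>

definition adjoint :: "free_algebra \<Rightarrow> free_algebra" where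
  "adjoint P = (\<Sum>u\<in>Poly_Mapping.keys P.
     Poly_Mapping.single (Letters (rev (letters u))) (cnj (Poly_Mapping.lookup P u)))"

definition state :: "(free_algebra \<Rightarrow> complex) \<Rightarrow> bool" where
  "state \<phi> \<longleftrightarrow>
     (\<forall>P Q. \<phi> (P + Q) = \<phi> P + \<phi> Q) \<and>
     (\<forall>c P. \<phi> (scalar c * P) = c * \<phi> P) \<and>
     \<phi> 1 = 1 \<and>
     (\<forall>P. \<phi> (adjoint P * P) \<in> \<real>\<^sub>\<ge>\<^sub>0)"

text \<open>The unital subalgebra generated by one element.\<close>

definition subalgebra_gen :: "free_algebra \<Rightarrow> free_algebra set" where
  "subalgebra_gen a = {(\<Sum>i\<le>n. scalar (c i) * a ^ i) | (n :: nat) c. True}"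


section \<open>Free independence and free convolution\<close>

text \<open>
  Alternating products of centred elements are centred: neighbouring factors have to come from
  subalgebras with distinct indices.
\<close>

definition freely_independent ::
    "(free_algebra \<Rightarrow> complex) \<Rightarrow> ('i \<Rightarrow> free_algebra set) \<Rightarrow> bool" where
  "freely_independent \<phi> A \<longleftrightarrow>
     (\<forall>xs :: ('i \<times> free_algebra) list.
        xs \<noteq> [] \<longrightarrow> distinct_adj (map fst xs) \<longrightarrow>
        (\<forall>(i, a)\<in>set xs. a \<in> A i \<and> \<phi> a = 0) \<longrightarrow>
        \<phi> (prod_list (map snd xs)) = 0)"

definition has_law :: "(free_algebra \<Rightarrow> complex) \<Rightarrow> free_algebra \<Rightarrow> real measure \<Rightarrow> bool" where
  "has_law \<phi> a M \<longleftrightarrow> real_distribution M \<and>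
     (\<forall>n. integrable M (\<lambda>x. x ^ n) \<and> \<phi> (a ^ n) = complex_of_real (\<integral>x. x ^ n \<partial>M))"

text \<open>
  The free convolution is the law of the sum of two freely independent self-adjoint random
  variables with the given laws. A pair of self-adjoint elements of an arbitrary *-probability space
  pulls back, along evaluation of noncommutative polynomials, to the two generators of the free
  *-algebra with the state given by their joint distribution, so it suffices to let the state on
  this one algebra vary.

  Laws are compared through their moments. Hence the definition is the intended one
  for measures with finite moments of all orders whose free convolution is determined by its
  moments. This holds for dilations of \<^term>\<open>kernel_measure w\<close>, as their moments of order
  \<open>2 * n\<close> are at most \<open>c ^ (2 * n)\<close> times the number of pair partitions of a set of \<open>2 * n\<close> elements.
\<close>

definition free_convolution :: "real measure \<Rightarrow> real measure \<Rightarrow> real measure"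
    (infixl \<open>\<boxplus>\<close> 65) where
  "M \<boxplus> N = (THE L. \<exists>\<phi>. state \<phi> \<and>
     freely_independent \<phi> (\<lambda>b. subalgebra_gen (generator b)) \<and>
     has_law \<phi> (generator False) M \<and>
     has_law \<phi> (generator True) N \<and>
     has_law \<phi> (generator False + generator True) L)"

end

(*
  Give the first generator the colour of [0, \<alpha>) and the second one that of [\<alpha>, 1], where
  \<alpha> = s^2 / (s^2 + t^2), and glue the kernels w and w' along this splitting of the unit interval,
  filling the off-diagonal rectangles with the constant 1 for the classical and 0 for the free
  convolution. Expanding the moments of the glued kernel over the colours of the positions gives
  mixed moments. With the constant 1, pairings of the two colours contribute independently of
  their mutual crossings, so the mixed moments factorize. With the constant 0, blocks of different
  colours must not cross; every contributing pairing of an alternating word then has an isolated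
  interval, and summing over the first one makes alternating products of centred elements vanish.

  That these numbers are moments of measures, and form a state on the free algebra, follows from
  Speicher's central limit theorem: they are the limits of the moments of sums of N operators which
  commute up to random signs, with means given by w at N independent uniform points.
*)
theory Submission
  imports Defs "HOL-Computational_Algebra.Fundamental_Theorem_Algebra" "HOL-Real_Asymp.Real_Asymp"
begin

section \<open>The Hamburger moment problem\<close>

text \<open>\<open>kernel_measure\<close> and the free convolution are both definite descriptions,
  so every identity rests on existence and uniqueness of a measure with given moments. Uniqueness
  comes from the number of pair partitions of \<open>2 * n\<close> points, at most
  \<open>2 ^ n * fact n\<close>. Existence is Hamburger's theorem, proved by Gauss quadrature and
  weak limits from positivity of the moment matrix. To get positivity for measures and for states at
  once, every position carries a function of the coordinate of its block: the constant 1 gives the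
  moments of one measure, the indicators of the two parts of the unit interval give joint moments of
  two generators. The value of \<alpha> is forced by the blocks being pairs: confining n positions
  to a part of length l costs a factor l for each block, that is \<open>sqrt l ^ n\<close>. Hence
  \<open>r * sqrt \<alpha> = s\<close> and \<open>r * sqrt (1 - \<alpha>) = t\<close>, and r is
  found by adding squares. For the free convolution the glued state must moreover give the only
  possible law: freeness determines the mixed moments from the two marginal laws, by merging and
  centring factors.\<close>

text \<open>Taylor approximation of the characteristic function is fixed by the moments, with an
  error of at most \<open>2 * \<bar>t\<bar> ^ (2*n) / fact (2*n)\<close> times the moment of order
  2n. Growth \<open>C ^ n * fact n\<close> against \<open>fact (2*n)\<close> makes this vanish for
  every t, so no continuation from a neighbourhood of 0 is involved.\<close>

lemma moment_determinacy:
  fixes M N :: "real measure" and C :: real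
  assumes M: "real_distribution M" and N: "real_distribution N"
    and iM: "\<And>n. integrable M (\<lambda>x. x ^ n)" and iN: "\<And>n. integrable N (\<lambda>x. x ^ n)"
    and eq: "\<And>n. (\<integral>x. x ^ n \<partial>M) = (\<integral>x. x ^ n \<partial>N)"
    and bound: "\<And>n. (\<integral>x. x ^ (2 * n) \<partial>M) \<le> C ^ n * fact n"
  shows "M = N"
proof (rule Levy_uniqueness[OF M N], rule ext)
  fix t :: real
  interpret M: real_distribution M by fact
  interpret N: real_distribution N by fact
  define S where "S n = (\<Sum>k\<le>n. ((\<i> * t)^k / fact k) * complex_of_real (\<integral>x. x ^ k \<partial>M))" for n
  define e where "e n = (2 * \<bar>t\<bar> ^ (2*n) / fact (2*n)) * (\<integral>x. x ^ (2*n) \<partial>M)" for n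
  have 1: "cmod (char M t - S (2*n)) \<le> e n" for n
    using M.char_approx1[of "2*n" t] iM by (simp add: S_def e_def power_even_abs)
  have 2: "cmod (char N t - S (2*n)) \<le> e n" for n
    using N.char_approx1[of "2*n" t] iN by (simp add: S_def e_def eq power_even_abs)
  have 3: "cmod (char M t - char N t) \<le> 2 * e n" for n
  proof -
    have "cmod (char M t - char N t) \<le> cmod (char M t - S (2*n)) + cmod (char N t - S (2*n))"
      using norm_triangle_ineq4[of "char M t - S (2*n)" "char N t - S (2*n)"] by simp
    then show ?thesis using 1[of n] 2[of n] by linarith
  qed
  have 4: "e n \<le> 2 * ((t\<^sup>2 * C) ^ n / fact n)" for n
  proof -
    \<comment> \<open>One factorial cancels the growth of the moments, the other is left for
      convergence.\<close>
    have ff: "fact n * fact n \<le> (fact (2*n) :: real)"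
    proof -
      have "fact n * fact n \<le> (fact (2*n) :: nat)"
        using dvd_imp_le[OF fact_fact_dvd_fact[of n n]] by (simp add: mult_2)
      then show ?thesis by (metis of_nat_fact of_nat_mult of_nat_le_iff)
    qed
    have C: "0 \<le> C ^ n * fact n"
      by (rule order_trans[OF _ bound]) (simp add: Bochner_Integration.integral_nonneg)
    have "e n \<le> (2 * \<bar>t\<bar> ^ (2*n) / fact (2*n)) * (C ^ n * fact n)"
      unfolding e_def by (intro mult_left_mono bound) auto
    also have "\<dots> \<le> (2 * \<bar>t\<bar> ^ (2*n) / (fact n * fact n)) * (C ^ n * fact n)"
      using ff C by (intro mult_right_mono divide_left_mono) auto
    also have "\<dots> = 2 * ((t\<^sup>2 * C) ^ n / fact n)"
    proof -
      have "\<bar>t\<bar> ^ (2*n) = (t\<^sup>2) ^ n" by (simp add: power_mult)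
      then show ?thesis by (simp add: power_mult_distrib field_simps)
    qed
    finally show ?thesis .
  qed
  have "(\<lambda>n. 2 * (2 * ((t\<^sup>2 * C) ^ n / fact n))) \<longlonglongrightarrow> 2 * (2 * 0)"
    using summable_LIMSEQ_zero[OF summable_exp[of "t\<^sup>2 * C"]]
    by (intro tendsto_intros) (simp add: field_simps)
  then have "cmod (char M t - char N t) \<le> 2 * (2 * 0)"
    by (rule LIMSEQ_le_const) (use 3 4 in \<open>meson order_trans mult_left_mono zero_le_numeral\<close>)
  then show "char M t = char N t" by simp
qed

section \<open>Positive functionals on real polynomials and orthogonal polynomials\<close>

text \<open>Positivity is strict, so that \<open>L (p * q)\<close> is an inner product and
  Gram-Schmidt may divide by \<open>L (P * P)\<close>. Semidefinite functionals are made strict by a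
  perturbation in \<open>hamburger\<close>.\<close>

locale positive_functional =
  fixes L :: "real poly \<Rightarrow> real"
  assumes add: "L (p + q) = L p + L q"
    and smult: "L (smult c p) = c * L p"
    and pos: "p \<noteq> 0 \<Longrightarrow> 0 < L (p * p)"
begin

lemma zero [simp]: "L 0 = 0"
  using smult[of 0 0] by simp

lemma diff: "L (p - q) = L p - L q"
  using add[of "p - q" q] by simp

lemma sum: "L (\<Sum>x\<in>A. f x) = (\<Sum>x\<in>A. L (f x))"
  by (induction A rule: infinite_finite_induct) (auto simp: add)

text \<open>Gram-Schmidt by induction on d: the residue of the monomial of degree d is orthogonal to
  all lower degrees, and g is extended by the Fourier coefficient along it. Degree below d is
  expressed by vanishing coefficients, which for d = 0 leaves just the zero polynomial.\<close>

lemma projection: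
  "\<exists>g. (\<forall>i\<ge>d. coeff g i = 0) \<and> (\<forall>q. (\<forall>i\<ge>d. coeff q i = 0) \<longrightarrow> L ((f - g) * q) = 0)"
proof (induction d arbitrary: f)
  case 0
  have "L ((f - 0) * q) = 0" if "\<forall>i\<ge>0. coeff q i = 0" for q
  proof -
    have "q = 0" using that by (simp add: poly_eq_iff)
    then show ?thesis by simp
  qed
  then show ?case by (intro exI[of _ 0]) auto
next
  case (Suc d)
  obtain h where h: "\<forall>i\<ge>d. coeff h i = 0"
    "\<And>q. (\<forall>i\<ge>d. coeff q i = 0) \<Longrightarrow> L ((monom 1 d - h) * q) = 0"
    using Suc.IH[of "monom 1 d"] by auto
  obtain g where g: "\<forall>i\<ge>d. coeff g i = 0"
    "\<And>q. (\<forall>i\<ge>d. coeff q i = 0) \<Longrightarrow> L ((f - g) * q) = 0"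
    using Suc.IH[of f] by auto
  define P where "P = monom 1 d - h"
  have Pd: "coeff P d = 1" and P0: "\<And>i. i > d \<Longrightarrow> coeff P i = 0"
    using h(1) by (auto simp: P_def)
  then have LP: "L (P * P) > 0" by (intro pos) auto
  define c where "c = L ((f - g) * P) / L (P * P)"
  have "L ((f - (g + smult c P)) * q) = 0" if q: "\<forall>i\<ge>Suc d. coeff q i = 0" for q
  proof -
    \<comment> \<open>Cancelling the top coefficient of q against the monic P leaves a polynomial to
      which both induction hypotheses apply.\<close>
    define q' where "q' = q - smult (coeff q d) P"
    have q': "\<forall>i\<ge>d. coeff q' i = 0"
      using q Pd P0 by (auto simp: q'_def) (metis Suc_leI le_neq_implies_less mult_1_right mult_zero_right diff_self)
    have "(f - (g + smult c P)) * q = smult (coeff q d) ((f - g) * P) + (f - g) * q' - smult (coeff q d * c) (P * P) - smult c (P * q')"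
      by (simp add: q'_def algebra_simps smult_diff_right smult_add_right)
    then have "L ((f - (g + smult c P)) * q) = coeff q d * L ((f - g) * P) - coeff q d * c * L (P * P)"
      using g(2)[OF q'] h(2)[OF q'] by (simp add: add diff smult P_def)
    then show ?thesis using LP by (simp add: c_def)
  qed
  moreover have "\<forall>i\<ge>Suc d. coeff (g + smult c P) i = 0"
    using g(1) P0 by auto
  ultimately show ?case by blast
qed

lemma orthogonal_poly:
  obtains P where "degree P = n" "P \<noteq> 0"
    "\<And>q. q = 0 \<or> degree q < n \<Longrightarrow> L (P * q) = 0"
proof -
  obtain h where h: "\<forall>i\<ge>n. coeff h i = 0"
    "\<And>q. (\<forall>i\<ge>n. coeff q i = 0) \<Longrightarrow> L ((monom 1 n - h) * q) = 0"
    using projection[of n "monom 1 n"] by auto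
  define P where "P = monom 1 n - h"
  have c: "coeff P n = 1" and c': "\<And>i. i > n \<Longrightarrow> coeff P i = 0"
    using h(1) by (auto simp: P_def)
  have "degree P = n"
    by (rule antisym[OF degree_le le_degree]) (use c c' in auto)
  moreover have "L (P * q) = 0" if "q = 0 \<or> degree q < n" for q
    unfolding P_def using that by (intro h(2)) (auto simp: coeff_eq_0)
  moreover have "P \<noteq> 0" using c by auto
  ultimately show ?thesis using that by blast
qed

text \<open>With cofactor S, the product P * S is the sum of the squares of (x - a) S and b S, where
  L is positive; but S has smaller degree than P, so L vanishes there. The case b = 0 excludes
  double real roots, the other cases exclude pairs of conjugate roots.\<close>

lemma not_dvd_nonneg_quadratic:
  assumes P: "P \<noteq> 0" "\<And>q. q = 0 \<or> degree q < degree P \<Longrightarrow> L (P * q) = 0"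
  shows "\<not> [: a\<^sup>2 + b\<^sup>2, - 2 * a, 1 :] dvd P"
proof
  assume "[: a\<^sup>2 + b\<^sup>2, - 2 * a, 1 :] dvd P"
  then obtain S where S: "P = [: a\<^sup>2 + b\<^sup>2, - 2 * a, 1 :] * S" by auto
  with P(1) have "S \<noteq> 0" by auto
  then have deg: "degree P = 2 + degree S"
    by (subst S, subst degree_mult_eq) auto
  have "L (P * S) = 0" using deg by (intro P(2)) auto
  also have "P * S = ([:-a, 1:] * S) * ([:-a, 1:] * S) + smult (b\<^sup>2) (S * S)"
  proof -
    have "[: a\<^sup>2 + b\<^sup>2, - 2 * a, 1 :] = [:-a,1:] * [:-a,1:] + [:b\<^sup>2:]" by (simp add: power2_eq_square)
    then have "P * S = ([:-a,1:] * [:-a,1:] + [:b\<^sup>2:]) * S * S" using S by simp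
    also have "\<dots> = ([:-a, 1:] * S) * ([:-a, 1:] * S) + [:b\<^sup>2:] * (S * S)" by (simp only: algebra_simps)
    finally show ?thesis by simp
  qed
  finally have "L (([:-a, 1:] * S) * ([:-a, 1:] * S)) + b\<^sup>2 * L (S * S) = 0"
    by (simp only: add smult)
  moreover have "L (([:-a, 1:] * S) * ([:-a, 1:] * S)) > 0"
    using \<open>S \<noteq> 0\<close> by (intro pos) (simp del: mult_pCons_left)
  moreover have "b\<^sup>2 * L (S * S) \<ge> 0" using pos[OF \<open>S \<noteq> 0\<close>] by simp
  ultimately show False by linarith
qed

end

section \<open>Factors of real polynomials\<close>

lemma poly_map_of_real_pCons:
  "poly (map_poly of_real (pCons a p)) z = of_real a + z * poly (map_poly of_real p) (z::complex)"
  by (subst map_poly_pCons) auto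

lemma poly_map_of_real_add:
  "poly (map_poly of_real (p + q)) (z::complex) = poly (map_poly of_real p) z + poly (map_poly of_real q) z"
  by (induction p q rule: poly_induct2) (auto simp: poly_map_of_real_pCons algebra_simps)

lemma poly_map_of_real_smult:
  "poly (map_poly of_real (smult c p)) (z::complex) = of_real c * poly (map_poly of_real p) z"
  by (induction p) (auto simp: poly_map_of_real_pCons algebra_simps)

lemma poly_map_of_real_mult:
  "poly (map_poly of_real (p * q)) (z::complex) = poly (map_poly of_real p) z * poly (map_poly of_real q) z"
  by (induction p) (auto simp: poly_map_of_real_pCons poly_map_of_real_add poly_map_of_real_smult algebra_simps)

text \<open>The quadratic is the minimal polynomial of z over the reals: a remainder c + d x
  vanishing at z has d * Im z = 0, hence d = 0 and then c = 0.\<close>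

lemma real_poly_quadratic_dvd:
  fixes S :: "real poly"
  assumes z: "poly (map_poly complex_of_real S) z = 0" "Im z \<noteq> 0"
  shows "[: (Re z)\<^sup>2 + (Im z)\<^sup>2, - 2 * Re z, 1 :] dvd S"
proof -
  define q where "q = [: (Re z)\<^sup>2 + (Im z)\<^sup>2, - 2 * Re z, 1 :]"
  define r where "r = S mod q"
  have "q \<noteq> 0" "degree q = 2" by (auto simp: q_def)
  then have "degree r < 2" unfolding r_def using degree_mod_less[of q S] by auto
  then have "r = [:coeff r 0, coeff r 1:]"
    by (intro poly_eqI) (auto simp: coeff_pCons coeff_eq_0 split: nat.split)
  then obtain c d where r: "r = [:c, d:]" by blast
  have "poly (map_poly complex_of_real q) z = 0"
    by (simp add: q_def poly_map_of_real_pCons complex_eq_iff power2_eq_square algebra_simps)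
  moreover have "S = q * (S div q) + r" by (simp add: r_def)
  ultimately have "poly (map_poly complex_of_real r) z = 0"
    using z(1) poly_map_of_real_add poly_map_of_real_mult by (metis add_0 mult_zero_left)
  then have "c + d * Re z = 0" "d * Im z = 0"
    by (simp_all add: r poly_map_of_real_pCons complex_eq_iff algebra_simps)
  then have "r = 0" using z(2) by (simp add: r)
  then show ?thesis unfolding r_def q_def by (simp add: dvd_eq_mod_eq_0)
qed

lemma prod_linear_dvd:
  fixes P :: "'a :: field poly"
  assumes "finite X" "\<And>x. x \<in> X \<Longrightarrow> poly P x = 0"
  shows "(\<Prod>x\<in>X. [:-x, 1:]) dvd P"
  using assms
proof (induction X rule: finite_induct)
  case (insert a X)
  then obtain S where S: "P = (\<Prod>x\<in>X. [:-x, 1:]) * S" by auto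
  have "poly (\<Prod>x\<in>X. [:-x, 1:]) a \<noteq> 0"
    using insert by (auto simp: poly_prod)
  moreover have "poly P a = 0" using insert by auto
  ultimately have "poly S a = 0" by (simp add: S)
  then have "[:-a, 1:] dvd S" by (simp add: poly_eq_0_iff_dvd)
  then have "[:-a, 1:] * (\<Prod>x\<in>X. [:-x, 1:]) dvd S * (\<Prod>x\<in>X. [:-x, 1:])"
    by (rule mult_dvd_mono) simp
  moreover have "P = S * (\<Prod>x\<in>X. [:-x, 1:])" using S by (simp only: mult.commute)
  ultimately show ?case by (simp only: prod.insert[OF insert.hyps])
qed auto

lemma prod_linear_degree:
  fixes X :: "'a :: field set"
  assumes "finite X"
  shows "degree (\<Prod>x\<in>X. [:-x, 1:]) = card X" "(\<Prod>x\<in>X. [:-x, 1:]) \<noteq> 0"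
  using assms by (auto simp: degree_prod_eq_sum_degree)

section \<open>Gauss quadrature\<close>

context positive_functional
begin

text \<open>Divide by the linear factors of the distinct real roots. A real root of the cofactor
  would be a double root of P, and a non-real one would bring its conjugate; both are excluded, so
  the cofactor is constant.\<close>

lemma orthogonal_poly_splits:
  assumes P: "P \<noteq> 0" "\<And>q. q = 0 \<or> degree q < degree P \<Longrightarrow> L (P * q) = 0"
  obtains X c where "finite X" "card X = degree P" "c \<noteq> 0" "P = smult c (\<Prod>x\<in>X. [:-x, 1:])"
proof -
  define X where "X = {x. poly P x = 0}"
  have X: "finite X" unfolding X_def by (rule poly_roots_finite[OF P(1)])
  obtain S where S: "P = (\<Prod>x\<in>X. [:-x, 1:]) * S"
    using prod_linear_dvd[OF X, of P] by (auto simp: X_def)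
  with P(1) have S0: "S \<noteq> 0" by auto
  have real: "poly S a \<noteq> 0" for a
  proof
    assume a: "poly S a = 0"
    then have "poly P a = 0" by (subst S) (simp only: poly_mult mult_zero_right)
    then have "a \<in> X" by (simp add: X_def)
    then have "[:-a,1:] dvd (\<Prod>x\<in>X. [:-x, 1:])" using X by auto
    moreover have "[:-a,1:] dvd S" using a by (simp add: poly_eq_0_iff_dvd)
    ultimately have "[:-a,1:] * [:-a,1:] dvd P" by (subst S) (rule mult_dvd_mono)
    then show False using not_dvd_nonneg_quadratic[OF P, of a 0] by (simp add: power2_eq_square)
  qed
  have "degree S = 0"
  proof (rule ccontr)
    assume "degree S \<noteq> 0"
    then have "\<not> constant (poly (map_poly complex_of_real S))"
      by (simp add: constant_degree degree_map_poly)
    then obtain z where z: "poly (map_poly complex_of_real S) z = 0"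
      using fundamental_theorem_of_algebra by blast
    show False
    proof (cases "Im z = 0")
      case True
      then have zr: "z = of_real (Re z)" by (simp add: complex_eq_iff)
      have "poly (map_poly complex_of_real S) (of_real x) = of_real (poly S x)" for x
        by (induction S) (auto simp: poly_map_of_real_pCons)
      with z zr have "poly S (Re z) = 0" by (metis of_real_eq_0_iff)
      with real show False by blast
    next
      case False
      from real_poly_quadratic_dvd[OF z this] show False
        using not_dvd_nonneg_quadratic[OF P] S by (metis dvd_mult)
    qed
  qed
  then obtain c where c: "S = [:c:]" by (rule degree_eq_zeroE)
  with S0 have "c \<noteq> 0" by auto
  moreover have "P = smult c (\<Prod>x\<in>X. [:-x, 1:])" using S c by simp
  moreover from this have "card X = degree P" using prod_linear_degree[OF X] \<open>c \<noteq> 0\<close> by simp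
  ultimately show ?thesis using that X by blast
qed

text \<open>The nodes are the roots of the orthogonal polynomial P of degree n. The error of
  Lagrange interpolation is a multiple P * q, and degree below 2n leaves q with degree below n,
  where L (P * q) = 0.\<close>

lemma gauss_quadrature:
  assumes "n > 0"
  obtains X a where "finite X" "\<And>x. x \<in> X \<Longrightarrow> a x \<ge> 0"
    "\<And>p. degree p < 2 * n \<Longrightarrow> L p = (\<Sum>x\<in>X. a x * poly p x)"
proof -
  obtain P where P: "degree P = n" "P \<noteq> 0" "\<And>q. q = 0 \<or> degree q < n \<Longrightarrow> L (P * q) = 0"
    by (rule orthogonal_poly[of n]) blast
  then obtain X c where X: "finite X" "card X = n" "c \<noteq> 0" "P = smult c (\<Prod>x\<in>X. [:-x, 1:])"
    using orthogonal_poly_splits[OF P(2)] P(1,3) by metis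
  \<comment> \<open>Lagrange polynomials of the nodes; their values under L will be the
    weights.\<close>
  define l where "l x = smult (inverse (\<Prod>y\<in>X-{x}. x - y)) (\<Prod>y\<in>X-{x}. [:-y, 1:])" for x
  have l: "poly (l x) y = (if x = y then 1 else 0)" if "x \<in> X" "y \<in> X" for x y
    using that X(1) by (auto simp: l_def poly_prod prod_zero_iff field_simps)
  have deg_l: "degree (l x) < n" if "x \<in> X" for x
  proof -
    have "degree (l x) \<le> card (X - {x})"
      unfolding l_def using degree_smult_le prod_linear_degree(1)[of "X - {x}"] X(1) by (metis finite_Diff)
    also have "\<dots> < n" using that X assms by (simp add: card_Diff_singleton)
    finally show ?thesis .
  qed
  have L: "L p = (\<Sum>x\<in>X. L (l x) * poly p x)" if p: "degree p < 2 * n" for p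
  proof -
    define D where "D = p - (\<Sum>x\<in>X. smult (poly p x) (l x))"
    have "poly D y = 0" if "y \<in> X" for y
    proof -
      have "(\<Sum>x\<in>X. poly p x * poly (l x) y) = (\<Sum>x\<in>X. if x = y then poly p x else 0)"
        using that by (intro sum.cong) (auto simp: l)
      then show ?thesis using that X(1) by (simp add: D_def poly_sum)
    qed
    then have "(\<Prod>x\<in>X. [:-x, 1:]) dvd D" by (intro prod_linear_dvd X) auto
    then have "P dvd D" using X by (simp add: smult_dvd)
    then obtain q where q: "D = P * q" by auto
    have "degree (\<Sum>x\<in>X. smult (poly p x) (l x)) \<le> n"
      using deg_l by (intro degree_sum_le X) (meson degree_smult_le le_trans less_imp_le)
    then have "degree D < 2 * n"
      unfolding D_def using p assms by (intro degree_diff_less) auto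
    then have "q = 0 \<or> degree q < n"
      using P(1,2) q by (cases "q = 0") (auto simp: degree_mult_eq)
    then have "L D = 0" unfolding q by (rule P(3))
    then show ?thesis by (simp add: D_def diff sum smult mult.commute)
  qed
  \<comment> \<open>\<open>l x\<close> and its square agree on the nodes, and the square has degree
    below 2n; so L takes the same value on both, and the square makes it nonnegative.\<close>
  have "L (l x) \<ge> 0" if "x \<in> X" for x
  proof -
    have "degree (l x * l x) < 2 * n"
      using degree_mult_le[of "l x" "l x"] deg_l[OF that] by linarith
    from L[OF this] have "L (l x * l x) = (\<Sum>y\<in>X. L (l y) * (poly (l x) y * poly (l x) y))" by simp
    also have "\<dots> = (\<Sum>y\<in>X. if y = x then L (l y) else 0)"
      using that by (intro sum.cong) (auto simp: l)
    also have "\<dots> = L (l x)" using that X(1) by simp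
    moreover have "l x \<noteq> 0" using l[OF that that] by auto
    ultimately show ?thesis using pos[of "l x"] by linarith
  qed
  then show ?thesis using that[of X "\<lambda>x. L (l x)"] X(1) L by blast
qed

lemma truncated_moment_measure:
  assumes "L 1 = 1"
  obtains M where "real_distribution M"
    "\<And>k. integrable M (\<lambda>x. x ^ k)" "\<And>k. k \<le> n \<Longrightarrow> (\<integral>x. x ^ k \<partial>M) = L (monom 1 k)"
proof -
  \<comment> \<open>With \<open>n + 1\<close> nodes the case n = 0 needs no separate treatment; the
    rule is exact up to degree 2n + 1, which covers n.\<close>
  obtain X a where X: "finite X" and a: "\<And>x. x \<in> X \<Longrightarrow> a x \<ge> 0"
    and La: "\<And>p. degree p < 2 * (n + 1) \<Longrightarrow> L p = (\<Sum>x\<in>X. a x * poly p x)"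
    using gauss_quadrature[of "n + 1"] by auto
  define f where "f x = (if x \<in> X then a x else 0)" for x
  have "(\<Sum>x\<in>X. f x) = 1" using La[of 1] assms by (simp add: f_def)
  then have "(\<integral>\<^sup>+x. ennreal (f x) \<partial>count_space UNIV) = 1"
    using X a by (subst nn_integral_count_space'[of X]) (auto simp: f_def sum_ennreal)
  then have pmf: "pmf (embed_pmf f) x = f x" for x
    by (intro pmf_embed_pmf) (auto simp: f_def a)
  define M where "M = distr (measure_pmf (embed_pmf f)) borel (\<lambda>x. x)"
  have int: "(\<integral>x. x ^ k \<partial>M) = (\<Sum>x\<in>X. a x * x ^ k)" for k
  proof -
    have "(\<integral>x. x ^ k \<partial>M) = (\<integral>x. x ^ k \<partial>measure_pmf (embed_pmf f))"
      unfolding M_def by (rule integral_distr) auto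
    also have "\<dots> = (\<Sum>x\<in>X. x ^ k * f x)"
      using X by (subst integral_measure_pmf_real[of X]) (auto simp: pmf set_pmf_eq f_def split: if_splits)
    finally show ?thesis by (simp add: f_def mult.commute)
  qed
  have "real_distribution M" unfolding M_def
    by (intro prob_space.real_distribution_distr prob_space_measure_pmf) auto
  moreover have "integrable M (\<lambda>x. x ^ k)" for k
    unfolding M_def using X
    by (subst integrable_distr_eq)
       (auto intro!: integrable_measure_pmf_finite finite_subset[OF _ X] simp: set_pmf_eq pmf f_def split: if_splits)
  moreover have "(\<integral>x. x ^ k \<partial>M) = L (monom 1 k)" if "k \<le> n" for k
    unfolding int using that by (subst La) (auto simp: degree_monom_eq poly_monom)
  ultimately show ?thesis using that by blast
qed

end

section \<open>Convergence of moments along weak limits\<close>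

text \<open>The price of replacing a power by a bounded continuous function. Beyond R \<ge> 1 the
  power of order k is at most 1 / R times that of order k + 1; rounding up to the even exponent
  \<open>2 * (k + 1)\<close> lets a moment control it without absolute values.\<close>

lemma abs_power_diff_clip_le:
  fixes x R :: real
  assumes "R \<ge> 1"
  shows "\<bar>x ^ k - (max (-R) (min R x)) ^ k\<bar> \<le> 2 * x ^ (2 * (k + 1)) / R"
proof (cases "\<bar>x\<bar> \<le> R")
  case True
  then have "max (-R) (min R x) = x" by (auto simp: max_def min_def)
  moreover have "0 \<le> 2 * x ^ (2 * (k + 1)) / R"
    using assms zero_le_even_power[of "2 * (k + 1)" x] by (intro divide_nonneg_nonneg mult_nonneg_nonneg) auto
  ultimately show ?thesis by (simp only: diff_self abs_zero)
next
  case False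
  define g where "g = max (-R) (min R x)"
  have "\<bar>g\<bar> \<le> \<bar>x\<bar>" using assms by (auto simp: g_def max_def min_def)
  then have "\<bar>g ^ k\<bar> \<le> \<bar>x\<bar> ^ k" by (simp add: power_abs power_mono)
  then have "\<bar>x ^ k - g ^ k\<bar> \<le> 2 * \<bar>x\<bar> ^ k"
    using abs_triangle_ineq4[of "x ^ k" "g ^ k"] by (simp add: power_abs)
  also have "\<dots> \<le> 2 * x ^ (2 * (k + 1)) / R"
  proof -
    have "\<bar>x\<bar> ^ k * R \<le> \<bar>x\<bar> ^ k * \<bar>x\<bar>" using False by (intro mult_left_mono) auto
    also have "\<dots> = \<bar>x\<bar> ^ (k + 1)" by simp
    also have "\<dots> \<le> \<bar>x\<bar> ^ (2 * (k + 1))" using False assms by (intro power_increasing) auto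
    also have "\<dots> = x ^ (2 * (k + 1))" by (simp add: power_even_abs)
    finally show ?thesis using assms by (simp add: field_simps)
  qed
  finally show ?thesis by (simp add: g_def)
qed

lemma abs_power_le: "\<bar>x ^ k\<bar> \<le> 1 + (x::real) ^ (2 * k)"
proof -
  have "0 \<le> (\<bar>x ^ k\<bar> - 1)\<^sup>2" by simp
  then have "2 * \<bar>x ^ k\<bar> \<le> 1 + (x ^ k)\<^sup>2" by (simp add: power2_eq_square algebra_simps abs_mult_self_eq)
  then show ?thesis by (simp add: power_mult[symmetric] power_even_eq mult.commute)
qed

lemma tight_if_second_moments_bounded:
  fixes M :: "nat \<Rightarrow> real measure"
  assumes M: "\<And>n. real_distribution (M n)"
    and i: "\<And>n. integrable (M n) (\<lambda>x. x ^ 2)"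
    and B: "\<And>n. (\<integral>x. x ^ 2 \<partial>M n) \<le> B"
  shows "tight M"
  unfolding tight_def
proof (intro conjI allI impI)
  fix e :: real assume e: "e > 0"
  have "B \<ge> 0"
    by (rule order_trans[OF _ B[of 0]]) (simp add: Bochner_Integration.integral_nonneg)
  \<comment> \<open>Chosen so that B < R * e and R \<ge> 1; Chebyshev's bound B / R^2 is then at
    most B / R, which is below e.\<close>
  define R where "R = 1 + (B + 1) / e"
  have "R * e = e + B + 1" using e by (simp add: R_def field_simps)
  moreover have "R \<ge> 1" using e \<open>B \<ge> 0\<close> by (simp add: R_def)
  moreover from this have "R \<le> R ^ 2" by (intro self_le_power) auto
  ultimately have R: "R \<ge> 1" "R \<le> R ^ 2" "B < R * e"
    using e by linarith+
  have "measure (M n) {-R<..R} > 1 - e" for n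
  proof -
    interpret real_distribution "M n" by fact
    have "prob {x\<in>space (M n). R ^ 2 \<le> x ^ 2} \<le> (\<integral>x. x ^ 2 \<partial>M n) / R ^ 2"
      using R by (intro integral_Markov_inequality_measure[where A = "{}"] i) (auto simp: zero_less_power)
    also have "\<dots> \<le> B / R ^ 2" using B R by (intro divide_right_mono) auto
    also have "\<dots> \<le> B / R" using R \<open>B \<ge> 0\<close> by (intro divide_left_mono) auto
    also have "\<dots> < e" using R by (simp add: field_simps)
    finally have "prob {x\<in>space (M n). R ^ 2 \<le> x ^ 2} < e" .
    moreover have "{x\<in>space (M n). R ^ 2 \<le> x ^ 2} \<in> events" by measurable
    moreover have "1 - prob {x\<in>space (M n). R ^ 2 \<le> x ^ 2} \<le> prob {-R<..R}"
    proof -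
      have "prob (space (M n) - {x\<in>space (M n). R ^ 2 \<le> x ^ 2}) \<le> prob {-R<..R}"
        using R by (intro finite_measure_mono) (auto simp: abs_le_square_iff[symmetric] not_le)
      then show ?thesis by (subst (asm) prob_compl) auto
    qed
    ultimately show ?thesis by linarith
  qed
  then show "\<exists>a b. a < b \<and> (\<forall>n. 1 - e < measure (M n) {a<..b})"
    using R by (intro exI[of _ "-R"] exI[of _ R]) auto
qed (rule M)

text \<open>Bounded second moments give a weakly convergent subsequence. Weak convergence alone does
  not transport moments; bounds on a higher even moment, uniform along the sequence and inherited by
  the limit, make the truncation error small.\<close>

lemma moment_limit:
  fixes M :: "nat \<Rightarrow> real measure" and m :: "nat \<Rightarrow> real"
  assumes M: "\<And>n. real_distribution (M n)"
    and i: "\<And>n k. integrable (M n) (\<lambda>x. x ^ k)"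
    and lim: "\<And>k. (\<lambda>n. \<integral>x. x ^ k \<partial>M n) \<longlonglongrightarrow> m k"
  obtains N where "real_distribution N" "\<And>k. integrable N (\<lambda>x. x ^ k)"
    "\<And>k. (\<integral>x. x ^ k \<partial>N) = m k"
proof -
  have "\<exists>B. \<forall>n. \<bar>\<integral>x. x ^ k \<partial>M n\<bar> \<le> B" for k
    using convergent_imp_Bseq[OF convergentI[OF lim[of k]]] by (auto simp: Bseq_def)
  then obtain B where B: "\<And>k n. \<bar>\<integral>x. x ^ k \<partial>M n\<bar> \<le> B k" by metis
  have B': "(\<integral>x. x ^ k \<partial>M n) \<le> B k" for k n by (rule order_trans[OF abs_ge_self B])
  have "tight M" using M i B' by (rule tight_if_second_moments_bounded)
  from tight_imp_convergent_subsubsequence[OF this strict_mono_id]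
  obtain r N where r: "strict_mono (r :: nat \<Rightarrow> nat)" and N: "real_distribution N"
    and conv: "weak_conv_m (M \<circ> id \<circ> r) N" by blast
  interpret N: real_distribution N by fact
  have wc: "(\<lambda>n. \<integral>x. f x \<partial>M (r n)) \<longlonglongrightarrow> (\<integral>x. f x \<partial>N)"
    if "\<And>x. isCont f x" "\<And>x. norm (f x) \<le> b" for f :: "real \<Rightarrow> real" and b
    using weak_conv_imp_integral_bdd_continuous_conv[of "M \<circ> id \<circ> r" N f b] M N conv that by simp
  \<comment> \<open>Cut off at height R, even powers are bounded and continuous, so the bound passes
    to N; monotone convergence removes the cut-off.\<close>
  have even: "integrable N (\<lambda>x. x ^ (2 * k)) \<and> (\<integral>x. x ^ (2 * k) \<partial>N) \<le> B (2 * k)" for k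
  proof -
    have le: "(\<integral>x. min (x ^ (2 * k)) (real R) \<partial>N) \<le> B (2 * k)" for R
    proof (rule LIMSEQ_le_const2[OF wc[of _ "real R"]])
      have "(\<integral>x. min (x ^ (2 * k)) (real R) \<partial>M (r n)) \<le> B (2 * k)" for n
      proof -
        interpret Mn: real_distribution "M (r n)" by (rule M)
        have "(\<integral>x. min (x ^ (2 * k)) (real R) \<partial>M (r n)) \<le> (\<integral>x. x ^ (2 * k) \<partial>M (r n))"
          by (intro integral_mono i Mn.integrable_const_bound[where B = "real R"]) auto
        also have "\<dots> \<le> B (2 * k)" by (rule B')
        finally show ?thesis .
      qed
      then show "\<exists>N. \<forall>n\<ge>N. (\<integral>x. min (x ^ (2 * k)) (real R) \<partial>M (r n)) \<le> B (2 * k)" by blast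
    next
      show "isCont (\<lambda>x. min (x ^ (2 * k)) (real R)) x" for x :: real by (intro continuous_intros)
      show "norm (min (x ^ (2 * k)) (real R)) \<le> real R" for x :: real
        using zero_le_even_power[of "2 * k" x] by (auto simp: min_def)
    qed
    have int: "integrable N (\<lambda>x. min (x ^ (2 * k)) (real R))" for R
      by (intro N.integrable_const_bound[where B = "real R"]) auto
    have "incseq (\<lambda>R. \<integral>x. min (x ^ (2 * k)) (real R) \<partial>N)"
      by (intro incseq_SucI integral_mono int) auto
    then obtain I where I: "(\<lambda>R. \<integral>x. min (x ^ (2 * k)) (real R) \<partial>N) \<longlonglongrightarrow> I"
      using incseq_convergent le by blast
    have "has_bochner_integral N (\<lambda>x. x ^ (2 * k)) I"
    proof (rule has_bochner_integral_monotone_convergence[OF _ _ _ I])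
      show "integrable N (\<lambda>x. min (x ^ (2 * k)) (real R))" for R
        by (rule int)
      show "AE x in N. mono (\<lambda>n. min (x ^ (2 * k)) (real n))"
        by (auto intro!: AE_I2 monoI)
      show "AE x in N. (\<lambda>i. min (x ^ (2 * k)) (real i)) \<longlonglongrightarrow> x ^ (2 * k)"
      proof (rule AE_I2)
        fix x :: real
        have "eventually (\<lambda>i. x ^ (2 * k) = min (x ^ (2 * k)) (real i)) sequentially"
          using eventually_ge_at_top[of "nat \<lceil>x ^ (2 * k)\<rceil>"] by eventually_elim (auto simp: min_def nat_ceiling_le_eq)
        then show "(\<lambda>i. min (x ^ (2 * k)) (real i)) \<longlonglongrightarrow> x ^ (2 * k)"
          by (rule Lim_transform_eventually[OF tendsto_const])
      qed
    qed auto
    then have "integrable N (\<lambda>x. x ^ (2 * k))" "(\<integral>x. x ^ (2 * k) \<partial>N) = I"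
      by (auto simp: has_bochner_integral_iff)
    moreover have "I \<le> B (2 * k)" using le by (intro LIMSEQ_le_const2[OF I]) auto
    ultimately show ?thesis by simp
  qed
  have iN: "integrable N (\<lambda>x. x ^ k)" for k
    by (rule Bochner_Integration.integrable_bound[of _ "\<lambda>x. 1 + x ^ (2 * k)"])
       (use even[of k] in \<open>auto intro!: AE_I2 order_trans[OF abs_power_le] simp del: power_abs\<close>)
  have "(\<integral>x. x ^ k \<partial>N) = m k" for k
  proof -
    define b where "b = B (2 * (k + 1))"
    define g where "g R x = (max (-R) (min R x)) ^ k" for R x :: real
    have diff: "\<bar>(\<integral>x. x ^ k \<partial>K) - (\<integral>x. g R x \<partial>K)\<bar> \<le> 2 * b / R"
      if R: "R \<ge> 1" and K: "real_distribution K" "\<And>k. integrable K (\<lambda>x. x ^ k)" "(\<integral>x. x ^ (2 * (k + 1)) \<partial>K) \<le> b" for R K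
    proof -
      interpret K: real_distribution K by fact
      have ig: "integrable K (g R)"
        using R unfolding g_def
        by (intro K.integrable_const_bound[where B = "R ^ k"]) (auto simp: power_abs intro!: AE_I2 power_mono)
      have "\<bar>(\<integral>x. x ^ k \<partial>K) - (\<integral>x. g R x \<partial>K)\<bar> = \<bar>\<integral>x. x ^ k - g R x \<partial>K\<bar>"
        using K ig by simp
      also have "\<dots> \<le> (\<integral>x. \<bar>x ^ k - g R x\<bar> \<partial>K)" by (rule integral_abs_bound)
      also have "\<dots> \<le> (\<integral>x. 2 * x ^ (2 * (k + 1)) / R \<partial>K)"
      proof (rule integral_mono)
        show "integrable K (\<lambda>x. \<bar>x ^ k - g R x\<bar>)"
          by (intro integrable_abs Bochner_Integration.integrable_diff K(2) ig)
        show "integrable K (\<lambda>x. 2 * x ^ (2 * (k + 1)) / R)"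
          using K(2)[of "2 * (k + 1)"] by simp
        show "\<bar>x ^ k - g R x\<bar> \<le> 2 * x ^ (2 * (k + 1)) / R" for x
          unfolding g_def by (rule abs_power_diff_clip_le[OF R])
      qed
      also have "\<dots> = 2 * (\<integral>x. x ^ (2 * (k + 1)) \<partial>K) / R" by simp
      also have "\<dots> \<le> 2 * b / R" using K(3) R by (intro divide_right_mono) auto
      finally show ?thesis .
    qed
    \<comment> \<open>Two truncation errors of at most \<open>2 * b / R\<close> each, one along the
      subsequence and one for its limit.\<close>
    have main: "\<bar>(\<integral>x. x ^ k \<partial>N) - m k\<bar> \<le> 4 * b / R" if R: "R \<ge> 1" for R
    proof -
      have c: "(\<lambda>n. \<integral>x. g R x \<partial>M (r n)) \<longlonglongrightarrow> (\<integral>x. g R x \<partial>N)"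
        using R unfolding g_def
        by (intro wc[of _ "R ^ k"]) (auto intro!: continuous_intros power_mono simp: power_abs)
      have "(\<lambda>n. \<integral>x. x ^ k \<partial>M (r n)) \<longlonglongrightarrow> m k"
        using LIMSEQ_subseq_LIMSEQ[OF lim[of k] r] by (simp add: comp_def)
      from tendsto_rabs[OF tendsto_diff[OF this c]]
      have "\<bar>m k - (\<integral>x. g R x \<partial>N)\<bar> \<le> 2 * b / R"
      proof (rule LIMSEQ_le_const2, intro exI allI impI)
        show "\<bar>(\<integral>x. x ^ k \<partial>M (r n)) - (\<integral>x. g R x \<partial>M (r n))\<bar> \<le> 2 * b / R" for n
          by (rule diff[OF R M i]) (simp only: b_def B')
      qed
      moreover have "\<bar>(\<integral>x. x ^ k \<partial>N) - (\<integral>x. g R x \<partial>N)\<bar> \<le> 2 * b / R"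
        using diff[OF R N iN] even[of "k + 1"] by (simp add: b_def)
      ultimately show ?thesis by linarith
    qed
    have "(\<lambda>R. 4 * b / real (Suc R)) \<longlonglongrightarrow> 0" by real_asymp
    then have "\<bar>(\<integral>x. x ^ k \<partial>N) - m k\<bar> \<le> 0"
      by (rule LIMSEQ_le_const) (use main in auto)
    then show ?thesis by simp
  qed
  with N iN that show ?thesis by blast
qed


section \<open>Existence of representing measures\<close>

text \<open>A semidefinite sequence may belong to a finitely supported measure, where orthogonal
  polynomials break off. Mixing in a little of Lebesgue measure on [0,1] restores strictness; the
  mixtures are represented up to any given order by quadrature, and the mixing weight tends to
  0.\<close>

lemma hamburger:
  fixes m :: "nat \<Rightarrow> real"
  assumes m0: "m 0 = 1"
    and psd: "\<And>(c :: nat \<Rightarrow> real) n. 0 \<le> (\<Sum>i\<le>n. \<Sum>j\<le>n. c i * c j * m (i + j))"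
  obtains M where "real_distribution M" "\<And>k. integrable M (\<lambda>x. x ^ k)"
    "\<And>k. (\<integral>x. x ^ k \<partial>M) = m k"
proof -
  define L where "L p = (\<Sum>i\<le>degree p. coeff p i * m i)" for p
  have L: "L p = (\<Sum>i\<le>n. coeff p i * m i)" if "degree p \<le> n" for p n
    unfolding L_def using that by (intro sum.mono_neutral_left) (auto simp: coeff_eq_0)
  have L_add: "L (p + q) = L p + L q" for p q
  proof -
    define n where "n = max (degree p) (degree q)"
    have "degree (p + q) \<le> n" "degree p \<le> n" "degree q \<le> n"
      by (auto simp: n_def degree_add_le_max)
    then show ?thesis by (simp add: L[where n = n] sum.distrib algebra_simps)
  qed
  have L_smult: "L (smult c p) = c * L p" for c p
    by (simp add: L[OF degree_smult_le] L_def[of p] sum_distrib_left mult.assoc)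
  have L_monom: "L (monom c k) = c * m k" for c k
    using L[OF degree_monom_le, of c k] by (simp add: if_distrib[of "\<lambda>a. a * _"] cong: if_cong)
  have L_0: "L 0 = 0" by (simp add: L_def)
  have L_sum: "L (\<Sum>x\<in>A. f x) = (\<Sum>x\<in>A. L (f x))" for f and A :: "nat set"
    by (induction A rule: infinite_finite_induct) (auto simp: L_add L_0)
  have L_pos: "0 \<le> L (p * p)" for p
  proof -
    have "p * p = (\<Sum>i\<le>degree p. \<Sum>j\<le>degree p. monom (coeff p i * coeff p j) (i + j))"
      by (subst (1 2) poly_as_sum_of_monoms[symmetric]) (simp add: sum_product mult_monom)
    then have "L (p * p) = (\<Sum>i\<le>degree p. \<Sum>j\<le>degree p. coeff p i * coeff p j * m (i + j))"
      by (simp add: L_sum L_monom)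
    then show ?thesis using psd by simp
  qed
  define J where "J p = integral {0..1} (poly p)" for p :: "real poly"
  have ip: "poly p integrable_on {0..1}" for p :: "real poly"
    by (intro integrable_continuous_real continuous_intros)
  have J_pos: "J (p * p) > 0" if "p \<noteq> 0" for p
  proof -
    have "J (p * p) \<noteq> 0"
    proof
      assume "J (p * p) = 0"
      then have "\<forall>x\<in>{0..1}. poly (p * p) x = 0"
        unfolding J_def by (subst (asm) integral_eq_0_iff) (auto intro!: continuous_intros)
      then have "{0..1} \<subseteq> {x. poly p x = 0}" by auto
      then show False
        using poly_roots_finite[OF that] by (metis finite_subset infinite_Icc zero_less_one)
    qed
    moreover have "J (p * p) \<ge> 0" unfolding J_def by (intro integral_nonneg ip) auto
    ultimately show ?thesis by linarith
  qed
  \<comment> \<open>The double successor keeps both \<open>e n\<close> and \<open>1 - e n\<close>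
    positive for every n.\<close>
  define e where "e n = inverse (real (Suc (Suc n)))" for n
  have e: "0 < e n" "e n < 1" for n by (auto simp: e_def field_simps)
  define K where "K n p = (1 - e n) * L p + e n * J p" for n p
  have J1: "J 1 = 1"
  proof -
    have "poly (1 :: real poly) = (\<lambda>_. 1)" by (simp add: fun_eq_iff)
    then show ?thesis by (simp add: J_def)
  qed
  have "\<exists>M. real_distribution M \<and> (\<forall>k. integrable M (\<lambda>x. x ^ k)) \<and>
      (\<forall>k\<le>n. (\<integral>x. x ^ k \<partial>M) = K n (monom 1 k))" for n
  proof -
    interpret positive_functional "K n"
    proof
      show "K n (p + q) = K n p + K n q" for p q
      proof -
        have "poly (p + q) = (\<lambda>x. poly p x + poly q x)" by (simp add: fun_eq_iff)
        then have "J (p + q) = J p + J q" by (simp add: J_def integral_add[OF ip ip])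
        then show ?thesis by (simp add: K_def L_add algebra_simps)
      qed
      show "K n (smult c p) = c * K n p" for c p
      proof -
        have "poly (smult c p) = (\<lambda>x. c * poly p x)" by (simp add: fun_eq_iff)
        then have "J (smult c p) = c * J p" by (simp add: J_def)
        then show ?thesis by (simp add: K_def L_smult algebra_simps)
      qed
      show "0 < K n (p * p)" if "p \<noteq> 0" for p
        unfolding K_def using e[of n] L_pos[of p] J_pos[OF that] by (intro add_nonneg_pos) auto
    qed
    have "K n 1 = 1"
    proof -
      have "L 1 = L (monom 1 0)" by (simp only: monom_eq_1)
      then have "L 1 = 1" by (simp only: L_monom m0 mult_1)
      then show ?thesis by (simp add: K_def J1)
    qed
    then show ?thesis by (rule truncated_moment_measure[of n]) blast
  qed
  then obtain M where M: "\<And>n. real_distribution (M n)" "\<And>n k. integrable (M n) (\<lambda>x. x ^ k)"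
    "\<And>n k. k \<le> n \<Longrightarrow> (\<integral>x. x ^ k \<partial>M n) = K n (monom 1 k)"
    by metis
  have lim: "(\<lambda>n. \<integral>x. x ^ k \<partial>M n) \<longlonglongrightarrow> m k" for k
  proof -
    have "e \<longlonglongrightarrow> 0" unfolding e_def by real_asymp
    then have "(\<lambda>n. K n (monom 1 k)) \<longlonglongrightarrow> (1 - 0) * L (monom 1 k) + 0 * J (monom 1 k)"
      unfolding K_def by (intro tendsto_intros)
    then have "(\<lambda>n. K n (monom 1 k)) \<longlonglongrightarrow> m k" by (simp add: L_monom)
    moreover have "eventually (\<lambda>n. K n (monom 1 k) = (\<integral>x. x ^ k \<partial>M n)) sequentially"
      using eventually_ge_at_top[of k] by eventually_elim (simp add: M(3))
    ultimately show ?thesis by (rule Lim_transform_eventually)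
  qed
  show ?thesis by (rule moment_limit[OF M(1,2) lim]) (rule that)
qed

section \<open>Moments of kernels\<close>

text \<open>Arbitrary sets of positions are allowed, because moments will be split over subsets that
  are not initial segments.\<close>

definition pairings :: "nat set \<Rightarrow> nat set set set" where
  "pairings A = {\<pi>. partition_on A \<pi> \<and> (\<forall>B\<in>\<pi>. card B = 2)}"

text \<open>Position i applies \<open>f i\<close> to the coordinate of its block. An indicator
  confines that coordinate to a part of the unit interval, which is how positions acquire
  colours.\<close>

definition pairing_density :: "(real \<Rightarrow> real \<Rightarrow> real) \<Rightarrow> (nat \<Rightarrow> real \<Rightarrow> real) \<Rightarrow> nat set set \<Rightarrow> (nat set \<Rightarrow> real) \<Rightarrow> real" where
  "pairing_density w f \<pi> x =
     (\<Prod>B\<in>\<pi>. \<Prod>i\<in>B. f i (x B)) * (\<Prod>(U, V)\<in>crossing_edges \<pi>. w (x U) (x V))"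

abbreviation uniform :: "real measure" where
  "uniform \<equiv> restrict_space lborel {0..1}"

definition pairing_weight :: "(real \<Rightarrow> real \<Rightarrow> real) \<Rightarrow> (nat \<Rightarrow> real \<Rightarrow> real) \<Rightarrow> nat set set \<Rightarrow> real" where
  "pairing_weight w f \<pi> = (\<integral>x. pairing_density w f \<pi> x \<partial>(\<Pi>\<^sub>M B\<in>\<pi>. uniform))"

definition word_moment :: "(real \<Rightarrow> real \<Rightarrow> real) \<Rightarrow> (nat \<Rightarrow> real \<Rightarrow> real) \<Rightarrow> nat set \<Rightarrow> real" where
  "word_moment w f A = (\<Sum>\<pi>\<in>pairings A. pairing_weight w f \<pi>)"

lemma kernel_moment_atLeastAtMost: "kernel_moment w p = word_moment w (\<lambda>_ _. 1) {1..p}"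
  by (simp add: kernel_moment_def word_moment_def pairing_weight_def pairing_density_def
      pairings_def pair_partitions_def)

lemma prob_space_uniform: "prob_space uniform"
  by (rule prob_spaceI) (simp add: space_restrict_space emeasure_restrict_space)

interpretation uniform: prob_space uniform by (rule prob_space_uniform)

interpretation uniform_product: product_prob_space "\<lambda>_. uniform" UNIV
  by unfold_locales

lemma space_uniform [simp]: "space uniform = {0..1}"
  by (simp add: space_restrict_space)

lemma measurable_uniform [measurable (raw)]:
  assumes "f \<in> M \<rightarrow>\<^sub>M uniform"
  shows "f \<in> borel_measurable M"
proof -
  have "(\<lambda>x. x) \<in> uniform \<rightarrow>\<^sub>M borel" by (intro measurable_restrict_space1) simp
  from measurable_compose[OF assms this] show ?thesis by simp
qed

subsection \<open>Pair partitions\<close>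

lemma pairingsD:
  assumes "\<pi> \<in> pairings A"
  shows "\<Union>\<pi> = A" "\<And>U V. U \<in> \<pi> \<Longrightarrow> V \<in> \<pi> \<Longrightarrow> U \<noteq> V \<Longrightarrow> U \<inter> V = {}"
    "\<And>U. U \<in> \<pi> \<Longrightarrow> card U = 2" "\<And>U. U \<in> \<pi> \<Longrightarrow> finite U" "\<And>U. U \<in> \<pi> \<Longrightarrow> U \<noteq> {}" "\<And>U. U \<in> \<pi> \<Longrightarrow> U \<subseteq> A"
  using assms unfolding pairings_def partition_on_def disjoint_def
  by (auto intro: card_ge_0_finite)

lemma finite_pairings: "finite A \<Longrightarrow> finite (pairings A)"
  by (rule finite_subset[of _ "Pow (Pow A)"]) (auto simp: pairings_def partition_on_def)

lemma finite_pairing: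
  assumes "\<pi> \<in> pairings A" "finite A"
  shows "finite \<pi>"
  using assms by (intro finite_subset[of \<pi> "Pow A"]) (auto dest: pairingsD(6))

lemma card_pairing:
  assumes "\<pi> \<in> pairings A" "finite A"
  shows "card A = 2 * card \<pi>"
proof -
  have "card (\<Union>\<pi>) = (\<Sum>B\<in>\<pi>. card B)"
    using assms by (intro card_Union_disjoint) (auto simp: pairwise_def disjnt_def dest: pairingsD)
  also have "\<dots> = (\<Sum>B\<in>\<pi>. 2)" using pairingsD(3)[OF assms(1)] by simp
  finally show ?thesis using pairingsD(1)[OF assms(1)] by simp
qed

lemma pairings_empty: "pairings {} = {{}}"
  by (auto simp: pairings_def partition_on_def)

lemma pairings_remove_block:
  assumes "\<pi> \<in> pairings A" "U \<in> \<pi>"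
  shows "\<pi> - {U} \<in> pairings (A - U)"
proof -
  have "\<Union>(\<pi> - {U}) = A - U"
    using pairingsD(1,2)[OF assms(1)] assms(2) by blast
  then show ?thesis
    using assms by (auto simp: pairings_def partition_on_def disjoint_def)
qed

text \<open>Among 2n + 2 points a fixed one has 2n + 1 possible partners, rounded up to 2n + 2 so
  that the product takes the form accepted by \<open>moment_determinacy\<close>.\<close>

lemma card_pairings_le:
  assumes "finite A" "card A = 2 * n"
  shows "card (pairings A) \<le> 2 ^ n * fact n"
  using assms
proof (induction n arbitrary: A)
  case 0
  then show ?case by (simp add: pairings_empty)
next
  case (Suc n)
  then obtain a where a: "a \<in> A" by fastforce
  have "pairings A \<subseteq> (\<Union>b\<in>A - {a}. insert {a, b} ` pairings (A - {a, b}))"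
  proof
    fix \<pi> assume \<pi>: "\<pi> \<in> pairings A"
    then obtain U where U: "U \<in> \<pi>" "a \<in> U" using a pairingsD(1) by blast
    then obtain b where b: "U = {a, b}" "a \<noteq> b"
      using pairingsD(3)[OF \<pi> U(1)] by (auto simp: card_2_iff)
    have "\<pi> - {U} \<in> pairings (A - U)" by (rule pairings_remove_block[OF \<pi> U(1)])
    moreover have "\<pi> = insert U (\<pi> - {U})" using U by auto
    moreover have "b \<in> A - {a}" using pairingsD(6)[OF \<pi> U(1)] b by auto
    ultimately show "\<pi> \<in> (\<Union>b\<in>A - {a}. insert {a, b} ` pairings (A - {a, b}))"
      using b by blast
  qed
  then have "card (pairings A) \<le> card (\<Union>b\<in>A - {a}. insert {a, b} ` pairings (A - {a, b}))"
    using Suc.prems by (intro card_mono) (auto intro!: finite_pairings)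
  also have "\<dots> \<le> (\<Sum>b\<in>A - {a}. card (insert {a, b} ` pairings (A - {a, b})))"
    using Suc.prems by (intro card_UN_le) auto
  also have "\<dots> \<le> (\<Sum>b\<in>A - {a}. 2 ^ n * fact n)"
  proof (rule sum_mono)
    fix b assume b: "b \<in> A - {a}"
    have "card (A - {a, b}) = 2 * n"
      using Suc.prems a b by (subst card_Diff_subset) auto
    from Suc.IH[OF _ this] have "card (pairings (A - {a, b})) \<le> 2 ^ n * fact n"
      using Suc.prems by auto
    moreover have "card (insert {a, b} ` pairings (A - {a, b})) \<le> card (pairings (A - {a, b}))"
      using Suc.prems by (intro card_image_le finite_pairings) auto
    ultimately show "card (insert {a, b} ` pairings (A - {a, b})) \<le> 2 ^ n * fact n" by linarith
  qed
  also have "\<dots> = (2 * n + 1) * (2 ^ n * fact n)" using Suc.prems a by simp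
  also have "\<dots> \<le> (2 * n + 2) * (2 ^ n * fact n)" by (intro mult_right_mono) auto
  also have "\<dots> = 2 ^ Suc n * fact (Suc n)" by (simp add: algebra_simps)
  finally show ?case .
qed

text \<open>Turns a sum over pairings without blocks that mix A and B into a double sum. Such a
  pairing is cut into its blocks inside A and those inside B; blocks being nonempty, the cut is
  unique.\<close>

lemma pairings_Un_iff:
  assumes "A \<inter> B = {}"
  shows "(\<lambda>(\<rho>, \<sigma>). \<rho> \<union> \<sigma>) ` (pairings A \<times> pairings B) = {\<pi>\<in>pairings (A \<union> B). \<forall>U\<in>\<pi>. U \<subseteq> A \<or> U \<subseteq> B}"
proof (intro equalityI subsetI)
  fix \<pi> assume "\<pi> \<in> (\<lambda>(\<rho>, \<sigma>). \<rho> \<union> \<sigma>) ` (pairings A \<times> pairings B)"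
  then obtain \<rho> \<sigma> where \<pi>: "\<pi> = \<rho> \<union> \<sigma>" and \<rho>: "\<rho> \<in> pairings A" and \<sigma>: "\<sigma> \<in> pairings B"
    by auto
  have "partition_on (A \<union> B) \<pi>"
  proof (rule partition_onI)
    show "\<Union>\<pi> = A \<union> B" using pairingsD(1)[OF \<rho>] pairingsD(1)[OF \<sigma>] \<pi> by auto
    show "disjnt U V" if "U \<in> \<pi>" "V \<in> \<pi>" "U \<noteq> V" for U V
    proof -
      have "U \<inter> V = {}" if "U \<in> \<rho>" "V \<in> \<sigma>" for U V
        using pairingsD(6)[OF \<rho> that(1)] pairingsD(6)[OF \<sigma> that(2)] assms by auto
      then show ?thesis
        using that pairingsD(2)[OF \<rho>] pairingsD(2)[OF \<sigma>] unfolding \<pi> disjnt_def by (metis Int_commute Un_iff)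
    qed
  qed (use pairingsD(5)[OF \<rho>] pairingsD(5)[OF \<sigma>] \<pi> in auto)
  then show "\<pi> \<in> {\<pi>\<in>pairings (A \<union> B). \<forall>U\<in>\<pi>. U \<subseteq> A \<or> U \<subseteq> B}"
  proof -
    have "U \<subseteq> A \<or> U \<subseteq> B" "card U = 2" if "U \<in> \<pi>" for U
      using that pairingsD(3,6)[OF \<rho>, of U] pairingsD(3,6)[OF \<sigma>, of U] \<pi> by auto
    then show ?thesis using \<open>partition_on (A \<union> B) \<pi>\<close> by (simp add: pairings_def)
  qed
next
  fix \<pi> assume \<pi>: "\<pi> \<in> {\<pi>\<in>pairings (A \<union> B). \<forall>U\<in>\<pi>. U \<subseteq> A \<or> U \<subseteq> B}"
  define \<rho> \<sigma> where "\<rho> = {U\<in>\<pi>. U \<subseteq> A}" and "\<sigma> = {U\<in>\<pi>. U \<subseteq> B}"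
  have cover: "\<exists>U\<in>\<pi>. a \<in> U" if "a \<in> A \<union> B" for a
    using that pairingsD(1)[of \<pi> "A \<union> B"] \<pi> by blast
  have "\<exists>U\<in>\<rho>. a \<in> U" if "a \<in> A" for a
    using cover[of a] that assms \<pi> unfolding \<rho>_def by blast
  moreover have "\<exists>U\<in>\<sigma>. a \<in> U" if "a \<in> B" for a
    using cover[of a] that assms \<pi> unfolding \<sigma>_def by blast
  ultimately have "\<Union>\<rho> = A" "\<Union>\<sigma> = B"
    by (auto simp: \<rho>_def \<sigma>_def)
  then have "\<rho> \<in> pairings A" "\<sigma> \<in> pairings B"
    using \<pi> by (auto simp: pairings_def partition_on_def disjoint_def \<rho>_def \<sigma>_def)
  moreover have "\<pi> = \<rho> \<union> \<sigma>" using \<pi> by (auto simp: \<rho>_def \<sigma>_def)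
  ultimately show "\<pi> \<in> (\<lambda>(\<rho>, \<sigma>). \<rho> \<union> \<sigma>) ` (pairings A \<times> pairings B)" by auto
qed

lemma pairings_Un_cases:
  assumes "\<rho> \<in> pairings A" "\<sigma> \<in> pairings B" "A \<inter> B = {}"
  shows "\<rho> = {U\<in>\<rho> \<union> \<sigma>. U \<subseteq> A}" "\<sigma> = {U\<in>\<rho> \<union> \<sigma>. U \<subseteq> B}" "\<rho> \<inter> \<sigma> = {}"
proof -
  have "\<not> (U \<subseteq> A \<and> U \<subseteq> B)" if "U \<in> \<rho> \<union> \<sigma>" for U
    using that assms pairingsD(5)[OF assms(1)] pairingsD(5)[OF assms(2)] by blast
  moreover have "\<forall>U\<in>\<rho>. U \<subseteq> A" "\<forall>U\<in>\<sigma>. U \<subseteq> B"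
    using pairingsD(6)[OF assms(1)] pairingsD(6)[OF assms(2)] by auto
  ultimately show "\<rho> = {U\<in>\<rho> \<union> \<sigma>. U \<subseteq> A}" "\<sigma> = {U\<in>\<rho> \<union> \<sigma>. U \<subseteq> B}" "\<rho> \<inter> \<sigma> = {}"
    by blast+
qed

lemma pairings_Un_inj:
  assumes "A \<inter> B = {}"
  shows "inj_on (\<lambda>(\<rho>, \<sigma>). \<rho> \<union> \<sigma>) (pairings A \<times> pairings B)"
proof (rule inj_onI, clarify)
  fix \<rho> \<sigma> \<rho>' \<sigma>'
  assume "\<rho> \<in> pairings A" "\<sigma> \<in> pairings B" "\<rho>' \<in> pairings A" "\<sigma>' \<in> pairings B" "\<rho> \<union> \<sigma> = \<rho>' \<union> \<sigma>'"
  then show "\<rho> = \<rho>' \<and> \<sigma> = \<sigma>'"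
    using pairings_Un_cases[of \<rho> A \<sigma> B] pairings_Un_cases[of \<rho>' A \<sigma>' B] assms by metis
qed

subsection \<open>Relabelling\<close>

lemma crossing_edges_subset: "crossing_edges \<pi> \<subseteq> \<pi> \<times> \<pi>"
  by (auto simp: crossing_edges_def)

lemma finite_crossing_edges: "finite \<pi> \<Longrightarrow> finite (crossing_edges \<pi>)"
  using crossing_edges_subset[of \<pi>] finite_subset by blast

lemma blocks_cross_commute: "blocks_cross U V \<longleftrightarrow> blocks_cross V U"
  unfolding blocks_cross_def by (simp only: disj_commute)

lemma blocks_cross_image:
  assumes h: "strict_mono_on A h" and "U \<subseteq> A" "V \<subseteq> A"
  shows "blocks_cross (h ` U) (h ` V) \<longleftrightarrow> blocks_cross U V"
proof -
  have less: "h i < h j \<longleftrightarrow> i < j" if "i \<in> A" "j \<in> A" for i j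
    using h that by (metis strict_mono_on_less)
  have iff: "(\<exists>i k j l. i < k \<and> k < j \<and> j < l \<and> i \<in> h ` U \<and> j \<in> h ` U \<and> k \<in> h ` V \<and> l \<in> h ` V) \<longleftrightarrow>
    (\<exists>i k j l. i < k \<and> k < j \<and> j < l \<and> i \<in> U \<and> j \<in> U \<and> k \<in> V \<and> l \<in> V)" (is "?L \<longleftrightarrow> ?R")
    if UV: "U \<subseteq> A" "V \<subseteq> A" for U V
  proof
    assume ?L
    then obtain i k j l where *: "h i < h k" "h k < h j" "h j < h l" "i \<in> U" "j \<in> U" "k \<in> V" "l \<in> V"
      by blast
    then have "i \<in> A" "j \<in> A" "k \<in> A" "l \<in> A" using UV by (blast, blast, blast, blast)
    with * have "i < k" "k < j" "j < l" by (simp_all add: less)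
    with * show ?R by metis
  next
    assume ?R
    then obtain i k j l where *: "i < k" "k < j" "j < l" "i \<in> U" "j \<in> U" "k \<in> V" "l \<in> V" by blast
    then have "i \<in> A" "j \<in> A" "k \<in> A" "l \<in> A" using UV by (blast, blast, blast, blast)
    with * have "h i < h k" "h k < h j" "h j < h l" by (simp_all add: less)
    moreover have "h i \<in> h ` U" "h j \<in> h ` U" "h k \<in> h ` V" "h l \<in> h ` V" using * by auto
    ultimately show ?L by metis
  qed
  have cross: "blocks_cross U V \<longleftrightarrow>
      (\<exists>i k j l. i < k \<and> k < j \<and> j < l \<and> i \<in> U \<and> j \<in> U \<and> k \<in> V \<and> l \<in> V) \<or>
      (\<exists>i k j l. i < k \<and> k < j \<and> j < l \<and> i \<in> V \<and> j \<in> V \<and> k \<in> U \<and> l \<in> U)" for U V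
    unfolding blocks_cross_def by (simp only: insert_subset empty_subsetI simp_thms ex_disj_distrib conj_disj_distribL conj_assoc)
  show ?thesis unfolding cross iff[OF assms(2,3)] iff[OF assms(3,2)] ..
qed

lemma image_Min:
  fixes h :: "nat \<Rightarrow> nat"
  assumes h: "strict_mono_on A h" and "U \<subseteq> A" "finite U" "U \<noteq> {}"
  shows "Min (h ` U) = h (Min U)"
proof (rule Min_eqI)
  fix y assume "y \<in> h ` U"
  then obtain u where u: "u \<in> U" "y = h u" by auto
  have "Min U \<in> U" using assms by (intro Min_in)
  then have "Min U \<in> A" "u \<in> A" "Min U \<le> u" using assms(2,3) u by (blast, blast, simp)
  then show "h (Min U) \<le> y" using h u by (metis strict_mono_on_leD)
qed (use assms in auto)

lemma pairings_image:
  assumes h: "inj_on h A"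
  shows "bij_betw ((`) ((`) h)) (pairings A) (pairings (h ` A))"
proof -
  have inj: "inj_on ((`) h) (Pow A)" using h by (rule inj_on_image_Pow)
  have inj': "inj_on ((`) ((`) h)) (Pow (Pow A))" using inj by (rule inj_on_image_Pow)
  have sub: "pairings A \<subseteq> Pow (Pow A)" for A by (auto simp: pairings_def partition_on_def)
  \<comment> \<open>Stated for all sets and injections, to be applied to the inverse of h as
    well.\<close>
  have to: "(`) h ` \<pi> \<in> pairings (h ` A)" if \<pi>: "\<pi> \<in> pairings A" and h: "inj_on h A" for \<pi> A h
  proof -
    have "card (h ` B) = 2" if "B \<in> \<pi>" for B
      using pairingsD(3,6)[OF \<pi> that] h by (metis card_image inj_on_subset)
    moreover have "partition_on (h ` A) ((`) h ` \<pi>)"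
    proof -
      have "{} \<notin> (`) h ` \<pi>" using pairingsD(5)[OF \<pi>] by auto
      then show ?thesis
        using partition_on_inj_image[of A \<pi> h] \<pi> h by (simp add: pairings_def)
    qed
    ultimately show ?thesis by (auto simp: pairings_def)
  qed
  have "(`) ((`) h) ` pairings A = pairings (h ` A)"
  proof (intro equalityI subsetI)
    fix \<pi> assume \<pi>: "\<pi> \<in> pairings (h ` A)"
    define g where "g = the_inv_into A h"
    have g: "inj_on g (h ` A)" "g ` h ` A = A"
      using h by (auto simp: g_def inj_on_the_inv_into the_inv_into_onto)
    have "(`) g ` \<pi> \<in> pairings A" using to[OF \<pi> g(1)] g(2) by simp
    moreover have "(`) h ` (`) g ` \<pi> = \<pi>"
    proof -
      have "h ` g ` B = B" if "B \<in> \<pi>" for B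
        using pairingsD(6)[OF \<pi> that] h unfolding g_def
        by (force simp: image_image f_the_inv_into_f subset_iff)
      then show ?thesis by (simp add: image_image)
    qed
    ultimately show "\<pi> \<in> (`) ((`) h) ` pairings A" by blast
  qed (use to h in auto)
  moreover have "inj_on ((`) ((`) h)) (pairings A)" using inj' sub by (rule inj_on_subset)
  ultimately show ?thesis by (simp add: bij_betw_def)
qed


subsection \<open>Weights\<close>

text \<open>The conditions are imposed on the whole plane, which frees later terms from membership
  in the unit square; \<open>extend_kernel\<close> brings a given kernel into this form.\<close>

locale kernel =
  fixes w :: "real \<Rightarrow> real \<Rightarrow> real"
  assumes meas: "case_prod w \<in> borel_measurable (borel \<Otimes>\<^sub>M borel)"
    and sym: "w x y = w y x"
    and bound: "\<bar>w x y\<bar> \<le> 1"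
begin

lemma measurable_w [measurable (raw)]:
  assumes "f \<in> borel_measurable M" "g \<in> borel_measurable M"
  shows "(\<lambda>x. w (f x) (g x)) \<in> borel_measurable M"
proof -
  have "(\<lambda>x. (f x, g x)) \<in> M \<rightarrow>\<^sub>M borel \<Otimes>\<^sub>M borel" using assms by measurable
  from measurable_compose[OF this meas] show ?thesis by simp
qed

lemma pairing_density_measurable:
  assumes "\<And>i. f i \<in> borel_measurable borel" "\<pi> \<subseteq> I"
  shows "pairing_density w f \<pi> \<in> borel_measurable (\<Pi>\<^sub>M B\<in>I. uniform)"
proof -
  have x [measurable]: "(\<lambda>x. x B) \<in> borel_measurable (\<Pi>\<^sub>M B\<in>I. uniform)" if "B \<in> \<pi>" for B
  proof -
    have "(\<lambda>x. x B) \<in> (\<Pi>\<^sub>M B\<in>I. uniform) \<rightarrow>\<^sub>M uniform"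
      using that assms by (intro measurable_component_singleton) auto
    then show ?thesis by (rule measurable_uniform)
  qed
  show ?thesis unfolding pairing_density_def
  proof (intro borel_measurable_times borel_measurable_prod, goal_cases)
    case (1 B i)
    from measurable_compose[OF x[OF 1(1)] assms(1)] show ?case .
  next
    case (2 e)
    then have "fst e \<in> \<pi>" "snd e \<in> \<pi>" using crossing_edges_subset[of \<pi>] by auto
    from measurable_w[OF x[OF this(1)] x[OF this(2)]] show ?case by (simp add: case_prod_beta)
  qed
qed

lemma pairing_density_bound:
  assumes "\<And>i x. \<bar>f i x\<bar> \<le> 1"
  shows "\<bar>pairing_density w f \<pi> x\<bar> \<le> 1"
proof -
  have prod: "\<bar>\<Prod>a\<in>A. g a\<bar> \<le> 1" if "\<And>a. \<bar>g a\<bar> \<le> (1::real)" for A :: "'b set" and g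
    unfolding abs_prod by (rule prod_le_1) (use that in auto)
  show ?thesis unfolding pairing_density_def abs_mult
    by (intro mult_le_one prod assms) (auto simp: case_prod_beta bound)
qed

lemma integrable_pairing_density:
  assumes "\<And>i. f i \<in> borel_measurable borel" "\<And>i x. \<bar>f i x\<bar> \<le> 1"
  shows "integrable (\<Pi>\<^sub>M B\<in>\<pi>. uniform) (pairing_density w f \<pi>)"
proof -
  interpret prob_space "\<Pi>\<^sub>M B\<in>\<pi>. uniform" by (intro prob_space_PiM prob_space_uniform)
  show ?thesis
    by (rule integrable_const_bound[of _ 1])
       (use pairing_density_measurable[OF assms(1), of \<pi> \<pi>] pairing_density_bound[OF assms(2)] in auto)
qed

lemma abs_pairing_weight_le:
  assumes "\<And>i. f i \<in> borel_measurable borel" "\<And>i x. \<bar>f i x\<bar> \<le> 1"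
  shows "\<bar>pairing_weight w f \<pi>\<bar> \<le> 1"
proof -
  interpret prob_space "\<Pi>\<^sub>M B\<in>\<pi>. uniform" by (intro prob_space_PiM prob_space_uniform)
  have "\<bar>pairing_weight w f \<pi>\<bar> \<le> (\<integral>x. \<bar>pairing_density w f \<pi> x\<bar> \<partial>(\<Pi>\<^sub>M B\<in>\<pi>. uniform))"
    unfolding pairing_weight_def by (rule integral_abs_bound)
  also have "\<dots> \<le> (\<integral>x. 1 \<partial>(\<Pi>\<^sub>M B\<in>\<pi>. uniform))"
    by (intro integral_mono integrable_abs integrable_pairing_density assms pairing_density_bound) auto
  finally show ?thesis by (simp add: prob_space)
qed

lemma word_moment_le:
  assumes "\<And>i. f i \<in> borel_measurable borel" "\<And>i x. \<bar>f i x\<bar> \<le> 1" "finite A" "card A = 2 * n"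
  shows "\<bar>word_moment w f A\<bar> \<le> 2 ^ n * fact n"
proof -
  have "\<bar>word_moment w f A\<bar> \<le> (\<Sum>\<pi>\<in>pairings A. \<bar>pairing_weight w f \<pi>\<bar>)"
    unfolding word_moment_def by (rule sum_abs)
  also have "\<dots> \<le> real (card (pairings A)) * 1"
    by (intro sum_bounded_above abs_pairing_weight_le assms)
  also have "\<dots> \<le> 2 ^ n * fact n"
    using card_pairings_le[OF assms(3,4)] of_nat_mono[of "card (pairings A)" "2 ^ n * fact n", where 'a=real] by simp
  finally show ?thesis .
qed

text \<open>An increasing relabelling preserves crossings and the order of minima, hence the
  oriented edges; for the coordinates it merely renames the index set of a product measure.\<close>

lemma pairing_weight_image:
  assumes f: "\<And>i. f i \<in> borel_measurable borel"
    and h: "strict_mono_on A h" and \<pi>: "\<pi> \<in> pairings A"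
  shows "pairing_weight w f ((`) h ` \<pi>) = pairing_weight w (\<lambda>i. f (h i)) \<pi>"
proof -
  have inj: "inj_on h A" using h by (rule strict_mono_on_imp_inj_on)
  have sub: "\<pi> \<subseteq> Pow A" using pairingsD(6)[OF \<pi>] by auto
  have inj': "inj_on ((`) h) \<pi>" using inj_on_image_Pow[OF inj] sub by (rule inj_on_subset)
  have ce: "crossing_edges ((`) h ` \<pi>) = map_prod ((`) h) ((`) h) ` crossing_edges \<pi>"
  proof -
    have less: "Min (h ` U) < Min (h ` V) \<longleftrightarrow> Min U < Min V" if "U \<in> \<pi>" "V \<in> \<pi>" for U V
    proof -
      have "Min U \<in> A" "Min V \<in> A"
        using pairingsD(4-6)[OF \<pi>] that Min_in by blast+
      then show ?thesis
        using image_Min[OF h] pairingsD(4-6)[OF \<pi>] that h by (simp add: strict_mono_on_less)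
    qed
    have "blocks_cross (h ` U) (h ` V) \<longleftrightarrow> blocks_cross U V" if "U \<in> \<pi>" "V \<in> \<pi>" for U V
      using that sub by (intro blocks_cross_image[OF h]) auto
    with less show ?thesis unfolding crossing_edges_def by (auto 4 4 simp: image_iff)
  qed
  have inj_ce: "inj_on (map_prod ((`) h) ((`) h)) (crossing_edges \<pi>)"
    using map_prod_inj_on[OF inj' inj'] crossing_edges_subset by (rule inj_on_subset)
  have dens: "pairing_density w f ((`) h ` \<pi>) x = pairing_density w (\<lambda>i. f (h i)) \<pi> (\<lambda>B\<in>\<pi>. x (h ` B))" for x
  proof -
    have "(\<Prod>B\<in>(`) h ` \<pi>. \<Prod>i\<in>B. f i (x B)) = (\<Prod>B\<in>\<pi>. \<Prod>i\<in>B. f (h i) (x (h ` B)))"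
    proof -
      have "(\<Prod>B\<in>(`) h ` \<pi>. \<Prod>i\<in>B. f i (x B)) = (\<Prod>B\<in>\<pi>. \<Prod>i\<in>h ` B. f i (x (h ` B)))"
        by (simp add: prod.reindex[OF inj'])
      also have "\<dots> = (\<Prod>B\<in>\<pi>. \<Prod>i\<in>B. f (h i) (x (h ` B)))"
      proof (rule prod.cong[OF refl])
        fix B assume "B \<in> \<pi>"
        then have "inj_on h B" using sub inj by (auto intro: inj_on_subset)
        then show "(\<Prod>i\<in>h ` B. f i (x (h ` B))) = (\<Prod>i\<in>B. f (h i) (x (h ` B)))"
          by (simp add: prod.reindex)
      qed
      finally show ?thesis .
    qed
    moreover have "(\<Prod>(U, V)\<in>crossing_edges ((`) h ` \<pi>). w (x U) (x V)) =
        (\<Prod>(U, V)\<in>crossing_edges \<pi>. w (x (h ` U)) (x (h ` V)))"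
      unfolding ce by (subst prod.reindex[OF inj_ce]) (auto intro!: prod.cong)
    moreover have "(\<Prod>(U, V)\<in>crossing_edges \<pi>. w (x (h ` U)) (x (h ` V))) =
        (\<Prod>(U, V)\<in>crossing_edges \<pi>. w ((\<lambda>B\<in>\<pi>. x (h ` B)) U) ((\<lambda>B\<in>\<pi>. x (h ` B)) V))"
      using crossing_edges_subset[of \<pi>] by (intro prod.cong) auto
    ultimately show ?thesis by (simp add: pairing_density_def)
  qed
  let ?K = "\<Pi>\<^sub>M B\<in>(`) h ` \<pi>. uniform" and ?I = "\<Pi>\<^sub>M B\<in>\<pi>. uniform"
  have distr: "distr ?K ?I (\<lambda>x. \<lambda>B\<in>\<pi>. x (h ` B)) = ?I"
    using distr_PiM_reindex[of "(`) h ` \<pi>" "\<lambda>_. uniform" "(`) h" \<pi>] prob_space_uniform inj' by auto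
  have "pairing_weight w (\<lambda>i. f (h i)) \<pi> =
      (\<integral>x. pairing_density w (\<lambda>i. f (h i)) \<pi> x \<partial>distr ?K ?I (\<lambda>x. \<lambda>B\<in>\<pi>. x (h ` B)))"
    by (simp only: distr pairing_weight_def)
  also have "\<dots> = (\<integral>x. pairing_density w (\<lambda>i. f (h i)) \<pi> (\<lambda>B\<in>\<pi>. x (h ` B)) \<partial>?K)"
  proof (rule integral_distr)
    show "(\<lambda>x. \<lambda>B\<in>\<pi>. x (h ` B)) \<in> ?K \<rightarrow>\<^sub>M ?I"
      by (intro measurable_restrict measurable_component_singleton) auto
    show "pairing_density w (\<lambda>i. f (h i)) \<pi> \<in> borel_measurable ?I"
      by (intro pairing_density_measurable f) auto
  qed
  finally show ?thesis by (simp add: dens pairing_weight_def)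
qed

lemma word_moment_image:
  assumes "\<And>i. f i \<in> borel_measurable borel" "strict_mono_on A h"
  shows "word_moment w f (h ` A) = word_moment w (\<lambda>i. f (h i)) A"
  unfolding word_moment_def
  using sum.reindex_bij_betw[OF pairings_image[OF strict_mono_on_imp_inj_on[OF assms(2)]], of "pairing_weight w f"]
    pairing_weight_image[OF assms] by simp

lemma word_moment_cong:
  assumes "\<And>i x. i \<in> A \<Longrightarrow> f i x = g i x"
  shows "word_moment w f A = word_moment w g A"
  unfolding word_moment_def pairing_weight_def pairing_density_def
  by (intro sum.cong Bochner_Integration.integral_cong arg_cong2[where f = "(*)"] prod.cong refl)
     (use assms in \<open>auto dest: pairingsD(6)\<close>)

end

text \<open>Fubini's theorem, where dependence on only some of the coordinates is expressed as
  invariance under \<open>merge\<close>.\<close>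

lemma integral_PiM_mult:
  fixes F G :: "('i \<Rightarrow> real) \<Rightarrow> real"
  assumes I: "finite I" "finite J" "I \<inter> J = {}"
    and F: "F \<in> borel_measurable (\<Pi>\<^sub>M i\<in>I. uniform)" "\<And>x. \<bar>F x\<bar> \<le> 1"
    and G: "G \<in> borel_measurable (\<Pi>\<^sub>M i\<in>J. uniform)" "\<And>x. \<bar>G x\<bar> \<le> 1"
    and F': "\<And>x y. F (merge I J (x, y)) = F x" and G': "\<And>x y. G (merge I J (x, y)) = G y"
  shows "(\<integral>x. F x * G x \<partial>(\<Pi>\<^sub>M i\<in>I \<union> J. uniform)) =
    (\<integral>x. F x \<partial>(\<Pi>\<^sub>M i\<in>I. uniform)) * (\<integral>x. G x \<partial>(\<Pi>\<^sub>M i\<in>J. uniform))"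
proof -
  let ?P = "\<lambda>I. \<Pi>\<^sub>M i\<in>I. uniform"
  interpret P: prob_space "?P (I \<union> J)" by (intro prob_space_PiM prob_space_uniform)
  have mrg: "merge I J (restrict x I, restrict x J) = x" if "x \<in> space (?P (I \<union> J))" for x
    using that I by (auto simp: merge_def space_PiM PiE_def extensional_def fun_eq_iff)
  have mF: "F \<in> borel_measurable (?P (I \<union> J))"
  proof -
    have "(\<lambda>x. F (restrict x I)) \<in> borel_measurable (?P (I \<union> J))"
      by (rule measurable_compose[OF _ F(1)]) (auto intro: measurable_restrict_subset)
    moreover have "F (restrict x I) = F x" if "x \<in> space (?P (I \<union> J))" for x
      using F'[of "restrict x I" "restrict x J"] mrg[OF that] by metis
    ultimately show ?thesis by (simp cong: measurable_cong)
  qed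
  have mG: "G \<in> borel_measurable (?P (I \<union> J))"
  proof -
    have "(\<lambda>x. G (restrict x J)) \<in> borel_measurable (?P (I \<union> J))"
      by (rule measurable_compose[OF _ G(1)]) (auto intro: measurable_restrict_subset)
    moreover have "G (restrict x J) = G x" if "x \<in> space (?P (I \<union> J))" for x
      using G'[of "restrict x I" "restrict x J"] mrg[OF that] by metis
    ultimately show ?thesis by (simp cong: measurable_cong)
  qed
  have "integrable (?P (I \<union> J)) (\<lambda>x. F x * G x)"
    by (rule P.integrable_const_bound[of _ 1])
       (use mF mG F(2) G(2) in \<open>auto simp: abs_mult intro!: AE_I2 mult_le_one\<close>)
  from uniform_product.product_integral_fold[OF I(3,1,2) this] show ?thesis
    by (simp add: F' G')
qed

context kernel
begin

text \<open>Mixed edges are harmless if they carry the value 1 wherever the vertex factor is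
  nonzero. This covers both gluings: across the sides the kernel is 1 in the classical case, and in
  the free case the lemma is applied to parts without mutual crossings.\<close>

lemma pairing_weight_Un:
  assumes f: "\<And>i. f i \<in> borel_measurable borel" "\<And>i x. \<bar>f i x\<bar> \<le> 1"
    and \<rho>: "\<rho> \<in> pairings A" and \<sigma>: "\<sigma> \<in> pairings B" and AB: "A \<inter> B = {}" "finite A" "finite B"
    and one: "\<And>U V x. U \<in> \<rho> \<Longrightarrow> V \<in> \<sigma> \<Longrightarrow> blocks_cross U V \<Longrightarrow>
      (\<Prod>B\<in>\<rho> \<union> \<sigma>. \<Prod>i\<in>B. f i (x B)) \<noteq> 0 \<Longrightarrow> w (x U) (x V) = 1"
  shows "pairing_weight w f (\<rho> \<union> \<sigma>) = pairing_weight w f \<rho> * pairing_weight w f \<sigma>"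
proof -
  have fin: "finite \<rho>" "finite \<sigma>" using \<rho> \<sigma> AB finite_pairing by auto
  have disj: "\<rho> \<inter> \<sigma> = {}" by (rule pairings_Un_cases(3)[OF \<rho> \<sigma> AB(1)])
  \<comment> \<open>Mixed edges occur in both orientations, as the order of minima decides which
    block comes first.\<close>
  define M where "M = {(U, V). U \<in> \<rho> \<union> \<sigma> \<and> V \<in> \<rho> \<union> \<sigma> \<and> (U \<in> \<rho> \<longleftrightarrow> V \<in> \<sigma>) \<and> Min U < Min V \<and> blocks_cross U V}"
  have ce: "crossing_edges (\<rho> \<union> \<sigma>) = crossing_edges \<rho> \<union> crossing_edges \<sigma> \<union> M"
    using disj unfolding crossing_edges_def M_def by auto
  have fM: "finite M"
    using finite_crossing_edges[of "\<rho> \<union> \<sigma>"] fin ce by auto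
  note fc = finite_crossing_edges[OF fin(1)] finite_crossing_edges[OF fin(2)]
  have disj_ce: "(crossing_edges \<rho> \<union> crossing_edges \<sigma>) \<inter> M = {}" "crossing_edges \<rho> \<inter> crossing_edges \<sigma> = {}"
    using disj unfolding crossing_edges_def M_def by auto
  have M1: "(\<Prod>(U, V)\<in>M. w (x U) (x V)) = 1" if "(\<Prod>B\<in>\<rho> \<union> \<sigma>. \<Prod>i\<in>B. f i (x B)) \<noteq> 0" for x
  proof (intro prod.neutral ballI)
    fix e assume e: "e \<in> M"
    obtain U V where UV: "e = (U, V)" by (cases e)
    have "U \<in> \<rho> \<and> V \<in> \<sigma> \<or> V \<in> \<rho> \<and> U \<in> \<sigma>" "blocks_cross U V"
      using e disj unfolding UV M_def by auto
    moreover have "blocks_cross V U" using \<open>blocks_cross U V\<close> by (simp add: blocks_cross_commute)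
    ultimately have "w (x U) (x V) = 1 \<or> w (x V) (x U) = 1" using one[OF _ _ _ that] by blast
    then have "w (x U) (x V) = 1" by (simp add: sym[of "x V" "x U"])
    then show "(case e of (U, V) \<Rightarrow> w (x U) (x V)) = 1" by (simp add: UV)
  qed
  have dens: "pairing_density w f (\<rho> \<union> \<sigma>) x = pairing_density w f \<rho> x * pairing_density w f \<sigma> x" for x
  proof (cases "(\<Prod>B\<in>\<rho> \<union> \<sigma>. \<Prod>i\<in>B. f i (x B)) = 0")
    case True
    then have "(\<Prod>B\<in>\<rho>. \<Prod>i\<in>B. f i (x B)) = 0 \<or> (\<Prod>B\<in>\<sigma>. \<Prod>i\<in>B. f i (x B)) = 0"
      unfolding prod.union_disjoint[OF fin disj] by (simp only: mult_eq_0_iff)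
    then show ?thesis using True by (auto simp: pairing_density_def)
  next
    case False
    have "(\<Prod>(U, V)\<in>crossing_edges (\<rho> \<union> \<sigma>). w (x U) (x V)) =
      (\<Prod>(U, V)\<in>crossing_edges \<rho> \<union> crossing_edges \<sigma>. w (x U) (x V)) * (\<Prod>(U, V)\<in>M. w (x U) (x V))"
      unfolding ce using fc fM disj_ce by (intro prod.union_disjoint) auto
    also have "\<dots> = (\<Prod>(U, V)\<in>crossing_edges \<rho>. w (x U) (x V)) * (\<Prod>(U, V)\<in>crossing_edges \<sigma>. w (x U) (x V))"
      using prod.union_disjoint[OF fc disj_ce(2)] M1[OF False] by simp
    finally show ?thesis
      using prod.union_disjoint[OF fin disj, of "\<lambda>B. \<Prod>i\<in>B. f i (x B)"] by (simp add: pairing_density_def)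
  qed
  show ?thesis unfolding pairing_weight_def dens
  proof (rule integral_PiM_mult[OF fin disj])
    show "pairing_density w f \<rho> (merge \<rho> \<sigma> (x, y)) = pairing_density w f \<rho> x" for x y
      unfolding pairing_density_def using crossing_edges_subset[of \<rho>]
      by (intro arg_cong2[where f = "(*)"] prod.cong) (auto simp: merge_def)
    show "pairing_density w f \<sigma> (merge \<rho> \<sigma> (x, y)) = pairing_density w f \<sigma> y" for x y
      unfolding pairing_density_def using crossing_edges_subset[of \<sigma>] disj
      by (intro arg_cong2[where f = "(*)"] prod.cong) (auto simp: merge_def)
  qed (use f in \<open>auto intro!: pairing_density_measurable pairing_density_bound\<close>)
qed

end

section \<open>Positivity\<close>

subsection \<open>The finite spin model\<close>

text \<open>
  Self-adjoint operators \<open>b\<^sub>i\<close> with \<open>b\<^sub>i\<^sup>2 = 1\<close> that commute up to the sign \<open>s (j, i)\<close>, \<open>j < i\<close>, act on an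
  orthonormal basis \<open>e\<^sub>A\<close> indexed by finite sets \<open>A\<close>; the pair \<open>(a, A)\<close> stands for the vector \<open>a e\<^sub>A\<close>.
\<close>

definition spin :: "(nat \<times> nat \<Rightarrow> real) \<Rightarrow> nat \<Rightarrow> real \<times> nat set \<Rightarrow> real \<times> nat set" where
  "spin s i x = (fst x * (\<Prod>j\<in>{j\<in>snd x. j < i}. s (j, i)), sym_diff (snd x) {i})"

definition spins :: "(nat \<times> nat \<Rightarrow> real) \<Rightarrow> nat list \<Rightarrow> real \<times> nat set \<Rightarrow> real \<times> nat set" where
  "spins s is = foldr (spin s) is"

definition spin_inner :: "real \<times> nat set \<Rightarrow> real \<times> nat set \<Rightarrow> real" where
  "spin_inner x y = (if snd x = snd y then fst x * fst y else 0)"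

definition vacuum :: "real \<times> nat set" where
  "vacuum = (1, {})"

definition spin_trace :: "(nat \<times> nat \<Rightarrow> real) \<Rightarrow> nat list \<Rightarrow> real" where
  "spin_trace s is = spin_inner vacuum (spins s is vacuum)"

lemma spins_simps [simp]:
  "spins s [] x = x" "spins s (i # is) x = spin s i (spins s is x)"
  "spins s (is @ js) x = spins s is (spins s js x)"
  by (simp_all add: spins_def)

lemma spin_inner_commute: "spin_inner x y = spin_inner y x"
  by (simp add: spin_inner_def)

text \<open>The sign depends on the elements below i only, and toggling i does not change
  these.\<close>

lemma spin_selfadjoint: "spin_inner (spin s i x) y = spin_inner x (spin s i y)"
proof (cases "sym_diff (snd x) {i} = snd y")
  case True
  then have "{j\<in>snd x. j < i} = {j\<in>snd y. j < i}" and "snd x = sym_diff (snd y) {i}"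
    by blast+
  with True show ?thesis by (simp add: spin_inner_def spin_def)
next
  case False
  then have "snd x \<noteq> sym_diff (snd y) {i}" by blast
  with False show ?thesis by (simp add: spin_inner_def spin_def)
qed

lemma spins_adjoint: "spin_inner (spins s (rev is) x) y = spin_inner x (spins s is y)"
  by (induction "is" arbitrary: x) (simp_all add: spin_selfadjoint)

text \<open>Vacuum expectations become entries of a Gram matrix; all positivity and symmetry of
  moments comes from here.\<close>

lemma spin_trace_rev_append:
  "spin_trace s (rev is @ js) = spin_inner (spins s is vacuum) (spins s js vacuum)"
  unfolding spin_trace_def by (metis spin_inner_commute spins_adjoint spins_simps(3))

section \<open>Vacuum expectations as products of signs over crossings\<close>

text \<open>The operators act from the right end of the word, so the induction runs over suffixes;
  each occurrence of an index toggles it.\<close>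

lemma snd_spins:
  "snd (spins s (map i [k..<p]) vacuum) = {a. odd (card {l\<in>{k..<p}. i l = a})}"
proof (induction "p - k" arbitrary: k)
  case 0
  then show ?case by (simp add: vacuum_def)
next
  case (Suc n)
  then have kp: "k < p" and IH: "snd (spins s (map i [Suc k..<p]) vacuum) = {a. odd (card {l\<in>{Suc k..<p}. i l = a})}"
    by auto
  have "{l\<in>{k..<p}. i l = a} = (if i k = a then insert k {l\<in>{Suc k..<p}. i l = a} else {l\<in>{Suc k..<p}. i l = a})" for a
    using kp by (auto simp: le_less Suc_le_eq)
  then have "odd (card {l\<in>{k..<p}. i l = a}) \<longleftrightarrow> (odd (card {l\<in>{Suc k..<p}. i l = a}) \<noteq> (i k = a))" for a
    by simp
  then show ?case using kp by (auto simp: upt_conv_Cons spin_def IH)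
qed

lemma fst_spins:
  "fst (spins s (map i [k..<p]) vacuum) =
    (\<Prod>m\<in>{k..<p}. \<Prod>j\<in>{j. odd (card {l\<in>{m<..<p}. i l = j}) \<and> j < i m}. s (j, i m))"
proof (induction "p - k" arbitrary: k)
  case 0
  then show ?case by (simp add: vacuum_def)
next
  case (Suc n)
  then have kp: "k < p" and IH: "fst (spins s (map i [Suc k..<p]) vacuum) =
    (\<Prod>m\<in>{Suc k..<p}. \<Prod>j\<in>{j. odd (card {l\<in>{m<..<p}. i l = j}) \<and> j < i m}. s (j, i m))"
    by auto
  have "{Suc k..<p} = {k<..<p}" by auto
  then show ?case
    using kp by (simp add: upt_conv_Cons spin_def IH snd_spins prod.atLeast_Suc_lessThan mult.commute)
qed

text \<open>The number of points of U to the right of k is odd exactly when k lies between the two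
  points of U, and V crosses U iff just one of its points lies there.\<close>

lemma crossing_parity:
  assumes "card U = 2" "card V = 2" "U \<inter> V = {}"
  shows "odd (card {k\<in>V. odd (card {l\<in>U. k < l})}) \<longleftrightarrow> blocks_cross U V"
proof -
  obtain a b where U: "U = {a, b}" "a < b"
    using assms(1) by (metis card_2_iff doubleton_eq_iff linorder_neqE_nat)
  obtain c d where V: "V = {c, d}" "c < d"
    using assms(2) by (metis card_2_iff doubleton_eq_iff linorder_neqE_nat)
  have "odd (card {l\<in>U. k < l}) \<longleftrightarrow> a \<le> k \<and> k < b" for k
  proof -
    have "{l\<in>U. k < l} = (if k < a then {a, b} else if k < b then {b} else {})"
      using U by auto
    then show ?thesis using U by auto
  qed
  then have "{k\<in>V. odd (card {l\<in>U. k < l})} = {k\<in>V. a \<le> k \<and> k < b}" by simp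
  moreover have "a \<noteq> c" "a \<noteq> d" "b \<noteq> c" "b \<noteq> d" using assms(3) U V by auto
  moreover have "{k\<in>V. a \<le> k \<and> k < b} =
     (if a \<le> c \<and> c < b then {c} else {}) \<union> (if a \<le> d \<and> d < b then {d} else {})"
    using V by auto
  moreover have "blocks_cross U V \<longleftrightarrow> a < c \<and> c < b \<and> b < d \<or> c < a \<and> a < d \<and> d < b"
  proof
    assume "blocks_cross U V"
    then show "a < c \<and> c < b \<and> b < d \<or> c < a \<and> a < d \<and> d < b"
      using U V unfolding blocks_cross_def by auto
  next
    assume "a < c \<and> c < b \<and> b < d \<or> c < a \<and> a < d \<and> d < b"
    then show "blocks_cross U V"
      unfolding blocks_cross_def U V by (elim disjE) (blast intro: exI[of _ a] exI[of _ c])+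
  qed
  ultimately show ?thesis using U V by auto
qed

text \<open>The blocks are the fibres of the index tuple i, and \<phi> gives the common index of
  each block. Such tuples carry the main term of the central limit theorem.\<close>

definition adapted :: "nat set set \<Rightarrow> (nat set \<Rightarrow> nat) \<Rightarrow> (nat \<Rightarrow> nat) \<Rightarrow> bool" where
  "adapted \<pi> \<phi> i \<longleftrightarrow> inj_on \<phi> \<pi> \<and> (\<forall>B\<in>\<pi>. \<forall>k\<in>B. i k = \<phi> B)"

lemma fibre_adapted:
  assumes \<pi>: "\<pi> \<in> pairings {..<p}" and a: "adapted \<pi> \<phi> i" and U: "U \<in> \<pi>"
  shows "{l\<in>{..<p}. i l = \<phi> U} = U"
proof (intro equalityI subsetI)
  fix l assume l: "l \<in> {l\<in>{..<p}. i l = \<phi> U}"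
  then obtain V where "V \<in> \<pi>" "l \<in> V" using pairingsD(1)[OF \<pi>] by blast
  with l U a have "V = U" unfolding adapted_def by (metis (mono_tags, lifting) inj_onD mem_Collect_eq)
  then show "l \<in> U" using \<open>l \<in> V\<close> by simp
next
  fix l assume "l \<in> U"
  then show "l \<in> {l\<in>{..<p}. i l = \<phi> U}"
    using pairingsD(6)[OF \<pi> U] U a unfolding adapted_def by auto
qed

text \<open>Each index occurs twice, so the word returns to the vacuum. For \<phi> U < \<phi> V the
  sign \<open>s (\<phi> U, \<phi> V)\<close> arises once for every m in V with an odd number of
  points of U to its right; by \<open>crossing_parity\<close> the exponent is odd iff U and V
  cross.\<close>

lemma spin_trace_adapted:
  assumes s: "\<And>e. s e = 1 \<or> s e = -1"
    and \<pi>: "\<pi> \<in> pairings {..<p}" and a: "adapted \<pi> \<phi> i"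
  shows "spin_trace s (map i [0..<p]) =
    (\<Prod>(U, V)\<in>{(U, V). U \<in> \<pi> \<and> V \<in> \<pi> \<and> \<phi> U < \<phi> V \<and> blocks_cross U V}. s (\<phi> U, \<phi> V))"
proof -
  have fin: "finite \<pi>" using \<pi> by (rule finite_pairing) simp
  have inj: "inj_on \<phi> \<pi>" using a by (simp add: adapted_def)
  have range: "i l \<in> \<phi> ` \<pi>" if "l < p" for l
    using that pairingsD(1)[OF \<pi>] a unfolding adapted_def by (metis UnionE image_eqI lessThan_iff)
  have "odd (card {l\<in>{0..<p}. i l = b}) = False" for b
  proof (cases "b \<in> \<phi> ` \<pi>")
    case True
    then show ?thesis
      using fibre_adapted[OF \<pi> a] pairingsD(3)[OF \<pi>] by (auto simp: lessThan_atLeast0)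
  next
    case False
    then have empty: "{l\<in>{0..<p}. i l = b} = {}" using range by auto
    show ?thesis unfolding empty by simp
  qed
  then have "snd (spins s (map i [0..<p]) vacuum) = {}" by (simp add: snd_spins)
  then have "spin_trace s (map i [0..<p]) = fst (spins s (map i [0..<p]) vacuum)"
    by (simp add: spin_trace_def spin_inner_def vacuum_def)
  also have "\<dots> = (\<Prod>m<p. \<Prod>j\<in>{j. odd (card {l\<in>{m<..<p}. i l = j}) \<and> j < i m}. s (j, i m))"
    by (simp add: fst_spins lessThan_atLeast0)
  \<comment> \<open>Only indices of blocks can occur an odd number of times after m, and the
    occurrences of \<open>\<phi> U\<close> are the points of U.\<close>
  also have "\<dots> = (\<Prod>m<p. \<Prod>U\<in>{U\<in>\<pi>. odd (card {l\<in>U. m < l}) \<and> \<phi> U < i m}. s (\<phi> U, i m))"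
  proof (rule prod.cong[OF refl])
    fix m assume "m \<in> {..<p}"
    have fib: "{l\<in>{m<..<p}. i l = \<phi> U} = {l\<in>U. m < l}" if "U \<in> \<pi>" for U
      using fibre_adapted[OF \<pi> a that] by auto
    have "j \<in> \<phi> ` \<pi>" if "odd (card {l\<in>{m<..<p}. i l = j})" for j
    proof -
      have "{l\<in>{m<..<p}. i l = j} \<noteq> {}" using that by (metis card.empty even_zero)
      then show ?thesis using range by auto
    qed
    then have "{j. odd (card {l\<in>{m<..<p}. i l = j}) \<and> j < i m} =
        \<phi> ` {U\<in>\<pi>. odd (card {l\<in>{m<..<p}. i l = \<phi> U}) \<and> \<phi> U < i m}"
      by auto
    also have "{U\<in>\<pi>. odd (card {l\<in>{m<..<p}. i l = \<phi> U}) \<and> \<phi> U < i m} =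
        {U\<in>\<pi>. odd (card {l\<in>U. m < l}) \<and> \<phi> U < i m}"
      using fib by (intro Collect_cong conj_cong refl) (simp only:)
    finally have "{j. odd (card {l\<in>{m<..<p}. i l = j}) \<and> j < i m} =
        \<phi> ` {U\<in>\<pi>. odd (card {l\<in>U. m < l}) \<and> \<phi> U < i m}" .
    moreover have "inj_on \<phi> {U\<in>\<pi>. odd (card {l\<in>U. m < l}) \<and> \<phi> U < i m}"
      using inj by (rule inj_on_subset) auto
    ultimately show "(\<Prod>j\<in>{j. odd (card {l\<in>{m<..<p}. i l = j}) \<and> j < i m}. s (j, i m)) =
        (\<Prod>U\<in>{U\<in>\<pi>. odd (card {l\<in>U. m < l}) \<and> \<phi> U < i m}. s (\<phi> U, i m))"
      by (simp add: prod.reindex)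
  qed
  also have "\<dots> = (\<Prod>m\<in>\<Union>\<pi>. \<Prod>U\<in>{U\<in>\<pi>. odd (card {l\<in>U. m < l}) \<and> \<phi> U < i m}. s (\<phi> U, i m))"
    by (simp add: pairingsD(1)[OF \<pi>])
  also have "\<dots> = (\<Prod>V\<in>\<pi>. \<Prod>m\<in>V. \<Prod>U\<in>{U\<in>\<pi>. odd (card {l\<in>U. m < l}) \<and> \<phi> U < i m}. s (\<phi> U, i m))"
    using pairingsD(2,4)[OF \<pi>] by (subst prod.Union_disjoint) auto
  also have "\<dots> = (\<Prod>V\<in>\<pi>. \<Prod>U\<in>\<pi>. if \<phi> U < \<phi> V \<and> blocks_cross U V then s (\<phi> U, \<phi> V) else 1)"
  proof (rule prod.cong[OF refl])
    fix V assume V: "V \<in> \<pi>"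
    have "(\<Prod>m\<in>V. \<Prod>U\<in>{U\<in>\<pi>. odd (card {l\<in>U. m < l}) \<and> \<phi> U < i m}. s (\<phi> U, i m)) =
      (\<Prod>m\<in>V. \<Prod>U\<in>\<pi>. if odd (card {l\<in>U. m < l}) \<and> \<phi> U < \<phi> V then s (\<phi> U, \<phi> V) else 1)"
    proof (rule prod.cong[OF refl])
      fix m assume "m \<in> V"
      then have "i m = \<phi> V" using a V by (simp add: adapted_def)
      then show "(\<Prod>U\<in>{U\<in>\<pi>. odd (card {l\<in>U. m < l}) \<and> \<phi> U < i m}. s (\<phi> U, i m)) =
          (\<Prod>U\<in>\<pi>. if odd (card {l\<in>U. m < l}) \<and> \<phi> U < \<phi> V then s (\<phi> U, \<phi> V) else 1)"
        by (simp only: prod.inter_filter[OF fin])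
    qed
    also have "\<dots> = (\<Prod>U\<in>\<pi>. \<Prod>m\<in>V. if odd (card {l\<in>U. m < l}) \<and> \<phi> U < \<phi> V then s (\<phi> U, \<phi> V) else 1)"
      by (rule prod.swap)
    also have "\<dots> = (\<Prod>U\<in>\<pi>. if \<phi> U < \<phi> V \<and> blocks_cross U V then s (\<phi> U, \<phi> V) else 1)"
    proof (rule prod.cong[OF refl])
      fix U assume U: "U \<in> \<pi>"
      show "(\<Prod>m\<in>V. if odd (card {l\<in>U. m < l}) \<and> \<phi> U < \<phi> V then s (\<phi> U, \<phi> V) else 1) =
        (if \<phi> U < \<phi> V \<and> blocks_cross U V then s (\<phi> U, \<phi> V) else 1)"
      proof (cases "\<phi> U < \<phi> V")
        case True
        then have "U \<noteq> V" by auto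
        have "(\<Prod>m\<in>V. if odd (card {l\<in>U. m < l}) \<and> \<phi> U < \<phi> V then s (\<phi> U, \<phi> V) else 1) =
          (\<Prod>m\<in>{m\<in>V. odd (card {l\<in>U. m < l})}. s (\<phi> U, \<phi> V))"
          unfolding prod.inter_filter[OF pairingsD(4)[OF \<pi> V]] using True by (intro prod.cong) auto
        also have "\<dots> = s (\<phi> U, \<phi> V) ^ card {m\<in>V. odd (card {l\<in>U. m < l})}" by simp
        also have "\<dots> = (if blocks_cross U V then s (\<phi> U, \<phi> V) else 1)"
        proof -
          have "odd (card {m\<in>V. odd (card {l\<in>U. m < l})}) \<longleftrightarrow> blocks_cross U V"
            using U V \<open>U \<noteq> V\<close> pairingsD(2,3)[OF \<pi>] by (intro crossing_parity)
          then show ?thesis using s[of "(\<phi> U, \<phi> V)"] by (elim disjE) (auto simp: uminus_power_if)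
        qed
        finally show ?thesis using True by simp
      qed simp
    qed
    finally show "(\<Prod>m\<in>V. \<Prod>U\<in>{U\<in>\<pi>. odd (card {l\<in>U. m < l}) \<and> \<phi> U < i m}. s (\<phi> U, i m)) =
      (\<Prod>U\<in>\<pi>. if \<phi> U < \<phi> V \<and> blocks_cross U V then s (\<phi> U, \<phi> V) else 1)" .
  qed
  also have "\<dots> = (\<Prod>U\<in>\<pi>. \<Prod>V\<in>\<pi>. if \<phi> U < \<phi> V \<and> blocks_cross U V then s (\<phi> U, \<phi> V) else 1)"
    by (rule prod.swap)
  also have "\<dots> = (\<Prod>(U, V)\<in>\<pi> \<times> \<pi>. if \<phi> U < \<phi> V \<and> blocks_cross U V then s (\<phi> U, \<phi> V) else 1)"
    by (rule prod.cartesian_product)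
  also have "\<dots> = (\<Prod>e\<in>\<pi> \<times> \<pi>. if \<phi> (fst e) < \<phi> (snd e) \<and> blocks_cross (fst e) (snd e) then s (\<phi> (fst e), \<phi> (snd e)) else 1)"
    by (simp add: case_prod_beta)
  also have "\<dots> = (\<Prod>e\<in>{e\<in>\<pi> \<times> \<pi>. \<phi> (fst e) < \<phi> (snd e) \<and> blocks_cross (fst e) (snd e)}. s (\<phi> (fst e), \<phi> (snd e)))"
    using fin by (simp add: prod.inter_filter)
  also have "{e\<in>\<pi> \<times> \<pi>. \<phi> (fst e) < \<phi> (snd e) \<and> blocks_cross (fst e) (snd e)} =
      {(U, V). U \<in> \<pi> \<and> V \<in> \<pi> \<and> \<phi> U < \<phi> V \<and> blocks_cross U V}" by auto
  finally show ?thesis by (simp add: case_prod_beta)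
qed


section \<open>Averaging over random signs\<close>

definition edges :: "nat \<Rightarrow> (nat \<times> nat) set" where
  "edges N = {(a, b). a < b \<and> b < N}"

lemma finite_edges: "finite (edges N)"
  by (rule finite_subset[of _ "{..<N} \<times> {..<N}"]) (auto simp: edges_def)

text \<open>The expectation over independent random signs with means \<open>v e\<close>.\<close>

definition sign_average :: "nat \<Rightarrow> (nat \<times> nat \<Rightarrow> real) \<Rightarrow> ((nat \<times> nat \<Rightarrow> real) \<Rightarrow> real) \<Rightarrow> real" where
  "sign_average N v F = (\<Sum>s\<in>edges N \<rightarrow>\<^sub>E {-1, 1}.
     (\<Prod>e\<in>edges N. (1 + s e * v e) / 2) * F (\<lambda>e. if e \<in> edges N then s e else 1))"

text \<open>Independence turns the sum over configurations into a product of two-point sums, which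
  equal \<open>v e\<close> for e in D and 1 for the other edges.\<close>

lemma sign_average_prod:
  assumes "D \<subseteq> edges N"
  shows "sign_average N v (\<lambda>s. \<Prod>e\<in>D. s e) = (\<Prod>e\<in>D. v e)"
proof -
  let ?h = "\<lambda>e t. (1 + t * v e) / 2 * (if e \<in> D then t else 1)"
  have "sign_average N v (\<lambda>s. \<Prod>e\<in>D. s e) = (\<Sum>s\<in>edges N \<rightarrow>\<^sub>E {-1, 1}. \<Prod>e\<in>edges N. ?h e (s e))"
    unfolding sign_average_def
  proof (rule sum.cong[OF refl])
    fix s :: "nat \<times> nat \<Rightarrow> real"
    have "(\<Prod>e\<in>D. if e \<in> edges N then s e else 1) = (\<Prod>e\<in>D. s e)"
      using assms by (intro prod.cong) auto
    also have "\<dots> = (\<Prod>e\<in>edges N. if e \<in> D then s e else 1)"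
      using assms finite_edges[of N] by (simp add: prod.inter_restrict[symmetric] Int_absorb1)
    finally show "(\<Prod>e\<in>edges N. (1 + s e * v e) / 2) * (\<Prod>e\<in>D. if e \<in> edges N then s e else 1) =
        (\<Prod>e\<in>edges N. ?h e (s e))"
      by (simp only: prod.distrib)
  qed
  also have "\<dots> = (\<Prod>e\<in>edges N. \<Sum>t\<in>{-1, 1}. ?h e t)"
    by (rule prod_sum_PiE[symmetric]) (auto simp: finite_edges)
  also have "\<dots> = (\<Prod>e\<in>edges N. if e \<in> D then v e else 1)"
    by (intro prod.cong) (auto simp: field_simps)
  also have "\<dots> = (\<Prod>e\<in>D. v e)"
    using assms finite_edges[of N] by (simp add: prod.inter_restrict[symmetric] Int_absorb1)
  finally show ?thesis .
qed

lemma sign_weight_nonneg: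
  fixes s v :: "nat \<times> nat \<Rightarrow> real"
  assumes "\<And>e. \<bar>v e\<bar> \<le> 1" "s \<in> edges N \<rightarrow>\<^sub>E {-1, 1}"
  shows "0 \<le> (\<Prod>e\<in>edges N. (1 + s e * v e) / 2)"
proof (intro prod_nonneg ballI)
  fix e assume "e \<in> edges N"
  then have "s e = -1 \<or> s e = 1" using assms(2) by auto
  then show "0 \<le> (1 + s e * v e) / 2" using assms(1)[of e] by auto
qed

text \<open>Only functions with values 1 and -1 everywhere have to be compared, because
  configurations are continued by 1 off the edges; the bound on v makes their weights
  nonnegative.\<close>

lemma sign_average_mono:
  assumes "\<And>e. \<bar>v e\<bar> \<le> 1" "\<And>s. (\<And>e. s e = 1 \<or> s e = -1) \<Longrightarrow> F s \<le> G s"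
  shows "sign_average N v F \<le> sign_average N v G"
  unfolding sign_average_def
  by (intro sum_mono mult_left_mono sign_weight_nonneg assms) (auto simp: PiE_def Pi_def)

lemma sign_average_cong:
  assumes "\<And>s. (\<And>e. s e = 1 \<or> s e = -1) \<Longrightarrow> F s = G s"
  shows "sign_average N v F = sign_average N v G"
  unfolding sign_average_def
  by (intro sum.cong arg_cong2[where f = "(*)"] refl assms) (auto simp: PiE_def Pi_def)

lemma sign_average_sum: "sign_average N v (\<lambda>s. \<Sum>x\<in>X. F x s) = (\<Sum>x\<in>X. sign_average N v (F x))"
  unfolding sign_average_def sum_distrib_left by (rule sum.swap)

lemma sign_average_cmult: "sign_average N v (\<lambda>s. c * F s) = c * sign_average N v F"
  unfolding sign_average_def sum_distrib_left by (intro sum.cong) auto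

lemma sign_average_const: "sign_average N v (\<lambda>s. c) = c"
  using sign_average_cmult[of N v c "\<lambda>s. \<Prod>e\<in>{}. s e"] sign_average_prod[of "{}" N v] by simp

lemma sign_average_abs_le:
  assumes v: "\<And>e. \<bar>v e\<bar> \<le> 1" and F: "\<And>s. (\<And>e. s e = 1 \<or> s e = -1) \<Longrightarrow> \<bar>F s\<bar> \<le> 1"
  shows "\<bar>sign_average N v F\<bar> \<le> 1"
proof -
  have "sign_average N v F \<le> sign_average N v (\<lambda>s. 1)" "sign_average N v (\<lambda>s. -1) \<le> sign_average N v F"
    by (intro sign_average_mono v; use F in \<open>force simp: abs_le_iff\<close>)+
  then show ?thesis by (simp add: sign_average_const abs_le_iff)
qed

definition averaged_trace :: "nat \<Rightarrow> (nat \<times> nat \<Rightarrow> real) \<Rightarrow> nat list \<Rightarrow> real" where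
  "averaged_trace N v is = sign_average N v (\<lambda>s. spin_trace s is)"

lemma abs_fst_spins:
  assumes "\<And>e. s e = 1 \<or> s e = -1"
  shows "\<bar>fst (spins s is vacuum)\<bar> = 1"
proof (induction "is")
  case (Cons i "is")
  have "\<bar>s e\<bar> = 1" for e using assms[of e] by auto
  with Cons show ?case by (simp add: spin_def abs_mult abs_prod)
qed (simp add: vacuum_def)

lemma abs_averaged_trace_le:
  assumes "\<And>e. \<bar>v e\<bar> \<le> 1"
  shows "\<bar>averaged_trace N v is\<bar> \<le> 1"
  unfolding averaged_trace_def
proof (rule sign_average_abs_le[OF assms])
  fix s :: "nat \<times> nat \<Rightarrow> real" assume "\<And>e. s e = 1 \<or> s e = -1"
  from abs_fst_spins[OF this] show "\<bar>spin_trace s is\<bar> \<le> 1"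
    by (simp add: spin_trace_def spin_inner_def vacuum_def)
qed

lemma averaged_trace_odd:
  assumes "odd (card {l\<in>{..<p}. i l = a})"
  shows "averaged_trace N v (map i [0..<p]) = 0"
proof -
  have "a \<in> snd (spins s (map i [0..<p]) vacuum)" for s
    using assms by (simp add: snd_spins lessThan_atLeast0)
  then have "spin_trace s (map i [0..<p]) = 0" for s
    by (force simp: spin_trace_def spin_inner_def vacuum_def)
  then show ?thesis by (simp add: averaged_trace_def sign_average_const)
qed

text \<open>As \<phi> is injective, distinct crossing pairs of blocks use distinct edges, so
  averaging replaces each sign by its mean.\<close>

lemma averaged_trace_adapted:
  assumes \<pi>: "\<pi> \<in> pairings {..<p}" and a: "adapted \<pi> \<phi> i" and N: "\<phi> ` \<pi> \<subseteq> {..<N}"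
  shows "averaged_trace N v (map i [0..<p]) =
    (\<Prod>(U, V)\<in>{(U, V). U \<in> \<pi> \<and> V \<in> \<pi> \<and> \<phi> U < \<phi> V \<and> blocks_cross U V}. v (\<phi> U, \<phi> V))"
proof -
  define M where "M = {(U, V). U \<in> \<pi> \<and> V \<in> \<pi> \<and> \<phi> U < \<phi> V \<and> blocks_cross U V}"
  have "inj_on (map_prod \<phi> \<phi>) (\<pi> \<times> \<pi>)" using a by (intro map_prod_inj_on) (auto simp: adapted_def)
  then have inj: "inj_on (map_prod \<phi> \<phi>) M" by (rule inj_on_subset) (auto simp: M_def)
  have "averaged_trace N v (map i [0..<p]) = sign_average N v (\<lambda>s. \<Prod>(U, V)\<in>M. s (\<phi> U, \<phi> V))"
    unfolding averaged_trace_def M_def by (intro sign_average_cong spin_trace_adapted[OF _ \<pi> a])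
  also have "\<dots> = sign_average N v (\<lambda>s. \<Prod>e\<in>map_prod \<phi> \<phi> ` M. s e)"
    by (simp only: prod.reindex[OF inj]) (simp add: case_prod_beta map_prod_def)
  also have "\<dots> = (\<Prod>e\<in>map_prod \<phi> \<phi> ` M. v e)"
    using N by (intro sign_average_prod) (auto simp: M_def edges_def)
  also have "\<dots> = (\<Prod>(U, V)\<in>M. v (\<phi> U, \<phi> V))"
    by (simp only: prod.reindex[OF inj]) (simp add: case_prod_beta map_prod_def)
  finally show ?thesis by (simp add: M_def)
qed

section \<open>Mixed moments of the spin model\<close>

definition tuples :: "nat \<Rightarrow> nat \<Rightarrow> nat list set" where
  "tuples N p = {is. set is \<subseteq> {..<N} \<and> length is = p}"

lemma finite_tuples: "finite (tuples N p)"
  unfolding tuples_def using finite_lists_length_eq[of "{..<N}" p] by simp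

text \<open>The mixed moment along u of the operators obtained by summing \<open>y l a\<close> times
  the a-th spin operator over a, averaged over the signs. The normalisation by powers of
  \<open>sqrt N\<close> is left to the limit.\<close>

definition spin_moment :: "nat \<Rightarrow> (nat \<times> nat \<Rightarrow> real) \<Rightarrow> ('l \<Rightarrow> nat \<Rightarrow> real) \<Rightarrow> 'l list \<Rightarrow> real" where
  "spin_moment N v y u = (\<Sum>is\<in>tuples N (length u).
     prod_list (map2 y u is) * averaged_trace N v is)"

text \<open>The first part is reversed to match \<open>spin_trace_rev_append\<close>.\<close>

lemma sum_tuples_append:
  "(\<Sum>is\<in>tuples N (m + n). F is) = (\<Sum>as\<in>tuples N m. \<Sum>bs\<in>tuples N n. F (rev as @ bs))"
proof -
  have "(\<Sum>as\<in>tuples N m. \<Sum>bs\<in>tuples N n. F (rev as @ bs)) =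
      (\<Sum>x\<in>tuples N m \<times> tuples N n. F (rev (fst x) @ snd x))"
    by (simp add: sum.cartesian_product case_prod_beta)
  also have "\<dots> = (\<Sum>is\<in>tuples N (m + n). F is)"
  proof (rule sum.reindex_bij_witness[where j = "\<lambda>x. rev (fst x) @ snd x" and i = "\<lambda>is. (rev (take m is), drop m is)"])
    fix "is" assume "is \<in> tuples N (m + n)"
    then show "(rev (take m is), drop m is) \<in> tuples N m \<times> tuples N n"
      using set_take_subset[of m "is"] set_drop_subset[of m "is"] by (auto simp: tuples_def)
  qed (auto simp: tuples_def)
  finally show ?thesis ..
qed

lemma spin_moment_rev_append:
  "spin_moment N v y (rev u @ u') = sign_average N v (\<lambda>s.
     \<Sum>as\<in>tuples N (length u). \<Sum>bs\<in>tuples N (length u').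
       prod_list (map2 y u as) * prod_list (map2 y u' bs) *
       spin_inner (spins s as vacuum) (spins s bs vacuum))"
proof -
  have "spin_moment N v y (rev u @ u') = (\<Sum>as\<in>tuples N (length u). \<Sum>bs\<in>tuples N (length u').
     prod_list (map2 y (rev u @ u') (rev as @ bs)) * averaged_trace N v (rev as @ bs))"
    by (simp add: spin_moment_def sum_tuples_append)
  also have "\<dots> = (\<Sum>as\<in>tuples N (length u). \<Sum>bs\<in>tuples N (length u').
     sign_average N v (\<lambda>s. prod_list (map2 y u as) * prod_list (map2 y u' bs) *
       spin_inner (spins s as vacuum) (spins s bs vacuum)))"
  proof (intro sum.cong refl)
    fix as bs assume "as \<in> tuples N (length u)" "bs \<in> tuples N (length u')"
    then have "length as = length u" "length bs = length u'" by (auto simp: tuples_def)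
    then have "prod_list (map2 y (rev u @ u') (rev as @ bs)) = prod_list (map2 y u as) * prod_list (map2 y u' bs)"
      by (simp add: zip_rev rev_map[symmetric] prod_list.rev)
    then show "prod_list (map2 y (rev u @ u') (rev as @ bs)) * averaged_trace N v (rev as @ bs) =
      sign_average N v (\<lambda>s. prod_list (map2 y u as) * prod_list (map2 y u' bs) *
       spin_inner (spins s as vacuum) (spins s bs vacuum))"
      by (simp add: averaged_trace_def spin_trace_rev_append sign_average_cmult)
  qed
  finally show ?thesis by (simp add: sign_average_sum)
qed

lemma spin_moment_commute: "spin_moment N v y (rev u @ u') = spin_moment N v y (rev u' @ u)"
  unfolding spin_moment_rev_append
  by (subst sum.swap) (simp add: mult.commute spin_inner_commute mult.left_commute)

text \<open>Grouping the vectors by basis element gives one square for each finite set that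
  occurs.\<close>

lemma spin_inner_positive:
  assumes "finite I"
  shows "0 \<le> (\<Sum>i\<in>I. \<Sum>j\<in>I. c i * c j * spin_inner (x i) (x j))"
proof -
  define \<A> where "\<A> = (\<lambda>i. snd (x i)) ` I"
  have fin: "finite \<A>" using assms by (simp add: \<A>_def)
  define f where "f A i = (if snd (x i) = A then c i * fst (x i) else 0)" for A i
  have "c i * c j * spin_inner (x i) (x j) = (\<Sum>A\<in>\<A>. f A i * f A j)" if "i \<in> I" for i j
  proof -
    have "(\<Sum>A\<in>\<A>. f A i * f A j) = (\<Sum>A\<in>{snd (x i)}. f A i * f A j)"
      using that fin by (intro sum.mono_neutral_right) (auto simp: \<A>_def f_def)
    then show ?thesis by (simp add: f_def spin_inner_def)
  qed
  then have "(\<Sum>i\<in>I. \<Sum>j\<in>I. c i * c j * spin_inner (x i) (x j)) = (\<Sum>i\<in>I. \<Sum>j\<in>I. \<Sum>A\<in>\<A>. f A i * f A j)"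
    by simp
  also have "\<dots> = (\<Sum>A\<in>\<A>. (\<Sum>i\<in>I. f A i)\<^sup>2)"
    by (simp add: power2_eq_square sum_product sum.swap[of _ \<A>])
  also have "\<dots> \<ge> 0" by (intro sum_nonneg) auto
  finally show ?thesis .
qed

text \<open>For fixed signs the double sum is the squared norm of a single combination of vectors,
  indexed by pairs of a word and an index tuple.\<close>

lemma spin_moment_positive:
  assumes v: "\<And>e. \<bar>v e\<bar> \<le> 1" and F: "finite F"
  shows "0 \<le> (\<Sum>u\<in>F. \<Sum>u'\<in>F. c u * c u' * spin_moment N v y (rev u @ u'))"
proof -
  define I where "I = (SIGMA u:F. tuples N (length u))"
  define d where "d i = c (fst i) * prod_list (map2 y (fst i) (snd i))" for i
  have "(\<Sum>u\<in>F. \<Sum>u'\<in>F. c u * c u' * spin_moment N v y (rev u @ u')) = sign_average N v (\<lambda>s.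
    \<Sum>u\<in>F. \<Sum>u'\<in>F. c u * c u' * (\<Sum>as\<in>tuples N (length u). \<Sum>bs\<in>tuples N (length u').
       prod_list (map2 y u as) * prod_list (map2 y u' bs) *
       spin_inner (spins s as vacuum) (spins s bs vacuum)))"
    by (simp add: spin_moment_rev_append sign_average_sum sign_average_cmult)
  also have "\<dots> = sign_average N v (\<lambda>s. \<Sum>i\<in>I. \<Sum>j\<in>I. d i * d j *
      spin_inner (spins s (snd i) vacuum) (spins s (snd j) vacuum))"
  proof (rule sign_average_cong)
    fix s
    have Sigma: "(\<Sum>i\<in>I. G i) = (\<Sum>u\<in>F. \<Sum>as\<in>tuples N (length u). G (u, as))" for G :: "_ \<Rightarrow> real"
      using F by (simp add: I_def sum.Sigma finite_tuples)
    have "(\<Sum>i\<in>I. \<Sum>j\<in>I. d i * d j * spin_inner (spins s (snd i) vacuum) (spins s (snd j) vacuum)) =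
      (\<Sum>u\<in>F. \<Sum>as\<in>tuples N (length u). \<Sum>u'\<in>F. \<Sum>bs\<in>tuples N (length u'). d (u, as) * d (u', bs) * spin_inner (spins s as vacuum) (spins s bs vacuum))"
      by (simp add: Sigma)
    also have "\<dots> = (\<Sum>u\<in>F. \<Sum>u'\<in>F. \<Sum>as\<in>tuples N (length u). \<Sum>bs\<in>tuples N (length u'). d (u, as) * d (u', bs) * spin_inner (spins s as vacuum) (spins s bs vacuum))"
      by (intro sum.cong[OF refl] sum.swap)
    finally show "(\<Sum>u\<in>F. \<Sum>u'\<in>F. c u * c u' * (\<Sum>as\<in>tuples N (length u). \<Sum>bs\<in>tuples N (length u').
       prod_list (map2 y u as) * prod_list (map2 y u' bs) *
       spin_inner (spins s as vacuum) (spins s bs vacuum))) = (\<Sum>i\<in>I. \<Sum>j\<in>I. d i * d j *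
      spin_inner (spins s (snd i) vacuum) (spins s (snd j) vacuum))"
      by (simp add: d_def sum_distrib_left mult_ac)
  qed
  also have "\<dots> \<ge> sign_average N v (\<lambda>s. 0)"
    using F by (intro sign_average_mono v spin_inner_positive) (auto simp: I_def finite_tuples)
  finally show ?thesis by (simp add: sign_average_const)
qed

subsection \<open>Counting tuples\<close>

text \<open>Two positions with a common value can be paired off and removed without changing the
  parity of any count.\<close>

lemma even_fibres_pairing:
  assumes "finite A" "\<And>a. even (card {l\<in>A. i l = a})"
  shows "\<exists>\<pi>\<in>pairings A. \<forall>B\<in>\<pi>. \<forall>k\<in>B. \<forall>l\<in>B. i k = i l"
  using assms
proof (induction "card A" arbitrary: A rule: less_induct)
  case less
  show ?case
  proof (cases "A = {}")
    case True
    then show ?thesis by (simp add: pairings_empty)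
  next
    case False
    then obtain a where a: "a \<in> A" by auto
    have "{l\<in>A. i l = i a} \<noteq> {a}" using less.prems(2)[of "i a"] by (intro notI) simp
    then obtain b where b: "b \<in> A" "b \<noteq> a" "i b = i a" using a by blast
    define A' where "A' = A - {a, b}"
    have "even (card {l\<in>A'. i l = c})" for c
    proof (cases "c = i a")
      case True
      have "{l\<in>A'. i l = c} = {l\<in>A. i l = c} - {a, b}" by (auto simp: A'_def)
      moreover have "{a, b} \<subseteq> {l\<in>A. i l = c}" using a b True by auto
      ultimately show ?thesis using less.prems b by (simp add: card_Diff_subset)
    next
      case False
      then have "{l\<in>A'. i l = c} = {l\<in>A. i l = c}" using b by (auto simp: A'_def)
      then show ?thesis using less.prems by simp
    qed
    moreover have "card A' < card A" unfolding A'_def using a less.prems by (intro psubset_card_mono) auto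
    moreover have "finite A'" using less.prems by (simp add: A'_def)
    ultimately obtain \<pi> where \<pi>: "\<pi> \<in> pairings A'" "\<forall>B\<in>\<pi>. \<forall>k\<in>B. \<forall>l\<in>B. i k = i l"
      using less.hyps by blast
    have ab: "{{a, b}} \<in> pairings {a, b}"
      using b by (simp add: pairings_def partition_on_def)
    have "\<pi> \<union> {{a, b}} \<in> (\<lambda>(\<rho>, \<sigma>). \<rho> \<union> \<sigma>) ` (pairings A' \<times> pairings {a, b})"
      using \<pi>(1) ab by (intro image_eqI[of _ _ "(\<pi>, {{a, b}})"]) auto
    then have "\<pi> \<union> {{a, b}} \<in> pairings (A' \<union> {a, b})"
      by (subst (asm) pairings_Un_iff) (auto simp: A'_def)
    moreover have "A' \<union> {a, b} = A" using a b by (auto simp: A'_def)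
    moreover have "\<forall>B\<in>\<pi> \<union> {{a, b}}. \<forall>k\<in>B. \<forall>l\<in>B. i k = i l"
    proof (intro ballI)
      fix B k l assume *: "B \<in> \<pi> \<union> {{a, b}}" "k \<in> B" "l \<in> B"
      show "i k = i l"
      proof (cases "B \<in> \<pi>")
        case True
        with *(2,3) \<pi>(2) show ?thesis by blast
      next
        case False
        with * have "k \<in> {a, b}" "l \<in> {a, b}" by auto
        then show ?thesis using b(3) by auto
      qed
    qed
    ultimately show ?thesis by metis
  qed
qed

definition block :: "nat set set \<Rightarrow> nat \<Rightarrow> nat set" where
  "block \<pi> k = (THE B. B \<in> \<pi> \<and> k \<in> B)"

lemma block_eq:
  assumes "\<pi> \<in> pairings A" "B \<in> \<pi>" "k \<in> B"
  shows "block \<pi> k = B"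
  unfolding block_def
proof (rule the_equality)
  fix C assume "C \<in> \<pi> \<and> k \<in> C"
  then show "C = B" using pairingsD(2)[OF assms(1), of B C] assms(2,3) by blast
qed (use assms in auto)

lemma block_in:
  assumes "\<pi> \<in> pairings A" "k \<in> A"
  shows "block \<pi> k \<in> \<pi>"
proof -
  obtain B where "B \<in> \<pi>" "k \<in> B" using pairingsD(1)[OF assms(1)] assms(2) by auto
  then show ?thesis using block_eq[OF assms(1)] by simp
qed

text \<open>Restricted to the positions below p, so that labellings of blocks can be counted inside
  an extensional function space.\<close>

definition block_tuple :: "nat \<Rightarrow> nat set set \<Rightarrow> (nat set \<Rightarrow> nat) \<Rightarrow> nat \<Rightarrow> nat" where
  "block_tuple p \<pi> \<phi> = (\<lambda>k\<in>{..<p}. \<phi> (block \<pi> k))"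

lemma block_tuple_eq:
  assumes "\<pi> \<in> pairings {..<p}" "B \<in> \<pi>" "k \<in> B"
  shows "block_tuple p \<pi> \<phi> k = \<phi> B"
proof -
  have "k < p" using pairingsD(6)[OF assms(1,2)] assms(3) by auto
  then show ?thesis using block_eq[OF assms] by (simp add: block_tuple_def)
qed

lemma block_tuple_inj:
  assumes \<pi>: "\<pi> \<in> pairings {..<p}"
  shows "inj_on (block_tuple p \<pi>) (\<pi> \<rightarrow>\<^sub>E {..<N})"
proof (rule inj_onI)
  fix \<phi> \<psi> assume \<phi>: "\<phi> \<in> \<pi> \<rightarrow>\<^sub>E {..<N}" and \<psi>: "\<psi> \<in> \<pi> \<rightarrow>\<^sub>E {..<N}"
    and eq: "block_tuple p \<pi> \<phi> = block_tuple p \<pi> \<psi>"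
  show "\<phi> = \<psi>"
  proof (rule PiE_ext[OF \<phi> \<psi>])
    fix B assume B: "B \<in> \<pi>"
    then obtain k where "k \<in> B" using pairingsD(5)[OF \<pi>] by blast
    then show "\<phi> B = \<psi> B" using block_tuple_eq[OF \<pi> B] eq by metis
  qed
qed

lemma adapted_block_tuple:
  assumes "\<pi> \<in> pairings {..<p}" "inj_on \<phi> \<pi>"
  shows "adapted \<pi> \<phi> (block_tuple p \<pi> \<phi>)"
  using assms block_tuple_eq by (auto simp: adapted_def)

text \<open>The pairing is recovered from the tuple as the set of its fibres.\<close>

lemma adapted_unique:
  assumes "\<pi> \<in> pairings {..<p}" "adapted \<pi> \<phi> i" "\<pi>' \<in> pairings {..<p}" "adapted \<pi>' \<phi>' i"
  shows "\<pi> = \<pi>'"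
proof -
  have "\<pi> = (\<lambda>k. {l\<in>{..<p}. i l = i k}) ` {..<p}"
    if \<pi>: "\<pi> \<in> pairings {..<p}" and a: "adapted \<pi> \<phi> i" for \<pi> \<phi>
  proof -
    have "{l\<in>{..<p}. i l = i k} = block \<pi> k" if "k < p" for k
    proof -
      have "block \<pi> k \<in> \<pi>" using block_in[OF \<pi>] that by simp
      moreover obtain B where "B \<in> \<pi>" "k \<in> B"
        using pairingsD(1)[OF \<pi>] \<open>k < p\<close> by blast
      ultimately show ?thesis
        using fibre_adapted[OF \<pi> a \<open>B \<in> \<pi>\<close>] a block_eq[OF \<pi>] by (simp add: adapted_def)
    qed
    moreover have "block \<pi> ` {..<p} = \<pi>"
    proof (intro equalityI subsetI)
      fix B assume B: "B \<in> \<pi>"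
      then obtain k where "k \<in> B" using pairingsD(5)[OF \<pi>] by blast
      then show "B \<in> block \<pi> ` {..<p}"
        using block_eq[OF \<pi> B] pairingsD(6)[OF \<pi> B] by (intro image_eqI[of _ _ k]) auto
    qed (use block_in[OF \<pi>] in auto)
    ultimately show ?thesis by (metis (no_types, lifting) image_cong lessThan_iff)
  qed
  from this[OF assms(1,2)] this[OF assms(3,4)] show ?thesis by simp
qed

text \<open>If two blocks share a label, the value at one of them is redundant: overwriting it
  arbitrarily embeds these labellings times \<open>{..<N}\<close> into all labellings. The factor N
  stays on the left to avoid the exponent \<open>card P - 1\<close>.\<close>

lemma card_not_inj_le:
  assumes "finite P"
  shows "card {\<phi>\<in>P \<rightarrow>\<^sub>E {..<N::nat}. \<not> inj_on \<phi> P} * N \<le> (card P)\<^sup>2 * N ^ card P"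
proof -
  have pair: "card {\<phi>\<in>P \<rightarrow>\<^sub>E {..<N}. \<phi> U = \<phi> V} * N \<le> N ^ card P" if UV: "U \<in> P" "V \<in> P" "U \<noteq> V" for U V
  proof -
    have inj: "inj_on (\<lambda>(\<phi>, a). \<phi>(V := a)) ({\<phi>\<in>P \<rightarrow>\<^sub>E {..<N}. \<phi> U = \<phi> V} \<times> {..<N})"
    proof (rule inj_onI, clarify)
      fix \<phi> \<psi> :: "'a \<Rightarrow> nat" and a b assume *: "\<phi> U = \<phi> V" "\<psi> U = \<psi> V" "\<phi>(V := a) = \<psi>(V := b)"
      then have "\<phi> V = \<psi> V" using UV by (metis fun_upd_other)
      moreover have "\<phi> W = \<psi> W" if "W \<noteq> V" for W using * that by (metis fun_upd_other)
      ultimately have "\<phi> = \<psi>" by (metis ext)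
      moreover have "a = b" using * by (metis fun_upd_same)
      ultimately show "\<phi> = \<psi> \<and> a = b" by simp
    qed
    have "card ({\<phi>\<in>P \<rightarrow>\<^sub>E {..<N}. \<phi> U = \<phi> V} \<times> {..<N}) \<le> card (P \<rightarrow>\<^sub>E {..<N})"
      using UV assms by (intro card_inj_on_le[OF inj] finite_PiE) (auto simp: PiE_def extensional_def Pi_def)
    then show ?thesis using assms by (simp add: card_cartesian_product card_PiE)
  qed
  have "{\<phi>\<in>P \<rightarrow>\<^sub>E {..<N}. \<not> inj_on \<phi> P} \<subseteq>
     (\<Union>e\<in>{e\<in>P \<times> P. fst e \<noteq> snd e}. {\<phi>\<in>P \<rightarrow>\<^sub>E {..<N}. \<phi> (fst e) = \<phi> (snd e)})"
    by (force simp: inj_on_def)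
  then have "card {\<phi>\<in>P \<rightarrow>\<^sub>E {..<N}. \<not> inj_on \<phi> P} \<le>
      card (\<Union>e\<in>{e\<in>P \<times> P. fst e \<noteq> snd e}. {\<phi>\<in>P \<rightarrow>\<^sub>E {..<N}. \<phi> (fst e) = \<phi> (snd e)})"
    using assms by (intro card_mono finite_UN_I) (auto intro!: finite_subset[OF _ finite_PiE[of P "\<lambda>_. {..<N}"]])
  also have "\<dots> \<le> (\<Sum>e\<in>{e\<in>P \<times> P. fst e \<noteq> snd e}. card {\<phi>\<in>P \<rightarrow>\<^sub>E {..<N}. \<phi> (fst e) = \<phi> (snd e)})"
    using assms by (intro card_UN_le) auto
  finally have "card {\<phi>\<in>P \<rightarrow>\<^sub>E {..<N}. \<not> inj_on \<phi> P} * N \<le>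
     (\<Sum>e\<in>{e\<in>P \<times> P. fst e \<noteq> snd e}. card {\<phi>\<in>P \<rightarrow>\<^sub>E {..<N}. \<phi> (fst e) = \<phi> (snd e)}) * N"
    by (rule mult_right_mono) simp
  also have "\<dots> = (\<Sum>e\<in>{e\<in>P \<times> P. fst e \<noteq> snd e}. card {\<phi>\<in>P \<rightarrow>\<^sub>E {..<N}. \<phi> (fst e) = \<phi> (snd e)} * N)"
    by (rule sum_distrib_right)
  also have "\<dots> \<le> (\<Sum>e\<in>{e\<in>P \<times> P. fst e \<noteq> snd e}. N ^ card P)"
    using pair by (intro sum_mono) auto
  also have "\<dots> \<le> card (P \<times> P) * N ^ card P"
  proof -
    have "card {e\<in>P \<times> P. fst e \<noteq> snd e} \<le> card (P \<times> P)" using assms by (intro card_mono) auto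
    then show ?thesis by simp
  qed
  finally show ?thesis by (simp add: card_cartesian_product power2_eq_square)
qed

text \<open>Injective labellings of the blocks contribute \<open>W \<pi>\<close> each, and distinct
  pairings give distinct tuples. A tuple that comes from no labelling has an odd fibre and
  contributes 0. The collisions are fewer by a factor N; they enter twice, as terms of the sum and
  as tuples missing from the main term, whence the constant 2.\<close>

lemma sum_tuples_approx:
  fixes T :: "(nat \<Rightarrow> nat) \<Rightarrow> real" and W :: "nat set set \<Rightarrow> real"
  assumes T: "\<And>i. \<bar>T i\<bar> \<le> 1" and W: "\<And>\<pi>. \<bar>W \<pi>\<bar> \<le> 1"
    and odd: "\<And>i a. odd (card {l\<in>{..<p}. i l = a}) \<Longrightarrow> T i = 0"
    and adapted: "\<And>i \<phi> \<pi>. \<pi> \<in> pairings {..<p} \<Longrightarrow> adapted \<pi> \<phi> i \<Longrightarrow> \<phi> ` \<pi> \<subseteq> {..<N} \<Longrightarrow> T i = W \<pi>"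
  shows "\<bar>(\<Sum>i\<in>{..<p} \<rightarrow>\<^sub>E {..<N}. T i) - real N ^ (p div 2) * (\<Sum>\<pi>\<in>pairings {..<p}. W \<pi>)\<bar> * real N
    \<le> 2 * real (card (pairings {..<p})) * (real (p div 2))\<^sup>2 * real N ^ (p div 2)"
proof -
  define n where "n = p div 2"
  define PP where "PP = pairings {..<p}"
  have finP: "finite PP" by (simp add: PP_def finite_pairings)
  have PP: "finite \<pi>" "card \<pi> = n" if "\<pi> \<in> PP" for \<pi>
    using finite_pairing[of \<pi> "{..<p}"] card_pairing[of \<pi> "{..<p}"] that by (auto simp: PP_def n_def)
  define A where "A \<pi> = \<pi> \<rightarrow>\<^sub>E {..<N}" for \<pi> :: "nat set set"
  define G where "G \<pi> = block_tuple p \<pi> ` {\<phi>\<in>A \<pi>. inj_on \<phi> \<pi>}" for \<pi>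
  define E where "E \<pi> = block_tuple p \<pi> ` {\<phi>\<in>A \<pi>. \<not> inj_on \<phi> \<pi>}" for \<pi>
  have finA: "finite (A \<pi>)" if "\<pi> \<in> PP" for \<pi>
    unfolding A_def using PP[OF that] by (intro finite_PiE) auto
  have finGE: "finite (G \<pi>)" "finite (E \<pi>)" if "\<pi> \<in> PP" for \<pi>
    using finA[OF that] by (auto simp: G_def E_def)
  have cardA: "card (A \<pi>) = N ^ n" if "\<pi> \<in> PP" for \<pi>
    using PP[OF that] by (simp add: A_def card_PiE)
  have inj: "inj_on (block_tuple p \<pi>) (A \<pi>)" if "\<pi> \<in> PP" for \<pi>
    using block_tuple_inj that by (simp add: PP_def A_def)
  have cardG: "real (card (G \<pi>)) = real N ^ n - real (card (E \<pi>))" if "\<pi> \<in> PP" for \<pi>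
  proof -
    have "card (G \<pi>) + card (E \<pi>) = card {\<phi>\<in>A \<pi>. inj_on \<phi> \<pi>} + card {\<phi>\<in>A \<pi>. \<not> inj_on \<phi> \<pi>}"
      unfolding G_def E_def using inj_on_subset[OF inj[OF that]] by (simp add: card_image)
    also have "\<dots> = card ({\<phi>\<in>A \<pi>. inj_on \<phi> \<pi>} \<union> {\<phi>\<in>A \<pi>. \<not> inj_on \<phi> \<pi>})"
      using finA[OF that] by (intro card_Un_disjoint[symmetric]) auto
    also have "{\<phi>\<in>A \<pi>. inj_on \<phi> \<pi>} \<union> {\<phi>\<in>A \<pi>. \<not> inj_on \<phi> \<pi>} = A \<pi>" by auto
    finally have "card (G \<pi>) + card (E \<pi>) = N ^ n" using cardA[OF that] by simp
    then show ?thesis by (metis add_diff_cancel_right' of_nat_add of_nat_power)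
  qed
  have cardE: "real (card (E \<pi>)) * real N \<le> (real n)\<^sup>2 * real N ^ n" if "\<pi> \<in> PP" for \<pi>
  proof -
    have "card (E \<pi>) \<le> card {\<phi>\<in>A \<pi>. \<not> inj_on \<phi> \<pi>}"
      unfolding E_def using finA[OF that] by (intro card_image_le) auto
    then have "card (E \<pi>) * N \<le> card {\<phi>\<in>A \<pi>. \<not> inj_on \<phi> \<pi>} * N" by simp
    also have "\<dots> \<le> n\<^sup>2 * N ^ n"
      using card_not_inj_le[OF PP(1)[OF that], of N] PP(2)[OF that] by (simp add: A_def)
    finally have "real (card (E \<pi>) * N) \<le> real (n\<^sup>2 * N ^ n)" by (rule of_nat_mono)
    then show ?thesis by simp
  qed
  have TG: "T i = W \<pi>" if \<pi>: "\<pi> \<in> PP" and i: "i \<in> G \<pi>" for \<pi> i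
  proof -
    obtain \<phi> where \<phi>: "\<phi> \<in> A \<pi>" "inj_on \<phi> \<pi>" "i = block_tuple p \<pi> \<phi>" using i by (auto simp: G_def)
    show ?thesis
    proof -
      have "\<phi> ` \<pi> \<subseteq> {..<N}" using \<phi>(1) by (auto simp: A_def)
      moreover have "adapted \<pi> \<phi> i" using adapted_block_tuple[of \<pi> p \<phi>] \<phi> \<pi> by (simp add: PP_def)
      ultimately show ?thesis using adapted \<pi> by (simp add: PP_def)
    qed
  qed
  have disj: "G \<pi> \<inter> G \<pi>' = {}" if "\<pi> \<in> PP" "\<pi>' \<in> PP" "\<pi> \<noteq> \<pi>'" for \<pi> \<pi>'
  proof (rule ccontr)
    assume "G \<pi> \<inter> G \<pi>' \<noteq> {}"
    then obtain i \<phi> \<phi>' where i: "i = block_tuple p \<pi> \<phi>" "inj_on \<phi> \<pi>" "i = block_tuple p \<pi>' \<phi>'" "inj_on \<phi>' \<pi>'"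
      unfolding G_def by blast
    have "\<pi> \<in> pairings {..<p}" "\<pi>' \<in> pairings {..<p}" using that by (simp_all add: PP_def)
    then have "\<pi> = \<pi>'"
      using adapted_unique[of \<pi> p \<phi> i \<pi>' \<phi>'] adapted_block_tuple[of \<pi> p \<phi>] adapted_block_tuple[of \<pi>' p \<phi>'] i
      by simp
    with that show False by simp
  qed
  define X where "X = {..<p} \<rightarrow>\<^sub>E {..<N}"
  have finX: "finite X" by (simp add: X_def finite_PiE)
  have blk: "block \<pi> k \<in> \<pi>" if "\<pi> \<in> PP" "k < p" for \<pi> k
    using block_in[of \<pi> "{..<p}" k] that by (simp add: PP_def)
  have sub: "G \<pi> \<subseteq> X" "E \<pi> \<subseteq> X" if "\<pi> \<in> PP" for \<pi>
    using blk[OF that] by (auto simp: G_def E_def X_def A_def block_tuple_def PiE_def Pi_def)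
  have cover: "T i = 0" if i: "i \<in> X" "i \<notin> (\<Union>\<pi>\<in>PP. G \<pi> \<union> E \<pi>)" for i
  proof (rule ccontr)
    assume "T i \<noteq> 0"
    then have "even (card {l\<in>{..<p}. i l = a})" for a using odd by blast
    then obtain \<pi> where \<pi>: "\<pi> \<in> PP" "\<forall>B\<in>\<pi>. \<forall>k\<in>B. \<forall>l\<in>B. i k = i l"
      using even_fibres_pairing[of "{..<p}" i] by (auto simp: PP_def)
    \<comment> \<open>Any point of the block would do, as i is constant on blocks.\<close>
    define \<phi> where "\<phi> = (\<lambda>B\<in>\<pi>. i (Min B))"
    have Min: "Min B \<in> B" if "B \<in> \<pi>" for B
      using pairingsD(4,5)[of \<pi> "{..<p}"] \<pi>(1) that by (intro Min_in) (auto simp: PP_def)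
    have "i = block_tuple p \<pi> \<phi>"
    proof
      fix k show "i k = block_tuple p \<pi> \<phi> k"
      proof (cases "k < p")
        case True
        have \<pi>p: "\<pi> \<in> pairings {..<p}" using \<pi>(1) by (simp add: PP_def)
        have "k \<in> \<Union>\<pi>" unfolding pairingsD(1)[OF \<pi>p] using True by simp
        then obtain B where B: "B \<in> \<pi>" "k \<in> B" by blast
        have "block_tuple p \<pi> \<phi> k = i (Min B)"
          using block_tuple_eq[OF \<pi>p B] B(1) by (simp add: \<phi>_def)
        also have "\<dots> = i k" using \<pi>(2) Min[OF B(1)] B by blast
        finally show ?thesis by simp
      next
        case False
        then show ?thesis using i(1) by (auto simp: X_def block_tuple_def PiE_def extensional_def)
      qed
    qed
    moreover have "\<phi> \<in> A \<pi>"
    proof -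
      have "Min B < p" if "B \<in> \<pi>" for B
        using Min[OF that] pairingsD(6)[of \<pi> "{..<p}" B] \<pi>(1) that by (auto simp: PP_def)
      then show ?thesis using i(1) unfolding \<phi>_def A_def X_def by auto
    qed
    ultimately have "i \<in> G \<pi> \<union> E \<pi>" by (auto simp: G_def E_def)
    with i(2) \<pi>(1) show False by blast
  qed
  \<comment> \<open>Removing the injective tuples makes the error part disjoint from the main term
    by construction; only its cardinality matters.\<close>
  define B where "B = X \<inter> (\<Union>\<pi>\<in>PP. E \<pi>) - (\<Union>\<pi>\<in>PP. G \<pi>)"
  have "(\<Sum>i\<in>X. T i) = (\<Sum>i\<in>(\<Union>\<pi>\<in>PP. G \<pi>) \<union> B. T i)"
    using finX sub cover by (intro sum.mono_neutral_right) (auto simp: B_def)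
  also have "\<dots> = (\<Sum>i\<in>(\<Union>\<pi>\<in>PP. G \<pi>). T i) + (\<Sum>i\<in>B. T i)"
    using finX finP finGE by (intro sum.union_disjoint) (auto simp: B_def)
  also have "(\<Sum>i\<in>(\<Union>\<pi>\<in>PP. G \<pi>). T i) = (\<Sum>\<pi>\<in>PP. \<Sum>i\<in>G \<pi>. T i)"
    using finP finGE disj by (intro sum.UNION_disjoint) auto
  also have "\<dots> = (\<Sum>\<pi>\<in>PP. real N ^ n * W \<pi> - real (card (E \<pi>)) * W \<pi>)"
  proof (rule sum.cong[OF refl])
    fix \<pi> assume \<pi>: "\<pi> \<in> PP"
    have "(\<Sum>i\<in>G \<pi>. T i) = real (card (G \<pi>)) * W \<pi>" using TG[OF \<pi>] by simp
    then show "(\<Sum>i\<in>G \<pi>. T i) = real N ^ n * W \<pi> - real (card (E \<pi>)) * W \<pi>"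
      by (simp only: cardG[OF \<pi>] left_diff_distrib)
  qed
  finally have "(\<Sum>i\<in>X. T i) - real N ^ n * (\<Sum>\<pi>\<in>PP. W \<pi>) = (\<Sum>i\<in>B. T i) - (\<Sum>\<pi>\<in>PP. real (card (E \<pi>)) * W \<pi>)"
    by (simp add: sum_subtractf sum_distrib_left)
  moreover have "\<bar>\<Sum>\<pi>\<in>PP. real (card (E \<pi>)) * W \<pi>\<bar> \<le> (\<Sum>\<pi>\<in>PP. real (card (E \<pi>)))"
    by (intro order_trans[OF sum_abs] sum_mono) (use W in \<open>auto simp: abs_mult mult_left_le\<close>)
  moreover have "\<bar>\<Sum>i\<in>B. T i\<bar> \<le> (\<Sum>\<pi>\<in>PP. real (card (E \<pi>)))"
  proof -
    have "\<bar>\<Sum>i\<in>B. T i\<bar> \<le> (\<Sum>i\<in>B. 1)" by (intro order_trans[OF sum_abs] sum_mono T)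
    also have "\<dots> = real (card B)" by simp
    also have "card B \<le> card (\<Union>\<pi>\<in>PP. E \<pi>)"
      using finP finGE by (intro card_mono) (auto simp: B_def)
    also have "\<dots> \<le> (\<Sum>\<pi>\<in>PP. card (E \<pi>))" by (rule card_UN_le[OF finP])
    finally show ?thesis by simp
  qed
  ultimately have "\<bar>(\<Sum>i\<in>X. T i) - real N ^ n * (\<Sum>\<pi>\<in>PP. W \<pi>)\<bar> \<le> 2 * (\<Sum>\<pi>\<in>PP. real (card (E \<pi>)))"
    by linarith
  then have "\<bar>(\<Sum>i\<in>X. T i) - real N ^ n * (\<Sum>\<pi>\<in>PP. W \<pi>)\<bar> * real N \<le> 2 * (\<Sum>\<pi>\<in>PP. real (card (E \<pi>))) * real N"
    by (rule mult_right_mono) simp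
  also have "\<dots> = 2 * (\<Sum>\<pi>\<in>PP. real (card (E \<pi>)) * real N)" by (simp add: sum_distrib_right)
  also have "\<dots> \<le> 2 * (\<Sum>\<pi>\<in>PP. (real n)\<^sup>2 * real N ^ n)"
    by (intro mult_left_mono sum_mono cardE) auto
  also have "\<dots> = 2 * real (card PP) * (real n)\<^sup>2 * real N ^ n" by simp
  finally show ?thesis unfolding X_def n_def PP_def .
qed

subsection \<open>The limit of the spin model\<close>

context kernel
begin

text \<open>The spin model orients edges by the labels of the blocks, the intersection graph by
  their minima; the symmetry of w reconciles the two.\<close>

lemma edge_product_eq:
  fixes \<phi> :: "nat set \<Rightarrow> nat"
  assumes \<pi>: "\<pi> \<in> pairings A" and inj: "inj_on \<phi> \<pi>"
  shows "(\<Prod>(U, V)\<in>{(U, V). U \<in> \<pi> \<and> V \<in> \<pi> \<and> \<phi> U < \<phi> V \<and> blocks_cross U V}. w (x U) (x V)) =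
    (\<Prod>(U, V)\<in>crossing_edges \<pi>. w (x U) (x V))"
proof -
  have Min: "Min U \<noteq> Min V" if "U \<in> \<pi>" "V \<in> \<pi>" "U \<noteq> V" for U V
  proof
    assume eq: "Min U = Min V"
    have "Min U \<in> U" "Min V \<in> V" using pairingsD(4,5)[OF \<pi>] that by (auto intro!: Min_in)
    with pairingsD(2)[OF \<pi> that] eq show False by auto
  qed
  have \<phi>: "\<phi> U \<noteq> \<phi> V" if "U \<in> \<pi>" "V \<in> \<pi>" "U \<noteq> V" for U V
    using inj that by (auto dest: inj_onD)
  let ?i = "\<lambda>(U, V). if \<phi> U < \<phi> V then (U, V) else (V, U)"
  let ?j = "\<lambda>(U, V). if Min U < Min V then (U, V) else (V, U)"
  show ?thesis
  proof (rule prod.reindex_bij_witness[of _ ?i ?j])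
    fix e assume "e \<in> {(U, V). U \<in> \<pi> \<and> V \<in> \<pi> \<and> \<phi> U < \<phi> V \<and> blocks_cross U V}"
    then obtain U V where e: "e = (U, V)" "U \<in> \<pi>" "V \<in> \<pi>" "\<phi> U < \<phi> V" "blocks_cross U V" by auto
    then have "U \<noteq> V" by auto
    then have "Min U < Min V \<or> Min V < Min U" using Min[OF e(2,3)] by auto
    then show "?i (?j e) = e" "?j e \<in> crossing_edges \<pi>"
        "(case ?j e of (U, V) \<Rightarrow> w (x U) (x V)) = (case e of (U, V) \<Rightarrow> w (x U) (x V))"
      using e by (auto simp: crossing_edges_def blocks_cross_commute[of V U] sym[of "x V" "x U"])
  next
    fix e assume "e \<in> crossing_edges \<pi>"
    then obtain U V where e: "e = (U, V)" "U \<in> \<pi>" "V \<in> \<pi>" "Min U < Min V" "blocks_cross U V"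
      by (auto simp: crossing_edges_def)
    then have "U \<noteq> V" by auto
    then have "\<phi> U < \<phi> V \<or> \<phi> V < \<phi> U" using \<phi>[OF e(2,3)] by auto
    then show "?j (?i e) = e" "?i e \<in> {(U, V). U \<in> \<pi> \<and> V \<in> \<pi> \<and> \<phi> U < \<phi> V \<and> blocks_cross U V}"
      using e by (auto simp: blocks_cross_commute[of V U])
  qed
qed

abbreviation weights :: "(nat \<Rightarrow> real) \<Rightarrow> nat \<times> nat \<Rightarrow> real" where
  "weights x \<equiv> \<lambda>(a, b). w (x a) (x b)"

lemma abs_weights: "\<bar>weights x e\<bar> \<le> 1"
  by (simp add: case_prod_beta bound)

definition tuple_density :: "nat \<Rightarrow> nat \<Rightarrow> (nat \<Rightarrow> real \<Rightarrow> real) \<Rightarrow> (nat \<Rightarrow> nat) \<Rightarrow> (nat \<Rightarrow> real) \<Rightarrow> real" where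
  "tuple_density N p f i x = (\<Prod>k<p. f k (x (i k))) * averaged_trace N (weights x) (map i [0..<p])"

lemma coordinate_measurable:
  "a \<in> I \<Longrightarrow> (\<lambda>x. x a) \<in> borel_measurable (\<Pi>\<^sub>M a\<in>I. uniform)"
  by (intro measurable_uniform measurable_component_singleton)

lemma averaged_trace_measurable:
  "(\<lambda>x. averaged_trace N (weights x) is) \<in> borel_measurable (\<Pi>\<^sub>M a\<in>{..<N}. uniform)"
  unfolding averaged_trace_def sign_average_def
proof (intro borel_measurable_sum borel_measurable_times borel_measurable_prod borel_measurable_const, goal_cases)
  case (1 s e)
  then obtain a b where "e = (a, b)" "a < N" "b < N" by (auto simp: edges_def)
  then show ?case
    by (auto intro!: borel_measurable_divide borel_measurable_add borel_measurable_times borel_measurable_const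
        measurable_w coordinate_measurable)
qed

lemma tuple_density_measurable:
  assumes f: "\<And>k. f k \<in> borel_measurable borel" and i: "i \<in> {..<p} \<rightarrow>\<^sub>E {..<N}"
  shows "tuple_density N p f i \<in> borel_measurable (\<Pi>\<^sub>M a\<in>{..<N}. uniform)"
  unfolding tuple_density_def
proof (intro borel_measurable_times averaged_trace_measurable borel_measurable_prod)
  fix k assume "k \<in> {..<p}"
  then have "i k \<in> {..<N}" using i by auto
  from measurable_compose[OF coordinate_measurable[OF this] f]
  show "(\<lambda>x. f k (x (i k))) \<in> borel_measurable (\<Pi>\<^sub>M a\<in>{..<N}. uniform)" .
qed

lemma abs_tuple_density_le:
  assumes "\<And>k x. \<bar>f k x\<bar> \<le> 1"
  shows "\<bar>tuple_density N p f i x\<bar> \<le> 1"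
  unfolding tuple_density_def abs_mult abs_prod
  by (intro mult_le_one prod_le_1 abs_averaged_trace_le abs_weights) (use assms in auto)

lemma integrable_tuple_density:
  assumes "\<And>k. f k \<in> borel_measurable borel" "\<And>k x. \<bar>f k x\<bar> \<le> 1" "i \<in> {..<p} \<rightarrow>\<^sub>E {..<N}"
  shows "integrable (\<Pi>\<^sub>M a\<in>{..<N}. uniform) (tuple_density N p f i)"
proof -
  interpret prob_space "\<Pi>\<^sub>M a\<in>{..<N}. uniform" by (intro prob_space_PiM prob_space_uniform)
  show ?thesis
    by (rule integrable_const_bound[of _ 1])
       (use tuple_density_measurable[OF assms(1,3)] abs_tuple_density_le[OF assms(2)] in auto)
qed

definition tuple_weight :: "nat \<Rightarrow> nat \<Rightarrow> (nat \<Rightarrow> real \<Rightarrow> real) \<Rightarrow> (nat \<Rightarrow> nat) \<Rightarrow> real" where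
  "tuple_weight N p f i = (\<integral>x. tuple_density N p f i x \<partial>(\<Pi>\<^sub>M a\<in>{..<N}. uniform))"

text \<open>The counting lemma asks for this bound at every tuple, including those where the density
  is not known to be integrable; the integral is then 0 by convention.\<close>

lemma abs_tuple_weight_le:
  assumes "\<And>k x. \<bar>f k x\<bar> \<le> 1"
  shows "\<bar>tuple_weight N p f i\<bar> \<le> 1"
proof (cases "integrable (\<Pi>\<^sub>M a\<in>{..<N}. uniform) (tuple_density N p f i)")
  case True
  interpret prob_space "\<Pi>\<^sub>M a\<in>{..<N}. uniform" by (intro prob_space_PiM prob_space_uniform)
  have "\<bar>tuple_weight N p f i\<bar> \<le> expectation (\<lambda>x. \<bar>tuple_density N p f i x\<bar>)"
    unfolding tuple_weight_def by (rule integral_abs_bound)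
  also have "\<dots> \<le> expectation (\<lambda>x. 1)"
    by (intro integral_mono integrable_abs True abs_tuple_density_le assms) auto
  finally show ?thesis by (simp add: prob_space)
qed (simp add: tuple_weight_def not_integrable_integral_eq)

text \<open>An adapted tuple uses different sample points for different blocks, and the joint law of
  these coordinates is again a product of uniform laws.\<close>

lemma tuple_weight_adapted:
  assumes f: "\<And>k. f k \<in> borel_measurable borel"
    and \<pi>: "\<pi> \<in> pairings {..<p}" and a: "adapted \<pi> \<phi> i" and N: "\<phi> ` \<pi> \<subseteq> {..<N}"
  shows "tuple_weight N p f i = pairing_weight w f \<pi>"
proof -
  have inj: "inj_on \<phi> \<pi>" using a by (simp add: adapted_def)
  let ?K = "\<Pi>\<^sub>M a\<in>{..<N}. uniform" and ?I = "\<Pi>\<^sub>M B\<in>\<pi>. uniform"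
  have dens: "tuple_density N p f i x = pairing_density w f \<pi> (\<lambda>B\<in>\<pi>. x (\<phi> B))" for x
  proof -
    have "(\<Prod>k<p. f k (x (i k))) = (\<Prod>k\<in>\<Union>\<pi>. f k (x (i k)))" by (simp add: pairingsD(1)[OF \<pi>])
    also have "\<dots> = (\<Prod>B\<in>\<pi>. \<Prod>k\<in>B. f k (x (i k)))"
      using pairingsD(2,4)[OF \<pi>] by (subst prod.Union_disjoint) auto
    also have "\<dots> = (\<Prod>B\<in>\<pi>. \<Prod>k\<in>B. f k ((\<lambda>B\<in>\<pi>. x (\<phi> B)) B))"
      using a by (intro prod.cong) (auto simp: adapted_def)
    finally have 1: "(\<Prod>k<p. f k (x (i k))) = (\<Prod>B\<in>\<pi>. \<Prod>k\<in>B. f k ((\<lambda>B\<in>\<pi>. x (\<phi> B)) B))" .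
    have "averaged_trace N (weights x) (map i [0..<p]) =
        (\<Prod>(U, V)\<in>{(U, V). U \<in> \<pi> \<and> V \<in> \<pi> \<and> \<phi> U < \<phi> V \<and> blocks_cross U V}. w (x (\<phi> U)) (x (\<phi> V)))"
      by (subst averaged_trace_adapted[OF \<pi> a N]) simp
    also have "\<dots> = (\<Prod>(U, V)\<in>crossing_edges \<pi>. w (x (\<phi> U)) (x (\<phi> V)))"
      using edge_product_eq[OF \<pi> inj, of "\<lambda>B. x (\<phi> B)"] by simp
    also have "\<dots> = (\<Prod>(U, V)\<in>crossing_edges \<pi>. w ((\<lambda>B\<in>\<pi>. x (\<phi> B)) U) ((\<lambda>B\<in>\<pi>. x (\<phi> B)) V))"
      using crossing_edges_subset[of \<pi>] by (intro prod.cong) auto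
    finally show ?thesis by (simp only: tuple_density_def pairing_density_def 1)
  qed
  have distr: "distr ?K ?I (\<lambda>x. \<lambda>B\<in>\<pi>. x (\<phi> B)) = ?I"
    using distr_PiM_reindex[of "{..<N}" "\<lambda>_. uniform" \<phi> \<pi>] prob_space_uniform inj N by auto
  have "pairing_weight w f \<pi> = (\<integral>x. pairing_density w f \<pi> x \<partial>distr ?K ?I (\<lambda>x. \<lambda>B\<in>\<pi>. x (\<phi> B)))"
    by (simp only: distr pairing_weight_def)
  also have "\<dots> = (\<integral>x. pairing_density w f \<pi> (\<lambda>B\<in>\<pi>. x (\<phi> B)) \<partial>?K)"
  proof (rule integral_distr)
    show "(\<lambda>x. \<lambda>B\<in>\<pi>. x (\<phi> B)) \<in> ?K \<rightarrow>\<^sub>M ?I"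
      using N by (intro measurable_restrict measurable_component_singleton) auto
    show "pairing_density w f \<pi> \<in> borel_measurable ?I"
      by (intro pairing_density_measurable f) auto
  qed
  finally show ?thesis by (simp only: dens tuple_weight_def)
qed

lemma tuple_weight_odd:
  assumes "odd (card {l\<in>{..<p}. i l = a})"
  shows "tuple_weight N p f i = 0"
  by (simp add: tuple_weight_def tuple_density_def averaged_trace_odd[OF assms])

text \<open>Each pairing is met by about \<open>N ^ (p div 2)\<close> tuples, in balance with the
  normalisation; collisions leave an error of order 1 / N.\<close>

lemma tuple_weights_limit:
  assumes f: "\<And>k. f k \<in> borel_measurable borel" "\<And>k x. \<bar>f k x\<bar> \<le> 1"
  shows "(\<lambda>N. (1 / sqrt (real N)) ^ p * (\<Sum>i\<in>{..<p} \<rightarrow>\<^sub>E {..<N}. tuple_weight N p f i))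
    \<longlonglongrightarrow> word_moment w f {..<p}"
proof -
  define n where "n = p div 2"
  define C where "C = 2 * real (card (pairings {..<p})) * (real n)\<^sup>2"
  define S where "S N = (\<Sum>i\<in>{..<p} \<rightarrow>\<^sub>E {..<N}. tuple_weight N p f i)" for N
  have approx: "\<bar>S N - real N ^ n * word_moment w f {..<p}\<bar> * real N \<le> C * real N ^ n" for N
    unfolding S_def C_def n_def word_moment_def
    by (rule sum_tuples_approx) (use f in \<open>auto intro!: abs_tuple_weight_le abs_pairing_weight_le tuple_weight_odd tuple_weight_adapted\<close>)
  have key: "\<bar>(1 / sqrt (real N)) ^ p * S N - word_moment w f {..<p}\<bar> \<le> C / real N" if N: "N > 0" for N
  proof (cases "pairings {..<p} = {}")
    \<comment> \<open>This includes odd p, where \<open>sqrt N ^ p\<close> and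
      \<open>N ^ (p div 2)\<close> do not match: the error constant is 0, so the sum itself is
      0.\<close>
    case True
    then have "S N = 0" using approx[of N] N by (auto simp: C_def word_moment_def mult_le_0_iff)
    with True show ?thesis by (simp add: C_def word_moment_def)
  next
    case False
    then obtain \<pi> where "\<pi> \<in> pairings {..<p}" by auto
    then have "p = 2 * card \<pi>" using card_pairing[of \<pi> "{..<p}"] by simp
    then have p: "p = 2 * n" by (simp add: n_def)
    have e: "(1 / sqrt (real N)) ^ p = 1 / real N ^ n"
      using N by (simp add: p power_mult power_divide)
    have "\<bar>1 / real N ^ n * S N - word_moment w f {..<p}\<bar> = \<bar>S N - real N ^ n * word_moment w f {..<p}\<bar> / real N ^ n"
    proof -
      have "1 / real N ^ n * S N - word_moment w f {..<p} = (S N - real N ^ n * word_moment w f {..<p}) / real N ^ n"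
        using N by (simp add: field_simps)
      then show ?thesis by (simp add: abs_divide)
    qed
    also have "\<dots> \<le> C / real N" using approx[of N] N by (simp add: field_simps)
    finally show ?thesis by (simp only: e)
  qed
  have "(\<lambda>N. (1 / sqrt (real N)) ^ p * S N - word_moment w f {..<p}) \<longlonglongrightarrow> 0"
  proof (rule tendsto_0_le[where K = 1])
    show "(\<lambda>N. C / real N) \<longlonglongrightarrow> 0" by real_asymp
    show "\<forall>\<^sub>F N in sequentially. norm ((1 / sqrt (real N)) ^ p * S N - word_moment w f {..<p}) \<le> norm (C / real N) * 1"
      using eventually_gt_at_top[of 0] by eventually_elim (use key in \<open>force simp: C_def\<close>)
  qed
  then show ?thesis unfolding S_def by (simp add: LIM_zero_iff)
qed

lemma spin_moment_eq:
  assumes g: "\<And>l. g l \<in> borel_measurable borel" "\<And>l x. \<bar>g l x\<bar> \<le> 1"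
  shows "integrable (\<Pi>\<^sub>M a\<in>{..<N}. uniform) (\<lambda>x. spin_moment N (weights x) (\<lambda>l j. g l (x j)) u)"
    and "(\<integral>x. spin_moment N (weights x) (\<lambda>l j. g l (x j)) u \<partial>(\<Pi>\<^sub>M a\<in>{..<N}. uniform)) =
      (\<Sum>i\<in>{..<length u} \<rightarrow>\<^sub>E {..<N}. tuple_weight N (length u) (\<lambda>k. g (u ! k)) i)"
proof -
  define p where "p = length u"
  have eq: "spin_moment N (weights x) (\<lambda>l j. g l (x j)) u =
      (\<Sum>i\<in>{..<p} \<rightarrow>\<^sub>E {..<N}. tuple_density N p (\<lambda>k. g (u ! k)) i x)" for x
    unfolding spin_moment_def p_def[symmetric]
  proof (rule sum.reindex_bij_witness[where i = "\<lambda>i. map i [0..<p]" and j = "\<lambda>is. \<lambda>k\<in>{..<p}. is ! k"])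
    fix "is" assume isN: "is \<in> tuples N p"
    then have len: "length is = p" by (simp add: tuples_def)
    show m: "map (\<lambda>k\<in>{..<p}. is ! k) [0..<p] = is"
      by (rule nth_equalityI) (auto simp: len)
    show "(\<lambda>k\<in>{..<p}. is ! k) \<in> {..<p} \<rightarrow>\<^sub>E {..<N}"
      using isN len by (auto simp: tuples_def dest!: nth_mem)
    have "prod_list (map2 (\<lambda>l j. g l (x j)) u is) = (\<Prod>k<p. g (u ! k) (x (is ! k)))"
      by (subst prod.list_conv_set_nth) (simp add: len p_def lessThan_atLeast0)
    then show "tuple_density N p (\<lambda>k. g (u ! k)) (\<lambda>k\<in>{..<p}. is ! k) x =
        prod_list (map2 (\<lambda>l j. g l (x j)) u is) * averaged_trace N (weights x) is"
      unfolding tuple_density_def m by simp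
  next
    fix i assume i: "i \<in> {..<p} \<rightarrow>\<^sub>E {..<N}"
    show "(\<lambda>k\<in>{..<p}. map i [0..<p] ! k) = i"
    proof
      fix k show "(\<lambda>k\<in>{..<p}. map i [0..<p] ! k) k = i k"
        using PiE_arb[OF i, of k] by (cases "k < p") auto
    qed
    have "i k < N" if "k < p" for k using PiE_mem[OF i, of k] that by simp
    then show "map i [0..<p] \<in> tuples N p" by (auto simp: tuples_def)
  qed
  show "integrable (\<Pi>\<^sub>M a\<in>{..<N}. uniform) (\<lambda>x. spin_moment N (weights x) (\<lambda>l j. g l (x j)) u)"
    unfolding eq by (intro Bochner_Integration.integrable_sum integrable_tuple_density g)
  show "(\<integral>x. spin_moment N (weights x) (\<lambda>l j. g l (x j)) u \<partial>(\<Pi>\<^sub>M a\<in>{..<N}. uniform)) =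
      (\<Sum>i\<in>{..<length u} \<rightarrow>\<^sub>E {..<N}. tuple_weight N (length u) (\<lambda>k. g (u ! k)) i)"
    unfolding eq p_def[symmetric] tuple_weight_def
    by (intro Bochner_Integration.integral_sum integrable_tuple_density g)
qed

text \<open>The alphabet is left open: a one-letter alphabet gives the moments of a single measure,
  \<open>bool\<close> the joint moments of the two generators.\<close>

definition letter_moment :: "('l \<Rightarrow> real \<Rightarrow> real) \<Rightarrow> 'l list \<Rightarrow> real" where
  "letter_moment g u = word_moment w (\<lambda>k. g (u ! k)) {..<length u}"

lemma spin_moment_limit:
  assumes g: "\<And>l. g l \<in> borel_measurable borel" "\<And>l x. \<bar>g l x\<bar> \<le> 1"
  shows "(\<lambda>N. (1 / sqrt (real N)) ^ length u *
      (\<integral>x. spin_moment N (weights x) (\<lambda>l j. g l (x j)) u \<partial>(\<Pi>\<^sub>M a\<in>{..<N}. uniform)))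
    \<longlonglongrightarrow> letter_moment g u"
  unfolding letter_moment_def spin_moment_eq[OF g] by (intro tuple_weights_limit g)

text \<open>Inherited from the symmetry of the Gram matrices of the finite models; for empty u it
  says that a word and its reversal have the same moment.\<close>

lemma letter_moment_commute:
  assumes g: "\<And>l. g l \<in> borel_measurable borel" "\<And>l x. \<bar>g l x\<bar> \<le> 1"
  shows "letter_moment g (rev u @ v) = letter_moment g (rev v @ u)"
proof (rule LIMSEQ_unique[OF spin_moment_limit[OF g]])
  show "(\<lambda>N. (1 / sqrt (real N)) ^ length (rev u @ v) *
      (\<integral>x. spin_moment N (weights x) (\<lambda>l j. g l (x j)) (rev u @ v) \<partial>(\<Pi>\<^sub>M a\<in>{..<N}. uniform)))
    \<longlonglongrightarrow> letter_moment g (rev v @ u)"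
    using spin_moment_limit[OF g, of "rev v @ u"]
    by (simp add: spin_moment_commute[where u = v] add.commute)
qed

text \<open>The normalisation splits into one power for each of the two words and is absorbed into
  the coefficients, so every finite stage is nonnegative.\<close>

lemma letter_moment_positive:
  assumes g: "\<And>l. g l \<in> borel_measurable borel" "\<And>l x. \<bar>g l x\<bar> \<le> 1" and F: "finite F"
  shows "0 \<le> (\<Sum>u\<in>F. \<Sum>v\<in>F. c u * c v * letter_moment g (rev u @ v))"
proof -
  let ?I = "\<lambda>N u. \<integral>x. spin_moment N (weights x) (\<lambda>l j. g l (x j)) u \<partial>(\<Pi>\<^sub>M a\<in>{..<N}. uniform)"
  define d where "d N u = c u * (1 / sqrt (real N)) ^ length u" for N u
  have "0 \<le> (\<Sum>u\<in>F. \<Sum>v\<in>F. d N u * d N v * ?I N (rev u @ v))" for N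
  proof -
    have "0 \<le> (\<integral>x. (\<Sum>u\<in>F. \<Sum>v\<in>F. d N u * d N v * spin_moment N (weights x) (\<lambda>l j. g l (x j)) (rev u @ v)) \<partial>(\<Pi>\<^sub>M a\<in>{..<N}. uniform))"
      by (intro Bochner_Integration.integral_nonneg spin_moment_positive abs_weights F)
    then show ?thesis by (simp add: spin_moment_eq(1)[OF g])
  qed
  then have "0 \<le> (\<Sum>u\<in>F. \<Sum>v\<in>F. c u * c v * ((1 / sqrt (real N)) ^ length (rev u @ v) * ?I N (rev u @ v)))" for N
    by (simp add: d_def power_add mult_ac)
  moreover have "(\<lambda>N. \<Sum>u\<in>F. \<Sum>v\<in>F. c u * c v * ((1 / sqrt (real N)) ^ length (rev u @ v) * ?I N (rev u @ v)))
      \<longlonglongrightarrow> (\<Sum>u\<in>F. \<Sum>v\<in>F. c u * c v * letter_moment g (rev u @ v))"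
    by (intro tendsto_intros spin_moment_limit g)
  ultimately show ?thesis by (intro LIMSEQ_le_const) auto
qed

end

section \<open>The measures of kernels and gluing\<close>

lemma kernel_unit_kernel:
  assumes "kernel w"
  shows "unit_kernel w"
proof -
  interpret kernel w by fact
  have "case_prod w \<in> borel_measurable borel"
    using meas by (simp only: borel_prod)
  then have "case_prod w \<in> borel_measurable (restrict_space borel ({0..1} \<times> {0..1}))"
    by (rule measurable_restrict_space1)
  then show ?thesis
    using sym bound by (auto simp: unit_kernel_def abs_le_iff minus_le_iff)
qed

definition extend_kernel :: "(real \<Rightarrow> real \<Rightarrow> real) \<Rightarrow> real \<Rightarrow> real \<Rightarrow> real" where
  "extend_kernel w x y = (if x \<in> {0..1} \<and> y \<in> {0..1} then w x y else 0)"

lemma kernel_extend_kernel: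
  assumes "unit_kernel w"
  shows "kernel (extend_kernel w)"
proof
  have "(\<lambda>z. indicator ({0..1} \<times> {0..1}) z *\<^sub>R case_prod w z) \<in> borel_measurable borel"
    using assms unfolding unit_kernel_def
    by (subst (asm) borel_measurable_restrict_space_iff) (auto intro!: borel_closed closed_Times)
  also have "(\<lambda>z. indicator ({0..1} \<times> {0..1}) z *\<^sub>R case_prod w z) = case_prod (extend_kernel w)"
    by (auto simp: extend_kernel_def indicator_def fun_eq_iff)
  finally show "case_prod (extend_kernel w) \<in> borel_measurable (borel \<Otimes>\<^sub>M borel)"
    by (simp only: borel_prod)
  show "extend_kernel w x y = extend_kernel w y x" for x y
    using assms by (auto simp: extend_kernel_def unit_kernel_def)
  show "\<bar>extend_kernel w x y\<bar> \<le> 1" for x y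
    using assms by (auto simp: extend_kernel_def unit_kernel_def abs_le_iff minus_le_iff)
qed

lemma kernel_moment_extend_kernel: "kernel_moment (extend_kernel w) p = kernel_moment w p"
  unfolding kernel_moment_def
proof (intro sum.cong refl Bochner_Integration.integral_cong prod.cong)
  fix \<pi> x e
  assume x: "x \<in> space (\<Pi>\<^sub>M B\<in>\<pi>. uniform)" and e: "e \<in> crossing_edges \<pi>"
  obtain U V where "e = (U, V)" "U \<in> \<pi>" "V \<in> \<pi>" using e crossing_edges_subset[of \<pi>] by (cases e) auto
  moreover have "x U \<in> {0..1}" if "U \<in> \<pi>" for U
    using x that by (auto simp: space_PiM PiE_def Pi_def)
  ultimately show "(case e of (U, V) \<Rightarrow> extend_kernel w (x U) (x V)) = (case e of (U, V) \<Rightarrow> w (x U) (x V))"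
    by (simp add: extend_kernel_def)
qed

lemma kernel_measure_cong:
  assumes "\<And>p. kernel_moment w p = kernel_moment w' p"
  shows "kernel_measure w = kernel_measure w'"
  unfolding kernel_measure_def assms ..

section \<open>Existence and uniqueness of the measure of a kernel\<close>

context kernel
begin

lemma kernel_moment_lessThan: "kernel_moment w p = word_moment w (\<lambda>_ _. 1) {..<p}"
proof -
  have "Suc ` {..<p} = {1..p}" by (simp add: lessThan_atLeast0 image_Suc_atLeastLessThan atLeastLessThanSuc_atLeastAtMost)
  then show ?thesis
    using word_moment_image[of "\<lambda>_ _. 1" "{..<p}" Suc] kernel_moment_atLeastAtMost[of w p]
    by (simp add: strict_mono_on_def)
qed

lemma kernel_moment_0: "kernel_moment w 0 = 1"
proof -
  interpret prob_space "\<Pi>\<^sub>M B\<in>{} :: nat set set. uniform" by (intro prob_space_PiM prob_space_uniform)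
  have "crossing_edges {} = {}" by (simp add: crossing_edges_def)
  then show ?thesis
    using prob_space by (simp add: kernel_moment_atLeastAtMost word_moment_def pairings_empty pairing_weight_def pairing_density_def)
qed

lemma kernel_moment_le: "\<bar>kernel_moment w (2 * n)\<bar> \<le> 2 ^ n * fact n"
  unfolding kernel_moment_atLeastAtMost by (rule word_moment_le) auto

text \<open>Powers of one variable are words over a one-letter alphabet, represented by lists of
  \<open>()\<close>.\<close>

lemma kernel_moment_positive:
  fixes c :: "nat \<Rightarrow> real"
  shows "0 \<le> (\<Sum>i\<le>n. \<Sum>j\<le>n. c i * c j * kernel_moment w (i + j))"
proof -
  define F where "F = (\<lambda>i. replicate i ()) ` {..n}"
  have inj: "inj_on (\<lambda>i. replicate i ()) {..n}" by (rule inj_onI) (metis length_replicate)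
  have "0 \<le> (\<Sum>u\<in>F. \<Sum>v\<in>F. c (length u) * c (length v) * letter_moment (\<lambda>_ _. 1) (rev u @ v))"
    by (intro letter_moment_positive) (auto simp: F_def)
  also have "\<dots> = (\<Sum>i\<le>n. \<Sum>j\<le>n. c i * c j * kernel_moment w (i + j))"
    unfolding F_def by (simp add: sum.reindex[OF inj] letter_moment_def kernel_moment_lessThan)
  finally show ?thesis .
qed

text \<open>Makes the definite description usable: \<open>hamburger\<close> provides a measure, and
  the bound on the number of pairings allows \<open>moment_determinacy\<close> with C = 2.\<close>

lemma kernel_measure:
  shows "real_distribution (kernel_measure w)"
    and "\<And>p. integrable (kernel_measure w) (\<lambda>x. x ^ p)"
    and "\<And>p. (\<integral>x. x ^ p \<partial>kernel_measure w) = kernel_moment w p"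
proof -
  define P where "P M \<longleftrightarrow> real_distribution M \<and>
     (\<forall>p\<ge>1. integrable M (\<lambda>x. x ^ p) \<and> (\<integral>x. x ^ p \<partial>M) = kernel_moment w p)" for M
  have P: "integrable M (\<lambda>x. x ^ p)" "(\<integral>x. x ^ p \<partial>M) = kernel_moment w p" if "P M" for M p
  proof -
    interpret real_distribution M using that by (simp add: P_def)
    \<comment> \<open>The definition speaks of p \<ge> 1 only; total mass 1 supplies p = 0.\<close>
    have "integrable M (\<lambda>x. x ^ p) \<and> (\<integral>x. x ^ p \<partial>M) = kernel_moment w p"
    proof (cases "p = 0")
      case True
      then show ?thesis using prob_space kernel_moment_0 by simp
    next
      case False
      then show ?thesis using that by (simp add: P_def)
    qed
    then show "integrable M (\<lambda>x. x ^ p)" "(\<integral>x. x ^ p \<partial>M) = kernel_moment w p" by auto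
  qed
  obtain M where M: "real_distribution M" "\<And>k. integrable M (\<lambda>x. x ^ k)"
    "\<And>k. (\<integral>x. x ^ k \<partial>M) = kernel_moment w k"
    by (rule hamburger[OF kernel_moment_0 kernel_moment_positive]) blast
  have "P M" using M by (simp add: P_def)
  moreover have "M' = M" if "P M'" for M'
  proof (rule moment_determinacy[where C = 2])
    show "real_distribution M'" using that by (simp add: P_def)
    show "(\<integral>x. x ^ (2 * n) \<partial>M') \<le> 2 ^ n * fact n" for n
      unfolding P(2)[OF that] by (rule order_trans[OF abs_ge_self kernel_moment_le])
    show "(\<integral>x. x ^ n \<partial>M') = (\<integral>x. x ^ n \<partial>M)" for n
      unfolding P(2)[OF that] M(3) ..
  qed (rule M P(1)[OF that])+
  ultimately have "P (THE M. P M)" by (rule theI)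
  moreover have "kernel_measure w = (THE M. P M)"
    by (simp only: kernel_measure_def P_def)
  ultimately have km: "P (kernel_measure w)" by simp
  then show "real_distribution (kernel_measure w)" by (simp add: P_def)
  show "integrable (kernel_measure w) (\<lambda>x. x ^ p)" for p by (rule P(1)[OF km])
  show "(\<integral>x. x ^ p \<partial>kernel_measure w) = kernel_moment w p" for p by (rule P(2)[OF km])
qed

lemma dilation_kernel_measure:
  shows "real_distribution (dilation t (kernel_measure w))"
    and "\<And>p. integrable (dilation t (kernel_measure w)) (\<lambda>x. x ^ p)"
    and "\<And>p. (\<integral>x. x ^ p \<partial>dilation t (kernel_measure w)) = t ^ p * kernel_moment w p"
proof -
  interpret real_distribution "kernel_measure w" by (rule kernel_measure)
  show "real_distribution (dilation t (kernel_measure w))"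
    unfolding dilation_def by (intro real_distribution_distr) simp
  show "integrable (dilation t (kernel_measure w)) (\<lambda>x. x ^ p)" for p
    unfolding dilation_def using kernel_measure(2)[of p]
    by (subst integrable_distr_eq) (auto simp: power_mult_distrib)
  show "(\<integral>x. x ^ p \<partial>dilation t (kernel_measure w)) = t ^ p * kernel_moment w p" for p
    unfolding dilation_def using kernel_measure(3)[of p]
    by (subst integral_distr) (auto simp: power_mult_distrib)
qed

text \<open>The criterion by which both convolutions are identified. The constant absorbs
  \<open>t ^ (2 * n)\<close> into the growth of the kernel moments.\<close>

lemma eq_dilation_kernel_measure:
  assumes "real_distribution M" "\<And>p. integrable M (\<lambda>x. x ^ p)"
    "\<And>p. (\<integral>x. x ^ p \<partial>M) = t ^ p * kernel_moment w p"
  shows "M = dilation t (kernel_measure w)"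
proof (rule moment_determinacy[where C = "2 * t\<^sup>2", OF assms(1) _ assms(2)])
  show "(\<integral>x. x ^ (2 * n) \<partial>M) \<le> (2 * t\<^sup>2) ^ n * fact n" for n
  proof -
    have "t ^ (2 * n) * kernel_moment w (2 * n) \<le> t ^ (2 * n) * (2 ^ n * fact n)"
      using kernel_moment_le[of n] by (intro mult_left_mono) (auto simp: abs_le_iff)
    also have "t ^ (2 * n) * (2 ^ n * fact n) = (2 * t\<^sup>2) ^ n * fact n"
      by (simp add: power_mult power_mult_distrib)
    finally show ?thesis by (simp only: assms(3))
  qed
  show "(\<integral>x. x ^ n \<partial>M) = (\<integral>x. x ^ n \<partial>dilation t (kernel_measure w))" for n
    unfolding assms(3) dilation_kernel_measure(3) ..
qed (rule dilation_kernel_measure)+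

end

subsection \<open>Rescaling coordinates\<close>

text \<open>If the density h followed by the map \<sigma> reproduces the uniform law in one
  coordinate, the product density and the coordinatewise map reproduce the product law; this is
  checked on boxes.\<close>

lemma product_rescale:
  fixes h :: "real \<Rightarrow> real" and F :: "('i \<Rightarrow> real) \<Rightarrow> real"
  assumes I: "finite I" and h: "h \<in> borel_measurable borel" "\<And>x. 0 \<le> h x"
    and \<sigma>: "\<sigma> \<in> uniform \<rightarrow>\<^sub>M uniform"
    and push: "\<And>A. A \<in> sets uniform \<Longrightarrow> (\<integral>\<^sup>+y. ennreal (h y) * indicator A (\<sigma> y) \<partial>uniform) = emeasure uniform A"
    and F: "F \<in> borel_measurable (\<Pi>\<^sub>M i\<in>I. uniform)"
  shows "(\<integral>x. (\<Prod>i\<in>I. h (x i)) * F (\<lambda>i\<in>I. \<sigma> (x i)) \<partial>(\<Pi>\<^sub>M i\<in>I. uniform)) = (\<integral>x. F x \<partial>(\<Pi>\<^sub>M i\<in>I. uniform))"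
proof -
  let ?P = "\<Pi>\<^sub>M i\<in>I. uniform" and ?T = "\<lambda>x. \<lambda>i\<in>I. \<sigma> (x i)"
  have hx: "(\<lambda>x. h (x i)) \<in> borel_measurable ?P" if "i \<in> I" for i
    using measurable_compose[OF measurable_uniform[OF measurable_component_singleton[OF that]] h(1)] .
  have H: "(\<lambda>x. \<Prod>i\<in>I. h (x i)) \<in> borel_measurable ?P"
    by (intro borel_measurable_prod hx)
  have T: "?T \<in> ?P \<rightarrow>\<^sub>M ?P"
    by (intro measurable_restrict) (rule measurable_compose[OF _ \<sigma>], rule measurable_component_singleton)
  let ?D = "density ?P (\<lambda>x. ennreal (\<Prod>i\<in>I. h (x i)))"
  have eq: "distr ?D ?P ?T = ?P"
  proof (rule uniform_product.PiM_eqI[OF I])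
    show "sets (distr ?D ?P ?T) = sets ?P" by simp
    fix A assume A: "\<And>i. i \<in> I \<Longrightarrow> A i \<in> sets uniform"
    have AP: "Pi\<^sub>E I A \<in> sets ?P" using A I by (intro sets_PiM_I_finite) auto
    have "emeasure (distr ?D ?P ?T) (Pi\<^sub>E I A) = emeasure ?D (?T -` Pi\<^sub>E I A \<inter> space ?P)"
      using T AP by (subst emeasure_distr) auto
    also have "\<dots> = (\<integral>\<^sup>+x. ennreal (\<Prod>i\<in>I. h (x i)) * indicator (?T -` Pi\<^sub>E I A \<inter> space ?P) x \<partial>?P)"
      using H measurable_sets[OF T AP] by (subst emeasure_density) auto
    also have "\<dots> = (\<integral>\<^sup>+x. (\<Prod>i\<in>I. ennreal (h (x i)) * indicator (A i) (\<sigma> (x i))) \<partial>?P)"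
    proof (rule nn_integral_cong)
      fix x assume x: "x \<in> space ?P"
      have "(indicator (?T -` Pi\<^sub>E I A \<inter> space ?P) x :: ennreal) = (\<Prod>i\<in>I. indicator (A i) (\<sigma> (x i)))"
      proof (cases "\<forall>i\<in>I. \<sigma> (x i) \<in> A i")
        case True
        then show ?thesis using x by (auto simp: indicator_def)
      next
        case False
        then have "(\<Prod>i\<in>I. indicator (A i) (\<sigma> (x i))) = (0 :: ennreal)"
          using I by (intro prod_zero) (force simp: indicator_def)+
        moreover have "x \<notin> ?T -` Pi\<^sub>E I A" using False by auto
        ultimately show ?thesis by simp
      qed
      then show "ennreal (\<Prod>i\<in>I. h (x i)) * indicator (?T -` Pi\<^sub>E I A \<inter> space ?P) x =
          (\<Prod>i\<in>I. ennreal (h (x i)) * indicator (A i) (\<sigma> (x i)))"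
        using h(2) by (simp add: prod.distrib prod_ennreal)
    qed
    also have "\<dots> = (\<Prod>i\<in>I. \<integral>\<^sup>+y. ennreal (h y) * indicator (A i) (\<sigma> y) \<partial>uniform)"
    proof (rule uniform_product.product_nn_integral_prod[OF I])
      fix i assume "i \<in> I"
      have "h \<in> borel_measurable uniform" by (intro measurable_restrict_space1) (use h in simp)
      moreover have "(\<lambda>y. indicator (A i) (\<sigma> y) :: ennreal) \<in> borel_measurable uniform"
        using A[OF \<open>i \<in> I\<close>] \<sigma> by (intro measurable_compose[OF \<sigma>] borel_measurable_indicator)
      ultimately show "(\<lambda>y. ennreal (h y) * indicator (A i) (\<sigma> y)) \<in> borel_measurable uniform"
        by measurable
    qed
    also have "\<dots> = (\<Prod>i\<in>I. emeasure uniform (A i))" using A by (intro prod.cong refl push)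
    finally show "emeasure (distr ?D ?P ?T) (Pi\<^sub>E I A) = (\<Prod>i\<in>I. emeasure uniform (A i))" .
  qed
  have "(\<integral>x. F x \<partial>?P) = (\<integral>x. F x \<partial>distr ?D ?P ?T)" by (simp only: eq)
  also have "\<dots> = (\<integral>x. F (?T x) \<partial>?D)" using T F by (intro integral_distr) auto
  also have "\<dots> = (\<integral>x. (\<Prod>i\<in>I. h (x i)) *\<^sub>R F (?T x) \<partial>?P)"
    using H measurable_compose[OF T F] h(2) by (intro integral_density) (auto intro!: AE_I2 prod_nonneg)
  finally show ?thesis by simp
qed

text \<open>Keeps rescaled points in [0,1], so that rescaling maps \<open>uniform\<close> measurably
  to itself; on the part being stretched it changes nothing.\<close>

definition clip :: "real \<Rightarrow> real" where
  "clip x = max 0 (min 1 x)"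

text \<open>Inside [0,1] the set J is prescribed up to two end points, which are null; this admits
  the half-lines \<open>{..<\<alpha>}\<close> and \<open>{\<alpha>..}\<close> alike.\<close>

lemma affine_push:
  fixes lo len :: real
  assumes len: "0 < len" "0 \<le> lo" "lo + len \<le> 1"
    and J: "{lo<..<lo + len} \<subseteq> J" "J \<inter> {0..1} \<subseteq> {lo..lo + len}"
    and A: "A \<in> sets uniform"
  shows "(\<integral>\<^sup>+y. ennreal (indicator J y / len) * indicator A (clip ((y - lo) / len)) \<partial>uniform) = emeasure uniform A"
proof -
  have A': "A \<subseteq> {0..1}" "A \<in> sets borel"
    using A by (auto simp: sets_restrict_space)
  have "(\<integral>\<^sup>+y. ennreal (indicator J y / len) * indicator A (clip ((y - lo) / len)) \<partial>uniform) =
     (\<integral>\<^sup>+y. ennreal (indicator J y / len) * indicator A (clip ((y - lo) / len)) * indicator {0..1} y \<partial>lborel)"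
    by (intro nn_integral_restrict_space) simp
  also have "\<dots> = (\<integral>\<^sup>+y. ennreal (1 / len) * indicator A ((y - lo) / len) \<partial>lborel)"
  proof (rule nn_integral_cong_AE)
    have "AE y in lborel. y \<noteq> lo" "AE y in lborel. y \<noteq> lo + len" by (rule AE_lborel_singleton)+
    then show "AE y in lborel. ennreal (indicator J y / len) * indicator A (clip ((y - lo) / len)) * indicator {0..1} y =
        ennreal (1 / len) * indicator A ((y - lo) / len)"
    proof eventually_elim
      fix y assume y: "y \<noteq> lo" "y \<noteq> lo + len"
      show "ennreal (indicator J y / len) * indicator A (clip ((y - lo) / len)) * indicator {0..1} y =
        ennreal (1 / len) * indicator A ((y - lo) / len)"
      proof (cases "y \<in> {lo<..<lo + len}")
        case True
        then have "clip ((y - lo) / len) = (y - lo) / len" using len by (auto simp: clip_def field_simps max_def min_def)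
        moreover have "y \<in> J" "y \<in> {0..1}" using True J len by auto
        ultimately show ?thesis by simp
      next
        case False
        then have "y \<notin> J \<inter> {0..1}" using J(2) y by auto
        moreover have "(y - lo) / len \<notin> A"
        proof
          assume "(y - lo) / len \<in> A"
          then have "0 \<le> (y - lo) / len" "(y - lo) / len \<le> 1" using A'(1) by auto
          then have "lo \<le> y" "y \<le> lo + len" using len(1) by (simp_all add: field_simps)
          with y False show False by simp
        qed
        ultimately show ?thesis by (auto simp: indicator_def)
      qed
    qed
  qed
  also have "\<dots> = ennreal (1 / len) * (\<integral>\<^sup>+y. indicator A ((y - lo) / len) \<partial>lborel)"
  proof (rule nn_integral_cmult)
    have "(\<lambda>y. (y - lo) / len) \<in> borel_measurable lborel" by simp
    then show "(\<lambda>y. indicator A ((y - lo) / len) :: ennreal) \<in> borel_measurable lborel"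
      using borel_measurable_indicator[OF A'(2)] by (rule measurable_compose)
  qed
  also have "(\<integral>\<^sup>+y. indicator A ((y - lo) / len) \<partial>lborel) = ennreal len * (\<integral>\<^sup>+x. indicator A x \<partial>lborel)"
    using A' len by (subst nn_integral_real_affine[where c = len and t = lo]) (auto simp: measurable_lborel2)
  also have "ennreal (1 / len) * (ennreal len * (\<integral>\<^sup>+x. indicator A x \<partial>lborel)) = emeasure lborel A"
    using len A' by (simp add: mult.assoc[symmetric] ennreal_mult[symmetric])
  also have "\<dots> = emeasure uniform A" using A' by (simp add: emeasure_restrict_space)
  finally show ?thesis .
qed

lemma clip_measurable:
  "(\<lambda>y. clip ((y - lo) / len)) \<in> uniform \<rightarrow>\<^sub>M uniform"
  by (intro measurable_restrict_space1 measurable_restrict_space2)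
     (auto simp: clip_def[abs_def] space_restrict_space intro!: borel_measurable_max borel_measurable_min)

text \<open>Every block confines its coordinate to J at the cost of a factor \<open>len\<close>.
  Blocks being pairs, this amounts to \<open>sqrt len\<close> for each position, which is the origin
  of the dilations.\<close>

lemma word_moment_rescale:
  fixes lo len :: real
  assumes w: "kernel w" and A: "finite A"
    and len: "0 < len" "0 \<le> lo" "lo + len \<le> 1"
    and J: "{lo<..<lo + len} \<subseteq> J" "J \<inter> {0..1} \<subseteq> {lo..lo + len}" "J \<in> sets borel"
    and v: "\<And>x y. x \<in> J \<inter> {0..1} \<Longrightarrow> y \<in> J \<inter> {0..1} \<Longrightarrow> v x y = w ((x - lo) / len) ((y - lo) / len)"
  shows "word_moment v (\<lambda>_. indicator J) A = sqrt len ^ card A * word_moment w (\<lambda>_ _. 1) A"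
proof -
  interpret kernel w by fact
  define h where "h x = indicator J x / len" for x :: real
  have "pairing_weight v (\<lambda>_. indicator J) \<pi> = sqrt len ^ card A * pairing_weight w (\<lambda>_ _. 1) \<pi>"
    if \<pi>: "\<pi> \<in> pairings A" for \<pi>
  proof -
    let ?P = "\<Pi>\<^sub>M B\<in>\<pi>. uniform"
    let ?T = "\<lambda>x. \<lambda>B\<in>\<pi>. clip ((x B - lo) / len)"
    have fin: "finite \<pi>" using \<pi> A by (rule finite_pairing)
    have c: "sqrt len ^ card A = len ^ card \<pi>"
      using card_pairing[OF \<pi> A] len by (simp add: power_mult)
    have dens: "pairing_density v (\<lambda>_. indicator J) \<pi> x =
        len ^ card \<pi> * ((\<Prod>B\<in>\<pi>. h (x B)) * pairing_density w (\<lambda>_ _. 1) \<pi> (?T x))"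
      if x: "x \<in> space ?P" for x
    proof -
      have x01: "x B \<in> {0..1}" if "B \<in> \<pi>" for B
        using x that by (auto simp: space_PiM PiE_def Pi_def)
      have ind: "(\<Prod>i\<in>B. indicator J (x B)) = (indicator J (x B) :: real)" if "B \<in> \<pi>" for B
        using pairingsD(3)[OF \<pi> that] by (simp add: indicator_def)
      have prods: "(\<Prod>B\<in>\<pi>. \<Prod>i\<in>B. indicator J (x B)) = len ^ card \<pi> * (\<Prod>B\<in>\<pi>. h (x B))"
        using ind len by (simp add: h_def prod_dividef)
      show ?thesis
      proof (cases "\<forall>B\<in>\<pi>. x B \<in> J")
        case True
        have clip: "clip ((x B - lo) / len) = (x B - lo) / len" if "B \<in> \<pi>" for B
        proof -
          have "x B \<in> {lo..lo + len}" using True x01[OF that] J(2) that by blast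
          then show ?thesis using len by (auto simp: clip_def field_simps max_def min_def)
        qed
        have "(\<Prod>(U, V)\<in>crossing_edges \<pi>. v (x U) (x V)) = (\<Prod>(U, V)\<in>crossing_edges \<pi>. w (?T x U) (?T x V))"
        proof (rule prod.cong[OF refl])
          fix e assume "e \<in> crossing_edges \<pi>"
          then obtain U V where e: "e = (U, V)" "U \<in> \<pi>" "V \<in> \<pi>" using crossing_edges_subset[of \<pi>] by (cases e) auto
          then show "(case e of (U, V) \<Rightarrow> v (x U) (x V)) = (case e of (U, V) \<Rightarrow> w (?T x U) (?T x V))"
            using True x01 by (simp add: v clip)
        qed
        then show ?thesis
          by (simp only: pairing_density_def prods prod.neutral_const mult_1_left mult.assoc)
      next
        case False
        then obtain B where "B \<in> \<pi>" "x B \<notin> J" by blast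
        then have "(\<Prod>B\<in>\<pi>. h (x B)) = 0" using fin by (intro prod_zero bexI[of _ B]) (simp_all add: h_def)
        then show ?thesis by (simp only: pairing_density_def prods mult_zero_left mult_zero_right)
      qed
    qed
    have "pairing_weight v (\<lambda>_. indicator J) \<pi> =
        (\<integral>x. len ^ card \<pi> * ((\<Prod>B\<in>\<pi>. h (x B)) * pairing_density w (\<lambda>_ _. 1) \<pi> (?T x)) \<partial>?P)"
      unfolding pairing_weight_def by (rule Bochner_Integration.integral_cong[OF refl dens])
    also have "\<dots> = len ^ card \<pi> * (\<integral>x. (\<Prod>B\<in>\<pi>. h (x B)) * pairing_density w (\<lambda>_ _. 1) \<pi> (?T x) \<partial>?P)"
      by simp
    also have "(\<integral>x. (\<Prod>B\<in>\<pi>. h (x B)) * pairing_density w (\<lambda>_ _. 1) \<pi> (?T x) \<partial>?P) = pairing_weight w (\<lambda>_ _. 1) \<pi>"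
      unfolding pairing_weight_def
    proof (rule product_rescale[OF fin _ _ clip_measurable])
      show "h \<in> borel_measurable borel" unfolding h_def[abs_def] using J(3) by measurable
      show "(\<integral>\<^sup>+y. ennreal (h y) * indicator A (clip ((y - lo) / len)) \<partial>uniform) = emeasure uniform A"
        if "A \<in> sets uniform" for A
        unfolding h_def by (rule affine_push[OF len J(1,2) that])
      show "0 \<le> h x" for x using len by (simp add: h_def)
      show "pairing_density w (\<lambda>_ _. 1) \<pi> \<in> borel_measurable ?P"
        by (intro pairing_density_measurable) auto
    qed
    finally show ?thesis by (simp only: c)
  qed
  then show ?thesis by (simp add: word_moment_def sum_distrib_left)
qed

subsection \<open>Gluing kernels\<close>

definition glue :: "real \<Rightarrow> real \<Rightarrow> (real \<Rightarrow> real \<Rightarrow> real) \<Rightarrow> (real \<Rightarrow> real \<Rightarrow> real) \<Rightarrow> real \<Rightarrow> real \<Rightarrow> real" where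
  "glue \<alpha> \<kappa> w0 w1 x y =
     (if x < \<alpha> \<and> y < \<alpha> then w0 (x / \<alpha>) (y / \<alpha>)
      else if \<alpha> \<le> x \<and> \<alpha> \<le> y then w1 ((x - \<alpha>) / (1 - \<alpha>)) ((y - \<alpha>) / (1 - \<alpha>)) else \<kappa>)"

text \<open>Half-lines rather than subintervals, so that the two sides add up to 1 at every real
  number.\<close>

definition side :: "real \<Rightarrow> bool \<Rightarrow> real \<Rightarrow> real" where
  "side \<alpha> b = indicator (if b then {\<alpha>..} else {..<\<alpha>})"

lemma side_measurable: "side \<alpha> b \<in> borel_measurable borel"
  by (simp add: side_def)

lemma abs_side_le: "\<bar>side \<alpha> b x\<bar> \<le> 1"
  by (simp add: side_def indicator_def)

lemma kernel_glue:
  assumes "kernel w0" "kernel w1" "\<bar>\<kappa>\<bar> \<le> 1"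
  shows "kernel (glue \<alpha> \<kappa> w0 w1)"
proof -
  interpret w0: kernel w0 by fact
  interpret w1: kernel w1 by fact
  show ?thesis
  proof
    note [measurable] = w0.measurable_w w1.measurable_w
    show "case_prod (glue \<alpha> \<kappa> w0 w1) \<in> borel_measurable (borel \<Otimes>\<^sub>M borel)"
      unfolding glue_def[abs_def] case_prod_beta' by measurable
    show "glue \<alpha> \<kappa> w0 w1 x y = glue \<alpha> \<kappa> w0 w1 y x" for x y
      using w0.sym w1.sym by (auto simp: glue_def)
    show "\<bar>glue \<alpha> \<kappa> w0 w1 x y\<bar> \<le> 1" for x y
      using w0.bound w1.bound assms(3) by (auto simp: glue_def)
  qed
qed

lemma word_moment_glue_False:
  assumes "kernel w0" "finite A" "0 < \<alpha>" "\<alpha> < 1"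
  shows "word_moment (glue \<alpha> \<kappa> w0 w1) (\<lambda>_. side \<alpha> False) A = sqrt \<alpha> ^ card A * word_moment w0 (\<lambda>_ _. 1) A"
proof -
  have "side \<alpha> False = indicator {..<\<alpha>}" by (simp add: side_def)
  then show ?thesis
    using word_moment_rescale[OF assms(1,2), of \<alpha> 0 "{..<\<alpha>}" "glue \<alpha> \<kappa> w0 w1"] assms(3,4)
    by (force simp: glue_def)
qed

lemma word_moment_glue_True:
  assumes "kernel w1" "finite A" "0 < \<alpha>" "\<alpha> < 1"
  shows "word_moment (glue \<alpha> \<kappa> w0 w1) (\<lambda>_. side \<alpha> True) A = sqrt (1 - \<alpha>) ^ card A * word_moment w1 (\<lambda>_ _. 1) A"
proof -
  have "side \<alpha> True = indicator {\<alpha>..}" by (simp add: side_def)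
  then show ?thesis
    using word_moment_rescale[OF assms(1,2), of "1 - \<alpha>" \<alpha> "{\<alpha>..}" "glue \<alpha> \<kappa> w0 w1"] assms(3,4)
    by (force simp: glue_def)
qed

section \<open>Free products\<close>

subsection \<open>Functionals on the free algebra\<close>

definition functional :: "(bool list \<Rightarrow> real) \<Rightarrow> free_algebra \<Rightarrow> complex" where
  "functional \<psi> P = (\<Sum>u\<in>Poly_Mapping.keys P. Poly_Mapping.lookup P u * of_real (\<psi> (letters u)))"

lemma functional_superset:
  assumes "finite K" "Poly_Mapping.keys P \<subseteq> K"
  shows "functional \<psi> P = (\<Sum>u\<in>K. Poly_Mapping.lookup P u * of_real (\<psi> (letters u)))"
  unfolding functional_def using assms by (intro sum.mono_neutral_left) (auto simp: in_keys_iff)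

lemma functional_add: "functional \<psi> (P + Q) = functional \<psi> P + functional \<psi> Q"
proof -
  define K where "K = Poly_Mapping.keys P \<union> Poly_Mapping.keys Q"
  have "finite K" "Poly_Mapping.keys P \<subseteq> K" "Poly_Mapping.keys Q \<subseteq> K" "Poly_Mapping.keys (P + Q) \<subseteq> K"
    using keys_add[of P Q] by (auto simp: K_def)
  then show ?thesis
    by (simp add: functional_superset[of K] lookup_add algebra_simps sum.distrib)
qed

lemma functional_zero [simp]: "functional \<psi> 0 = 0"
  by (simp add: functional_def)

lemma functional_sum: "functional \<psi> (\<Sum>x\<in>X. P x) = (\<Sum>x\<in>X. functional \<psi> (P x))"
  by (induction X rule: infinite_finite_induct) (auto simp: functional_add)

lemma functional_single: "functional \<psi> (Poly_Mapping.single u c) = c * of_real (\<psi> (letters u))"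
  by (simp add: functional_def)

lemma free_algebra_expand:
  "P = (\<Sum>u\<in>Poly_Mapping.keys P. Poly_Mapping.single u (Poly_Mapping.lookup P u))" for P :: free_algebra
proof (rule poly_mapping_eqI)
  fix k
  have "(\<Sum>u\<in>Poly_Mapping.keys P. Poly_Mapping.lookup P u when u = k) = Poly_Mapping.lookup P k"
    by (simp add: when_def in_keys_iff)
  then show "Poly_Mapping.lookup P k =
      Poly_Mapping.lookup (\<Sum>u\<in>Poly_Mapping.keys P. Poly_Mapping.single u (Poly_Mapping.lookup P u)) k"
    by (simp add: lookup_sum lookup_single)
qed

lemma scalar_mult_single: "scalar c * Poly_Mapping.single u d = Poly_Mapping.single u (c * d)"
  by (simp add: scalar_def mult_single)

lemma functional_scalar: "functional \<psi> (scalar c * P) = c * functional \<psi> P"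
proof -
  have "scalar c * P = (\<Sum>u\<in>Poly_Mapping.keys P. Poly_Mapping.single u (c * Poly_Mapping.lookup P u))"
    by (subst free_algebra_expand[of P]) (simp add: sum_distrib_left scalar_mult_single)
  then have "functional \<psi> (scalar c * P) =
      (\<Sum>u\<in>Poly_Mapping.keys P. c * Poly_Mapping.lookup P u * of_real (\<psi> (letters u)))"
    by (simp only: functional_sum functional_single)
  then show ?thesis by (simp only: functional_def[of \<psi> P] sum_distrib_left mult.assoc)
qed

lemma single_Letters_mult:
  "Poly_Mapping.single (Letters u) c * Poly_Mapping.single (Letters v) d = Poly_Mapping.single (Letters (u @ v)) (c * d)"
  by (simp add: mult_single plus_free_monoid_def)

lemma functional_adjoint_mult:
  "functional \<psi> (adjoint P * P) = (\<Sum>u\<in>Poly_Mapping.keys P. \<Sum>v\<in>Poly_Mapping.keys P.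
     cnj (Poly_Mapping.lookup P u) * Poly_Mapping.lookup P v * of_real (\<psi> (rev (letters u) @ letters v)))"
proof -
  have "adjoint P * P = (\<Sum>u\<in>Poly_Mapping.keys P. Poly_Mapping.single (Letters (rev (letters u))) (cnj (Poly_Mapping.lookup P u))) *
      (\<Sum>v\<in>Poly_Mapping.keys P. Poly_Mapping.single v (Poly_Mapping.lookup P v))"
    unfolding adjoint_def using free_algebra_expand[of P] by simp
  also have "\<dots> = (\<Sum>u\<in>Poly_Mapping.keys P. \<Sum>v\<in>Poly_Mapping.keys P.
      Poly_Mapping.single (Letters (rev (letters u) @ letters v)) (cnj (Poly_Mapping.lookup P u) * Poly_Mapping.lookup P v))"
    unfolding sum_product
  proof (intro sum.cong refl)
    fix u v
    show "Poly_Mapping.single (Letters (rev (letters u))) (cnj (Poly_Mapping.lookup P u)) * Poly_Mapping.single v (Poly_Mapping.lookup P v)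
      = Poly_Mapping.single (Letters (rev (letters u) @ letters v)) (cnj (Poly_Mapping.lookup P u) * Poly_Mapping.lookup P v)"
      using single_Letters_mult[of "rev (letters u)" _ "letters v"] by simp
  qed
  finally show ?thesis by (simp add: functional_sum functional_single)
qed

text \<open>Positivity is given for real coefficients. Complex ones are split into real and
  imaginary parts: the cross terms cancel by the symmetry in \<open>commute\<close>, and two real
  quadratic forms remain.\<close>

lemma state_functional:
  assumes one: "\<psi> [] = 1"
    and commute: "\<And>u v. \<psi> (rev u @ v) = \<psi> (rev v @ u)"
    and pos: "\<And>F (c :: bool list \<Rightarrow> real). finite F \<Longrightarrow> 0 \<le> (\<Sum>u\<in>F. \<Sum>v\<in>F. c u * c v * \<psi> (rev u @ v))"
  shows "state (functional \<psi>)"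
  unfolding state_def
proof (intro conjI allI)
  show "functional \<psi> 1 = 1"
  proof -
    have "functional \<psi> 1 = functional \<psi> (Poly_Mapping.single 0 1)" by simp
    also have "\<dots> = 1" by (simp only: functional_single) (simp add: one zero_free_monoid_def)
    finally show ?thesis .
  qed
  fix P :: free_algebra
  define K where "K = Poly_Mapping.keys P"
  define a where "a u = Re (Poly_Mapping.lookup P u)" for u
  define b where "b u = Im (Poly_Mapping.lookup P u)" for u
  define k where "k u v = \<psi> (rev (letters u) @ letters v)" for u v
  have psd: "0 \<le> (\<Sum>u\<in>K. \<Sum>v\<in>K. c u * c v * k u v)" for c :: "free_monoid \<Rightarrow> real"
  proof -
    have inj: "inj_on letters K" by (rule inj_onI) (metis free_monoid.collapse)
    have "0 \<le> (\<Sum>u\<in>letters ` K. \<Sum>v\<in>letters ` K. c (Letters u) * c (Letters v) * \<psi> (rev u @ v))"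
      by (rule pos) (simp add: K_def)
    then show ?thesis by (simp add: sum.reindex[OF inj] k_def)
  qed
  have "functional \<psi> (adjoint P * P) = (\<Sum>u\<in>K. \<Sum>v\<in>K.
      of_real (a u * a v * k u v + b u * b v * k u v) + \<i> * of_real (a u * b v * k u v - b u * a v * k u v))"
    unfolding functional_adjoint_mult K_def[symmetric]
    by (intro sum.cong refl) (simp add: complex_eq_iff a_def b_def k_def algebra_simps)
  also have "\<dots> = of_real ((\<Sum>u\<in>K. \<Sum>v\<in>K. a u * a v * k u v) + (\<Sum>u\<in>K. \<Sum>v\<in>K. b u * b v * k u v)) +
      \<i> * of_real ((\<Sum>u\<in>K. \<Sum>v\<in>K. a u * b v * k u v) - (\<Sum>u\<in>K. \<Sum>v\<in>K. b u * a v * k u v))"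
    by (simp add: sum.distrib sum_subtractf sum_distrib_left algebra_simps)
  also have "(\<Sum>u\<in>K. \<Sum>v\<in>K. b u * a v * k u v) = (\<Sum>u\<in>K. \<Sum>v\<in>K. a u * b v * k u v)"
    by (subst sum.swap) (simp add: k_def commute[of "letters _" "letters _"] mult_ac)
  finally have "functional \<psi> (adjoint P * P) =
      of_real ((\<Sum>u\<in>K. \<Sum>v\<in>K. a u * a v * k u v) + (\<Sum>u\<in>K. \<Sum>v\<in>K. b u * b v * k u v))" by simp
  then show "functional \<psi> (adjoint P * P) \<in> \<real>\<^sub>\<ge>\<^sub>0"
    using psd by (simp only: nonneg_Reals_of_real_iff) (intro add_nonneg_nonneg psd)
qed (simp_all add: functional_add functional_scalar)

lemma generator_power: "generator b ^ n = Poly_Mapping.single (Letters (replicate n b)) 1"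
proof (induction n)
  case 0
  show ?case by (simp add: zero_free_monoid_def[symmetric])
next
  case (Suc n)
  then show ?case by (simp add: generator_def single_Letters_mult)
qed

lemma functional_generator_power: "functional \<psi> (generator b ^ n) = of_real (\<psi> (replicate n b))"
  by (simp add: generator_power functional_single)

definition words :: "nat \<Rightarrow> bool list set" where
  "words n = {u. length u = n}"

lemma words_Suc: "words (Suc n) = (\<lambda>(b, u). b # u) ` (UNIV \<times> words n)"
  by (auto simp: words_def image_iff length_Suc_conv)

lemma generator_sum_power:
  "(generator False + generator True) ^ n = (\<Sum>u\<in>words n. prod_list (map generator u))"
proof (induction n)
  case 0
  show ?case by (simp add: words_def)
next
  case (Suc n)
  have inj: "inj_on (\<lambda>(b, u). b # u) (UNIV \<times> words n)" by (auto simp: inj_on_def)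
  have "(\<Sum>u\<in>words (Suc n). prod_list (map generator u)) =
      (\<Sum>x\<in>UNIV \<times> words n. prod_list (map generator (fst x # snd x)))"
    unfolding words_Suc by (subst sum.reindex[OF inj]) (simp add: case_prod_beta)
  also have "\<dots> = (\<Sum>b\<in>UNIV. \<Sum>u\<in>words n. generator b * prod_list (map generator u))"
    by (simp add: sum.cartesian_product case_prod_beta)
  also have "\<dots> = (generator False + generator True) * (\<Sum>u\<in>words n. prod_list (map generator u))"
    by (simp add: UNIV_bool sum_distrib_left[symmetric] distrib_right add.commute)
  finally show ?case by (simp add: Suc)
qed

lemma prod_list_generators: "prod_list (map generator u) = Poly_Mapping.single (Letters u) 1"
proof (induction u)
  case Nil
  show ?case by (simp add: zero_free_monoid_def[symmetric])
next
  case (Cons b u)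
  then show ?case by (simp add: generator_def single_Letters_mult)
qed

lemma functional_generator_sum_power:
  "functional \<psi> ((generator False + generator True) ^ n) = of_real (\<Sum>u\<in>words n. \<psi> u)"
  by (simp add: generator_sum_power functional_sum prod_list_generators functional_single)

subsection \<open>Uniqueness of free products\<close>

lemma scalar_add: "scalar (c + d) = scalar c + scalar d"
  by (simp add: scalar_def single_add)

lemma scalar_mult: "scalar (c * d) = scalar c * scalar d"
  by (simp add: scalar_def mult_single)

lemma scalar_0 [simp]: "scalar 0 = 0" and scalar_1 [simp]: "scalar 1 = 1"
  by (simp_all add: scalar_def)

lemma scalar_commute: "P * scalar c = scalar c * P"
proof -
  have "Poly_Mapping.single u d * scalar c = scalar c * Poly_Mapping.single u d" for u d
    by (simp add: scalar_def mult_single mult.commute)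
  then show ?thesis
    by (subst (1 2) free_algebra_expand[of P]) (simp add: sum_distrib_left sum_distrib_right)
qed

lemma subalgebra_gen_polynomial: "(\<Sum>i\<le>n. scalar (c i) * a ^ i) \<in> subalgebra_gen a"
  by (auto simp: subalgebra_gen_def)

lemma subalgebra_genI: "scalar c * a ^ n \<in> subalgebra_gen a"
proof -
  have "scalar c * a ^ n = (\<Sum>i\<le>n. scalar (if i = n then c else 0) * a ^ i)"
    by (simp add: if_distrib[of scalar] if_distrib[of "\<lambda>x. x * _"] cong: if_cong)
  then show ?thesis using subalgebra_gen_polynomial[of "\<lambda>i. if i = n then c else 0" a n] by simp
qed

lemma subalgebra_gen_add:
  assumes "x \<in> subalgebra_gen a" "y \<in> subalgebra_gen a"
  shows "x + y \<in> subalgebra_gen a"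
proof -
  obtain n c where x: "x = (\<Sum>i\<le>n. scalar (c i) * a ^ i)" using assms(1) unfolding subalgebra_gen_def by blast
  obtain m d where y: "y = (\<Sum>i\<le>m. scalar (d i) * a ^ i)" using assms(2) unfolding subalgebra_gen_def by blast
  define c' where "c' i = (if i \<le> n then c i else 0)" for i
  define d' where "d' i = (if i \<le> m then d i else 0)" for i
  have "x = (\<Sum>i\<le>max n m. scalar (c' i) * a ^ i)"
    unfolding x by (intro sum.mono_neutral_cong_left) (auto simp: c'_def)
  moreover have "y = (\<Sum>i\<le>max n m. scalar (d' i) * a ^ i)"
    unfolding y by (intro sum.mono_neutral_cong_left) (auto simp: d'_def)
  ultimately have "x + y = (\<Sum>i\<le>max n m. scalar (c' i + d' i) * a ^ i)"
    by (simp add: scalar_add distrib_right sum.distrib)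
  then show ?thesis using subalgebra_gen_polynomial[of "\<lambda>i. c' i + d' i" a "max n m"] by simp
qed

lemma subalgebra_gen_sum:
  assumes "\<And>x. x \<in> X \<Longrightarrow> f x \<in> subalgebra_gen a"
  shows "(\<Sum>x\<in>X. f x) \<in> subalgebra_gen a"
  using assms
proof (induction X rule: infinite_finite_induct)
  case (insert x X)
  then show ?case by (simp add: subalgebra_gen_add)
qed (use subalgebra_genI[of 0 a 0] in auto)

lemma subalgebra_gen_mult:
  assumes "x \<in> subalgebra_gen a" "y \<in> subalgebra_gen a"
  shows "x * y \<in> subalgebra_gen a"
proof -
  obtain n c where x: "x = (\<Sum>i\<le>n. scalar (c i) * a ^ i)" using assms(1) unfolding subalgebra_gen_def by blast
  obtain m d where y: "y = (\<Sum>i\<le>m. scalar (d i) * a ^ i)" using assms(2) unfolding subalgebra_gen_def by blast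
  have "x * y = (\<Sum>i\<le>n. \<Sum>j\<le>m. scalar (c i * d j) * a ^ (i + j))"
    unfolding x y sum_product
  proof (intro sum.cong refl)
    fix i j
    have "scalar (c i) * a ^ i * (scalar (d j) * a ^ j) = scalar (c i) * (a ^ i * scalar (d j)) * a ^ j"
      by (simp add: mult.assoc)
    then show "scalar (c i) * a ^ i * (scalar (d j) * a ^ j) = scalar (c i * d j) * a ^ (i + j)"
      by (simp only: scalar_commute[of "a ^ i"] scalar_mult power_add mult.assoc)
  qed
  then show ?thesis by (auto intro!: subalgebra_gen_sum subalgebra_genI)
qed

locale linear_unital =
  fixes \<phi> :: "free_algebra \<Rightarrow> complex"
  assumes add: "\<phi> (P + Q) = \<phi> P + \<phi> Q"
    and scalar: "\<phi> (scalar c * P) = c * \<phi> P"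
    and one: "\<phi> 1 = 1"
begin

lemma zero: "\<phi> 0 = 0"
  using scalar[of 0 0] by simp

lemma sum: "\<phi> (\<Sum>x\<in>X. f x) = (\<Sum>x\<in>X. \<phi> (f x))"
  by (induction X rule: infinite_finite_induct) (auto simp: add zero)

lemma centre: "\<phi> (P + scalar (- \<phi> P)) = 0"
  using scalar[of "- \<phi> P" 1] by (simp add: add one)

lemma split_centred:
  "\<phi> (L * a * R) = \<phi> (L * (a + scalar (- \<phi> a)) * R) + \<phi> a * \<phi> (L * R)"
proof -
  have "a = (a + scalar (- \<phi> a)) + scalar (\<phi> a)"
    using scalar_add[of "- \<phi> a" "\<phi> a"] by (simp add: add.assoc)
  then have "L * a * R = L * (a + scalar (- \<phi> a)) * R + L * scalar (\<phi> a) * R"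
    by (metis distrib_left distrib_right)
  also have "L * scalar (\<phi> a) * R = scalar (\<phi> a) * (L * R)"
    by (simp only: scalar_commute[of L] mult.assoc)
  finally show ?thesis by (simp add: add scalar)
qed

end

lemma state_linear_unital: "state \<phi> \<Longrightarrow> linear_unital \<phi>"
  by (simp add: state_def linear_unital_def)

text \<open>Adjacent factors of one algebra are merged; a noncentred factor is replaced by its
  centred version plus a scalar, and the scalar leaves a shorter word; an alternating word of
  centred factors vanishes under both functionals.\<close>

lemma free_product_unique:
  fixes A :: "'i \<Rightarrow> free_algebra set"
  assumes \<phi>: "linear_unital \<phi>" "freely_independent \<phi> A"
    and \<phi>': "linear_unital \<phi>'" "freely_independent \<phi>' A"
    and mult: "\<And>i x y. x \<in> A i \<Longrightarrow> y \<in> A i \<Longrightarrow> x * y \<in> A i"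
    and centre: "\<And>i x c. x \<in> A i \<Longrightarrow> x + scalar c \<in> A i"
    and eq: "\<And>i x. x \<in> A i \<Longrightarrow> \<phi> x = \<phi>' x"
    and xs: "\<forall>(i, a)\<in>set xs. a \<in> A i"
  shows "\<phi> (prod_list (map snd xs)) = \<phi>' (prod_list (map snd xs))"
  using xs
\<comment> \<open>Length counts double because merging shortens the word by 1 but may create one
  noncentred factor; centring lowers the second summand.\<close>
proof (induction "2 * length xs + length (filter (\<lambda>x. \<phi> (snd x) \<noteq> 0) xs)" arbitrary: xs rule: less_induct)
  case less
  interpret \<phi>: linear_unital \<phi> by fact
  interpret \<phi>': linear_unital \<phi>' by fact
  consider (adj) "\<not> distinct_adj (map fst xs)" | (noncentred) x where "x \<in> set xs" "\<phi> (snd x) \<noteq> 0"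
    | (empty) "xs = []" | (free) "xs \<noteq> []" "distinct_adj (map fst xs)" "\<forall>x\<in>set xs. \<phi> (snd x) = 0"
    by blast
  then show ?case
  proof cases
    case adj
    then obtain ys i a b zs where xs: "xs = ys @ (i, a) # (i, b) # zs"
    proof -
      have "\<exists>ys i a b zs. xs = ys @ (i, a) # (i, b) # zs" if "\<not> distinct_adj (map fst xs)" for xs :: "('i \<times> free_algebra) list"
        using that
      proof (induction xs)
        case (Cons x xs)
        show ?case
        proof (cases "distinct_adj (map fst xs)")
          case True
          with Cons.prems obtain y ys where "xs = y # ys" "fst x = fst y"
            by (cases xs) auto
          then have "x # xs = [] @ (fst x, snd x) # (fst x, snd y) # ys" by (simp add: prod_eq_iff)
          then show ?thesis by blast
        next
          case False
          then obtain ys i a b zs where "xs = ys @ (i, a) # (i, b) # zs" using Cons.IH by blast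
          then have "x # xs = (x # ys) @ (i, a) # (i, b) # zs" by simp
          then show ?thesis by blast
        qed
      qed simp
      with adj that show ?thesis by blast
    qed
    define us where "us = ys @ (i, a * b) # zs"
    have "\<phi> (prod_list (map snd us)) = \<phi>' (prod_list (map snd us))"
    proof (rule less.hyps)
      show "2 * length us + length (filter (\<lambda>x. \<phi> (snd x) \<noteq> 0) us)
          < 2 * length xs + length (filter (\<lambda>x. \<phi> (snd x) \<noteq> 0) xs)"
        by (simp add: us_def xs)
      show "\<forall>(i, a)\<in>set us. a \<in> A i" using less.prems mult by (auto simp: us_def xs)
    qed
    then show ?thesis by (simp add: us_def xs mult.assoc)
  next
    case noncentred
    then obtain ys zs where xs: "xs = ys @ x # zs" by (meson split_list)
    obtain i a where x: "x = (i, a)" by (cases x)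
    have a: "a \<in> A i" "\<phi> a \<noteq> 0" "\<phi>' a = \<phi> a" using less.prems noncentred eq by (auto simp: xs x)
    define us where "us = ys @ (i, a + scalar (- \<phi> a)) # zs"
    define vs where "vs = ys @ zs"
    have us: "\<phi> (prod_list (map snd us)) = \<phi>' (prod_list (map snd us))"
    proof (rule less.hyps)
      show "2 * length us + length (filter (\<lambda>x. \<phi> (snd x) \<noteq> 0) us)
          < 2 * length xs + length (filter (\<lambda>x. \<phi> (snd x) \<noteq> 0) xs)"
        using a by (simp add: us_def xs x \<phi>.centre)
      show "\<forall>(i, a)\<in>set us. a \<in> A i" using less.prems a centre by (auto simp: us_def xs x)
    qed
    have vs: "\<phi> (prod_list (map snd vs)) = \<phi>' (prod_list (map snd vs))"
    proof (rule less.hyps)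
      show "2 * length vs + length (filter (\<lambda>x. \<phi> (snd x) \<noteq> 0) vs)
          < 2 * length xs + length (filter (\<lambda>x. \<phi> (snd x) \<noteq> 0) xs)"
        by (simp add: vs_def xs)
      show "\<forall>(i, a)\<in>set vs. a \<in> A i" using less.prems by (auto simp: vs_def xs)
    qed
    let ?L = "prod_list (map snd ys)" and ?R = "prod_list (map snd zs)"
    have "\<phi> (prod_list (map snd xs)) = \<phi> (?L * (a + scalar (- \<phi> a)) * ?R) + \<phi> a * \<phi> (?L * ?R)"
      using \<phi>.split_centred[of ?L a ?R] by (simp add: xs x mult.assoc)
    also have "\<dots> = \<phi>' (?L * (a + scalar (- \<phi> a)) * ?R) + \<phi> a * \<phi>' (?L * ?R)"
      using us vs by (simp add: us_def vs_def mult.assoc)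
    also have "\<dots> = \<phi>' (prod_list (map snd xs))"
      using \<phi>'.split_centred[of ?L a ?R] by (simp add: xs x a mult.assoc)
    finally show ?thesis .
  next
    case empty
    then show ?thesis by (simp add: \<phi>.one \<phi>'.one)
  next
    case free
    have 1: "\<forall>(i, a)\<in>set xs. a \<in> A i \<and> \<phi> a = 0" using less.prems free(3) by auto
    have 2: "\<forall>(i, a)\<in>set xs. a \<in> A i \<and> \<phi>' a = 0"
    proof (rule ballI)
      fix x assume "x \<in> set xs"
      then have "snd x \<in> A (fst x)" "\<phi> (snd x) = 0" using 1 by (auto simp: case_prod_beta)
      then show "case x of (i, a) \<Rightarrow> a \<in> A i \<and> \<phi>' a = 0" using eq by (simp add: case_prod_beta)
    qed
    have "\<phi> (prod_list (map snd xs)) = 0"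
      using \<phi>(2)[unfolded freely_independent_def, rule_format, OF free(1,2)] 1 by blast
    moreover have "\<phi>' (prod_list (map snd xs)) = 0"
      using \<phi>'(2)[unfolded freely_independent_def, rule_format, OF free(1,2)] 2 by blast
    ultimately show ?thesis by simp
  qed
qed

lemma free_sum_moments_unique:
  assumes \<phi>: "linear_unital \<phi>" "freely_independent \<phi> (\<lambda>b. subalgebra_gen (generator b))"
    and \<phi>': "linear_unital \<phi>'" "freely_independent \<phi>' (\<lambda>b. subalgebra_gen (generator b))"
    and eq: "\<And>b n. \<phi> (generator b ^ n) = \<phi>' (generator b ^ n)"
  shows "\<phi> ((generator False + generator True) ^ n) = \<phi>' ((generator False + generator True) ^ n)"
proof -
  interpret \<phi>: linear_unital \<phi> by fact
  interpret \<phi>': linear_unital \<phi>' by fact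
  have "\<phi> (prod_list (map generator u)) = \<phi>' (prod_list (map generator u))" for u
  proof -
    have "\<phi> (prod_list (map snd (map (\<lambda>b. (b, generator b)) u))) =
        \<phi>' (prod_list (map snd (map (\<lambda>b. (b, generator b)) u)))"
    proof (rule free_product_unique[OF \<phi> \<phi>'])
      fix b x c assume "x \<in> subalgebra_gen (generator b)"
      then show "x + scalar c \<in> subalgebra_gen (generator b)"
        using subalgebra_genI[of c "generator b" 0] by (simp add: subalgebra_gen_add)
    next
      fix b x assume "x \<in> subalgebra_gen (generator b)"
      then show "\<phi> x = \<phi>' x"
        by (auto simp: subalgebra_gen_def \<phi>.sum \<phi>'.sum \<phi>.scalar \<phi>'.scalar eq)
    next
      show "\<forall>(b, a)\<in>set (map (\<lambda>b. (b, generator b)) u). a \<in> subalgebra_gen (generator b)"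
        using subalgebra_genI[of 1 _ 1] by auto
    qed (rule subalgebra_gen_mult)
    then show ?thesis by (simp add: comp_def)
  qed
  then show ?thesis by (simp add: generator_sum_power \<phi>.sum \<phi>'.sum)
qed

subsection \<open>Isolated intervals\<close>

text \<open>
  Positions are written as \<open>j * D + l\<close> with \<open>l < D\<close>; the position lies in the interval with
  number \<open>j\<close>, which has \<open>m j\<close> elements.
\<close>

definition positions :: "nat \<Rightarrow> nat \<Rightarrow> (nat \<Rightarrow> nat) \<Rightarrow> nat set" where
  "positions D k m = {t. t div D < k \<and> t mod D < m (t div D)}"

text \<open>An interval without positions is isolated too; it stands for the constant term of a
  factor.\<close>

definition isolated :: "nat \<Rightarrow> nat \<Rightarrow> nat set set \<Rightarrow> bool" where
  "isolated D j \<pi> \<longleftrightarrow> (\<forall>U\<in>\<pi>. \<forall>p\<in>U. \<forall>q\<in>U. p div D = j \<longrightarrow> q div D = j)"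

text \<open>
  Among the blocks joining two intervals take one for which the intervals are closest. The interval
  following the left one has a different colour, so its blocks stay inside the gap.
\<close>

lemma exists_isolated:
  assumes \<pi>: "\<pi> \<in> pairings A" and k: "k > 0" and A: "\<And>t. t \<in> A \<Longrightarrow> t div D < k"
    and col: "\<And>U t. U \<in> \<pi> \<Longrightarrow> t \<in> U \<Longrightarrow> b (t div D) = (col U :: bool)"
    and cross: "\<And>U V. U \<in> \<pi> \<Longrightarrow> V \<in> \<pi> \<Longrightarrow> blocks_cross U V \<Longrightarrow> col U = col V"
    and alt: "\<And>j. Suc j < k \<Longrightarrow> b j \<noteq> b (Suc j)"
  shows "\<exists>j<k. isolated D j \<pi>"
proof (rule ccontr)
  assume "\<not> (\<exists>j<k. isolated D j \<pi>)"
  then have step: "\<exists>U\<in>\<pi>. \<exists>p\<in>U. \<exists>q\<in>U. p div D = j \<and> q div D \<noteq> j" if "j < k" for j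
    using that unfolding isolated_def by blast
  define conn where "conn e \<longleftrightarrow> fst e < snd e \<and> (\<exists>U\<in>\<pi>. \<exists>p\<in>U. \<exists>q\<in>U. p div D = fst e \<and> q div D = snd e)" for e
  \<comment> \<open>Interval 0 is not isolated, so some block leads from it to the right and there
    are connections to minimise over.\<close>
  obtain U p q where "U \<in> \<pi>" "p \<in> U" "q \<in> U" "p div D = 0" "q div D \<noteq> 0" using step[OF k] by blast
  then have "conn (0, q div D)" unfolding conn_def by auto
  from ex_has_least_nat[of conn, OF this, of "\<lambda>e. snd e - fst e"]
  obtain e where e: "conn e" "\<And>e'. conn e' \<Longrightarrow> snd e - fst e \<le> snd e' - fst e'" by blast
  obtain i j where ij: "e = (i, j)" by (cases e)
  have "i < j" using e(1) by (simp add: conn_def ij)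
  obtain U p q where U: "U \<in> \<pi>" "p \<in> U" "q \<in> U" "p div D = i" "q div D = j"
    using e(1) unfolding conn_def ij by auto
  have "j < k" using A[of q] U pairingsD(6)[OF \<pi> U(1)] by auto
  have bU: "b i = col U" "b j = col U" using col[OF U(1,2)] col[OF U(1,3)] U by auto
  \<comment> \<open>Neighbouring intervals differ in colour, so no block joins them, and interval
    \<open>Suc i\<close> lies strictly inside the gap.\<close>
  have "Suc i \<noteq> j" using alt[of i] bU \<open>j < k\<close> by auto
  then have si: "Suc i < j" using \<open>i < j\<close> by simp
  obtain V p' q' where V: "V \<in> \<pi>" "p' \<in> V" "q' \<in> V" "p' div D = Suc i" "q' div D \<noteq> Suc i"
    using step[of "Suc i"] si \<open>j < k\<close> by auto
  have bV: "b (Suc i) = col V" "b (q' div D) = col V" using col[OF V(1,2)] col[OF V(1,3)] V by auto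
  have neq: "col U \<noteq> col V" using alt[of i] bU bV si \<open>j < k\<close> by auto
  then have nc: "\<not> blocks_cross U V" "\<not> blocks_cross V U"
    using cross U(1) V(1) by auto
  have pp: "p < p'"
  proof (rule ccontr)
    assume "\<not> p < p'"
    then have "p' div D \<le> p div D" by (intro div_le_mono) simp
    then show False using U V by simp
  qed
  have pq: "p' < q"
  proof (rule ccontr)
    assume "\<not> p' < q"
    then have "q div D \<le> p' div D" by (intro div_le_mono) simp
    then show False using U V si by simp
  qed
  have "\<not> q' < p"
  proof
    assume "q' < p"
    then have "blocks_cross V U" unfolding blocks_cross_def using pp pq U V
      by (intro exI[of _ q'] exI[of _ p] exI[of _ p'] exI[of _ q]) auto
    with nc show False by simp
  qed
  moreover have "\<not> q < q'"
  proof
    assume "q < q'"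
    then have "blocks_cross U V" unfolding blocks_cross_def using pp pq U V
      by (intro exI[of _ p] exI[of _ p'] exI[of _ q] exI[of _ q']) auto
    with nc show False by simp
  qed
  ultimately have "p \<le> q'" "q' \<le> q" by auto
  then have "i \<le> q' div D" "q' div D \<le> j"
    using U div_le_mono[of p q' D] div_le_mono[of q' q D] by auto
  moreover have "q' div D \<noteq> i" "q' div D \<noteq> j" using bU bV neq by auto
  ultimately have l: "Suc i < q' div D" "q' div D < j" using V(5) by auto
  have "conn (Suc i, q' div D)" unfolding conn_def using V l by auto
  from e(2)[OF this] show False using l unfolding ij by simp
qed

section \<open>Words as sequences of intervals\<close>

lemma positions_subset:
  assumes "\<And>j. j < k \<Longrightarrow> m j < D"
  shows "positions D k m \<subseteq> {..<k * D}"
proof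
  fix t assume t: "t \<in> positions D k m"
  then have "t div D < k" by (simp add: positions_def)
  moreover from this have "0 < D" using assms by fastforce
  ultimately show "t \<in> {..<k * D}" by (simp add: div_less_iff_less_mult)
qed

lemma positions_interval:
  assumes "j < k" "m j < D"
  shows "{t\<in>positions D k m. t div D = j} = (\<lambda>l. j * D + l) ` {..<m j}"
proof (intro equalityI subsetI)
  fix t assume "t \<in> {t\<in>positions D k m. t div D = j}"
  then have "t div D = j" "t mod D < m j" by (auto simp: positions_def)
  then show "t \<in> (\<lambda>l. j * D + l) ` {..<m j}"
    using div_mult_mod_eq[of t D] by (intro image_eqI[of _ _ "t mod D"]) auto
next
  fix t assume "t \<in> (\<lambda>l. j * D + l) ` {..<m j}"
  then obtain l where l: "t = j * D + l" "l < m j" by auto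
  then have "t div D = j" "t mod D = l" using assms by auto
  then show "t \<in> {t\<in>positions D k m. t div D = j}" using assms l by (simp add: positions_def)
qed

lemma positions_Suc:
  "positions D (Suc k) m = positions D k m \<union> {t\<in>positions D (Suc k) m. t div D = k}"
  by (auto simp: positions_def less_Suc_eq)

fun position_list :: "nat \<Rightarrow> (nat \<Rightarrow> nat) \<Rightarrow> nat \<Rightarrow> nat list" where
  "position_list D m 0 = []"
| "position_list D m (Suc k) = position_list D m k @ map (\<lambda>l. k * D + l) [0..<m k]"

fun interval_word :: "(nat \<Rightarrow> 'l) \<Rightarrow> (nat \<Rightarrow> nat) \<Rightarrow> nat \<Rightarrow> 'l list" where
  "interval_word b m 0 = []"
| "interval_word b m (Suc k) = interval_word b m k @ replicate (m k) (b k)"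

lemma position_list:
  assumes "\<And>j. j < k \<Longrightarrow> m j < D"
  shows "set (position_list D m k) = positions D k m \<and> sorted_wrt (<) (position_list D m k) \<and>
    map (\<lambda>t. b (t div D)) (position_list D m k) = interval_word b m k"
  using assms
proof (induction k)
  case 0
  then show ?case by (simp add: positions_def)
next
  case (Suc k)
  then have IH: "set (position_list D m k) = positions D k m" "sorted_wrt (<) (position_list D m k)"
    "map (\<lambda>t. b (t div D)) (position_list D m k) = interval_word b m k" by auto
  have mk: "m k < D" using Suc.prems by simp
  have "\<forall>t\<in>positions D k m. \<forall>l\<in>{k * D..<m k + k * D}. t < l"
    using positions_subset[of k m D] Suc.prems by (force simp: less_Suc_eq)
  moreover have "set (position_list D m (Suc k)) = positions D (Suc k) m"
    using positions_interval[of k "Suc k" m D] mk positions_Suc[of D k m]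
    by (simp add: IH(1) lessThan_atLeast0)
  moreover have "map (\<lambda>t. b (t div D)) (map (\<lambda>l. k * D + l) [0..<m k]) = replicate (m k) (b k)"
    using mk by (intro nth_equalityI) auto
  ultimately show ?case
    using IH by (simp add: sorted_wrt_append sorted_wrt_map)
qed

text \<open>Moments depend on the order of the positions only, so the letters of a word may be
  spread out over intervals starting at multiples of D.\<close>

lemma (in kernel) letter_moment_interval_word:
  assumes g: "\<And>l. g l \<in> borel_measurable borel" and m: "\<And>j. j < k \<Longrightarrow> m j < D"
  shows "letter_moment g (interval_word b m k) = word_moment w (\<lambda>t. g (b (t div D))) (positions D k m)"
proof -
  define ps where "ps = position_list D m k"
  have ps: "set ps = positions D k m" "sorted_wrt (<) ps" "map (\<lambda>t. b (t div D)) ps = interval_word b m k"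
    using position_list[OF m, where b = b] by (simp_all add: ps_def)
  then have len: "length (interval_word b m k) = length ps" by (metis length_map)
  have "word_moment w (\<lambda>t. g (b (t div D))) (positions D k m) = word_moment w (\<lambda>t. g (b (t div D))) ((!) ps ` {..<length ps})"
    using ps(1) nth_image[of "length ps" ps] by (simp add: lessThan_atLeast0)
  also have "\<dots> = word_moment w (\<lambda>l. g (b (ps ! l div D))) {..<length ps}"
  proof (rule word_moment_image)
    show "strict_mono_on {..<length ps} ((!) ps)"
      using ps(2) by (auto intro!: strict_mono_onI sorted_wrt_nth_less)
  qed (rule g)
  also have "\<dots> = letter_moment g (interval_word b m k)"
    unfolding letter_moment_def len by (rule word_moment_cong) (simp add: ps(3)[symmetric])
  finally show ?thesis ..
qed

lemma sum_PiE_split: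
  assumes "j \<in> I" "finite I"
  shows "(\<Sum>m\<in>Pi\<^sub>E I D. F m) = (\<Sum>m\<in>Pi\<^sub>E (I - {j}) D. \<Sum>x\<in>D j. F (m(j := x)))"
proof -
  have inj: "inj_on (\<lambda>(y, g). g(j := y)) (D j \<times> Pi\<^sub>E (I - {j}) D)" by (rule inj_combinator) simp
  have "Pi\<^sub>E I D = Pi\<^sub>E (insert j (I - {j})) D" using assms by (simp add: insert_absorb)
  also have "\<dots> = (\<lambda>(y, g). g(j := y)) ` (D j \<times> Pi\<^sub>E (I - {j}) D)" by (rule PiE_insert_eq)
  finally have eq: "Pi\<^sub>E I D = (\<lambda>(y, g). g(j := y)) ` (D j \<times> Pi\<^sub>E (I - {j}) D)" .
  have "(\<Sum>m\<in>Pi\<^sub>E I D. F m) = (\<Sum>x\<in>D j \<times> Pi\<^sub>E (I - {j}) D. F ((snd x)(j := fst x)))"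
    unfolding eq sum.reindex[OF inj] by (simp add: case_prod_beta)
  also have "\<dots> = (\<Sum>x\<in>D j. \<Sum>m\<in>Pi\<^sub>E (I - {j}) D. F (m(j := x)))"
    by (simp add: sum.cartesian_product case_prod_beta)
  also have "\<dots> = (\<Sum>m\<in>Pi\<^sub>E (I - {j}) D. \<Sum>x\<in>D j. F (m(j := x)))" by (rule sum.swap)
  finally show ?thesis .
qed

subsection \<open>Free independence\<close>

locale free_glue =
  fixes \<alpha> :: real and w0 w1 :: "real \<Rightarrow> real \<Rightarrow> real"
  assumes w0: "kernel w0" and w1: "kernel w1"
begin

definition W where "W = glue \<alpha> 0 w0 w1"

sublocale K: kernel W
  unfolding W_def by (rule kernel_glue[OF w0 w1]) simp

context
  fixes D k :: nat and b :: "nat \<Rightarrow> bool"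
begin

definition letter_side :: "nat \<Rightarrow> real \<Rightarrow> real" where
  "letter_side t = side \<alpha> (b (t div D))"

lemma letter_side_measurable: "letter_side t \<in> borel_measurable borel" and abs_letter_side_le: "\<bar>letter_side t x\<bar> \<le> 1"
  by (simp_all add: letter_side_def side_measurable abs_side_le)

text \<open>At a point x of nonzero density, each block has the colour of the side containing its
  coordinate, shared by all its positions, and the value 0 across the sides excludes crossings of
  different colours. These are the hypotheses of \<open>exists_isolated\<close>.\<close>

lemma nonzero_isolated:
  assumes k: "k > 0" and alt: "\<And>j. Suc j < k \<Longrightarrow> b j \<noteq> b (Suc j)"
    and \<pi>: "\<pi> \<in> pairings (positions D k m)" and fin: "finite (positions D k m)"
    and nz: "pairing_weight W letter_side \<pi> \<noteq> 0"
  shows "\<exists>j<k. isolated D j \<pi>"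
proof -
  have "\<exists>x. pairing_density W letter_side \<pi> x \<noteq> 0"
  proof (rule ccontr)
    assume "\<not> (\<exists>x. pairing_density W letter_side \<pi> x \<noteq> 0)"
    then show False using nz by (simp add: pairing_weight_def)
  qed
  then obtain x where "pairing_density W letter_side \<pi> x \<noteq> 0" by blast
  then have x: "(\<Prod>B\<in>\<pi>. \<Prod>i\<in>B. letter_side i (x B)) \<noteq> 0" "(\<Prod>(U, V)\<in>crossing_edges \<pi>. W (x U) (x V)) \<noteq> 0"
    by (auto simp only: pairing_density_def mult_eq_0_iff)
  have fp: "finite \<pi>" by (rule finite_pairing[OF \<pi> fin])
  show ?thesis
  proof (rule exists_isolated[OF \<pi> k, where col = "\<lambda>U. \<alpha> \<le> x U" and b = b])
    show "t div D < k" if "t \<in> positions D k m" for t using that by (simp add: positions_def)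
    show "b (t div D) = (\<alpha> \<le> x U)" if U: "U \<in> \<pi>" "t \<in> U" for U t
    proof -
      have "(\<Prod>i\<in>U. letter_side i (x U)) \<noteq> 0" using x(1) U(1) prod_zero[OF fp] by metis
      then have "letter_side t (x U) \<noteq> 0" using U(2) prod_zero[OF pairingsD(4)[OF \<pi> U(1)]] by metis
      then show ?thesis by (cases "b (t div D)") (auto simp: letter_side_def side_def indicator_def split: if_splits)
    qed
    have same: "(\<alpha> \<le> x U) = (\<alpha> \<le> x V)" if "(U, V) \<in> crossing_edges \<pi>" for U V
    proof -
      have "W (x U) (x V) \<noteq> 0"
      proof
        assume "W (x U) (x V) = 0"
        then have "(\<Prod>(U, V)\<in>crossing_edges \<pi>. W (x U) (x V)) = 0"
          using that finite_crossing_edges[OF fp] by (intro prod_zero bexI[of _ "(U, V)"]) auto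
        with x(2) show False by simp
      qed
      then show ?thesis by (auto simp: W_def glue_def split: if_splits)
    qed
    show "(\<alpha> \<le> x U) = (\<alpha> \<le> x V)" if UV: "U \<in> \<pi>" "V \<in> \<pi>" "blocks_cross U V" for U V
    proof -
      consider "Min U < Min V" | "Min V < Min U" | "Min U = Min V" by linarith
      then show ?thesis
      proof cases
        case 1
        then show ?thesis using UV by (intro same) (simp add: crossing_edges_def)
      next
        case 2
        then have "(V, U) \<in> crossing_edges \<pi>" using UV by (simp add: crossing_edges_def blocks_cross_commute)
        from same[OF this] show ?thesis by simp
      next
        case 3
        have "Min U \<in> U" "Min V \<in> V" using pairingsD(4,5)[OF \<pi>] UV by (auto intro!: Min_in)
        then have "U = V" using 3 pairingsD(2)[OF \<pi> UV(1,2)] by auto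
        then show ?thesis by simp
      qed
    qed
  qed (rule alt)
qed

definition interval :: "nat \<Rightarrow> (nat \<Rightarrow> nat) \<Rightarrow> nat set" where
  "interval j m = {t\<in>positions D k m. t div D = j}"

definition rest :: "nat \<Rightarrow> (nat \<Rightarrow> nat) \<Rightarrow> nat set" where
  "rest j m = {t\<in>positions D k m. t div D \<noteq> j}"

text \<open>The cofactor that remains when j is the first isolated interval, so only intervals
  before j are constrained.\<close>

definition rest_sum :: "nat \<Rightarrow> (nat \<Rightarrow> nat) \<Rightarrow> real" where
  "rest_sum j m = (\<Sum>\<sigma>\<in>{\<sigma>\<in>pairings (rest j m). \<forall>i<j. \<not> isolated D i \<sigma>}. pairing_weight W letter_side \<sigma>)"

definition first_isolated :: "nat \<Rightarrow> (nat \<Rightarrow> nat) \<Rightarrow> nat set set set" where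
  "first_isolated j m = {\<pi>\<in>pairings (positions D k m). isolated D j \<pi> \<and> (\<forall>i<j. \<not> isolated D i \<pi>)}"

text \<open>The fixed spacing D keeps the other intervals in place when the size of interval j
  changes. This independence allows the sum over \<open>m j\<close> to be carried out
  separately.\<close>

lemma rest_sum_upd: "rest_sum j (m(j := x)) = rest_sum j m"
proof -
  have "rest j (m(j := x)) = rest j m" by (auto simp: rest_def positions_def)
  then show ?thesis by (simp add: rest_sum_def)
qed

text \<open>Assigning each contributing pairing to its least isolated interval makes the
  decomposition disjoint.\<close>

lemma word_moment_first_isolated:
  assumes k: "k > 0" and alt: "\<And>j. Suc j < k \<Longrightarrow> b j \<noteq> b (Suc j)"
    and fin: "finite (positions D k m)"
  shows "word_moment W letter_side (positions D k m) = (\<Sum>j<k. \<Sum>\<pi>\<in>first_isolated j m. pairing_weight W letter_side \<pi>)"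
proof -
  have fp: "finite (pairings (positions D k m))" by (rule finite_pairings[OF fin])
  have "word_moment W letter_side (positions D k m) = (\<Sum>\<pi>\<in>(\<Union>j\<in>{..<k}. first_isolated j m). pairing_weight W letter_side \<pi>)"
    unfolding word_moment_def
  proof (rule sum.mono_neutral_right[OF fp])
    show "(\<Union>j\<in>{..<k}. first_isolated j m) \<subseteq> pairings (positions D k m)"
      by (auto simp: first_isolated_def)
    show "\<forall>\<pi>\<in>pairings (positions D k m) - (\<Union>j\<in>{..<k}. first_isolated j m). pairing_weight W letter_side \<pi> = 0"
    proof (rule ballI, rule ccontr)
      fix \<pi> assume \<pi>: "\<pi> \<in> pairings (positions D k m) - (\<Union>j\<in>{..<k}. first_isolated j m)"
        and nz: "pairing_weight W letter_side \<pi> \<noteq> 0"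
      obtain j where j: "j < k" "isolated D j \<pi>" using nonzero_isolated[OF k alt _ fin nz] \<pi> by blast
      define i where "i = (LEAST i. isolated D i \<pi>)"
      have "isolated D i \<pi>" "i \<le> j" "\<forall>l<i. \<not> isolated D l \<pi>"
        using j(2) not_less_Least unfolding i_def by (auto intro: LeastI Least_le)
      then have "\<pi> \<in> first_isolated i m" "i < k" using \<pi> j by (auto simp: first_isolated_def)
      with \<pi> show False by blast
    qed
  qed
  also have "\<dots> = (\<Sum>j<k. \<Sum>\<pi>\<in>first_isolated j m. pairing_weight W letter_side \<pi>)"
  proof (rule sum.UNION_disjoint)
    show "\<forall>j\<in>{..<k}. finite (first_isolated j m)"
      using fp by (auto simp: first_isolated_def)
    show "\<forall>i\<in>{..<k}. \<forall>j\<in>{..<k}. i \<noteq> j \<longrightarrow> first_isolated i m \<inter> first_isolated j m = {}"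
    proof (intro ballI impI)
      fix i j :: nat assume "i \<noteq> j"
      then show "first_isolated i m \<inter> first_isolated j m = {}"
        by (cases "i < j") (auto simp: first_isolated_def)
    qed
  qed simp
  finally show ?thesis .
qed

text \<open>Blocks inside interval j do not influence whether an earlier interval is isolated, so
  being first is a condition on the remaining blocks alone, and the sum factorises.\<close>

lemma first_isolated_eq:
  "first_isolated j m = (\<lambda>(\<rho>, \<sigma>). \<rho> \<union> \<sigma>) `
    (pairings (interval j m) \<times> {\<sigma>\<in>pairings (rest j m). \<forall>i<j. \<not> isolated D i \<sigma>})"
proof -
  have disj: "interval j m \<inter> rest j m = {}" and un: "interval j m \<union> rest j m = positions D k m"
    by (auto simp: interval_def rest_def)
  have iso: "isolated D j \<pi> \<longleftrightarrow> (\<forall>U\<in>\<pi>. U \<subseteq> interval j m \<or> U \<subseteq> rest j m)"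
    if \<pi>: "\<pi> \<in> pairings (positions D k m)" for \<pi>
  proof -
    have "(\<forall>p\<in>U. \<forall>q\<in>U. p div D = j \<longrightarrow> q div D = j) \<longleftrightarrow> (U \<subseteq> interval j m \<or> U \<subseteq> rest j m)" if "U \<in> \<pi>" for U
      using pairingsD(6)[OF \<pi> that] unfolding interval_def rest_def by blast
    then show ?thesis unfolding isolated_def by blast
  qed
  have iso': "isolated D i (\<rho> \<union> \<sigma>) \<longleftrightarrow> isolated D i \<sigma>" if "\<rho> \<in> pairings (interval j m)" "i < j" for \<rho> \<sigma> i
  proof -
    have "p div D = j" if "U \<in> \<rho>" "p \<in> U" for U p
      using pairingsD(6)[OF \<open>\<rho> \<in> pairings (interval j m)\<close> that(1)] that(2) by (auto simp: interval_def)
    then have "isolated D i \<rho>" using \<open>i < j\<close> unfolding isolated_def by blast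
    then show ?thesis unfolding isolated_def by blast
  qed
  have img: "(\<lambda>(\<rho>, \<sigma>). \<rho> \<union> \<sigma>) ` (pairings (interval j m) \<times> pairings (rest j m)) =
      {\<pi>\<in>pairings (positions D k m). isolated D j \<pi>}"
    unfolding pairings_Un_iff[OF disj] un using iso by blast
  show ?thesis
  proof (intro equalityI subsetI)
    fix \<pi> assume \<pi>: "\<pi> \<in> first_isolated j m"
    then have "\<pi> \<in> (\<lambda>(\<rho>, \<sigma>). \<rho> \<union> \<sigma>) ` (pairings (interval j m) \<times> pairings (rest j m))"
      unfolding img by (simp add: first_isolated_def)
    then obtain \<rho> \<sigma> where *: "\<pi> = \<rho> \<union> \<sigma>" "\<rho> \<in> pairings (interval j m)" "\<sigma> \<in> pairings (rest j m)" by auto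
    moreover have "\<forall>i<j. \<not> isolated D i \<sigma>"
      using \<pi> iso'[OF *(2)] unfolding first_isolated_def *(1) by auto
    ultimately show "\<pi> \<in> (\<lambda>(\<rho>, \<sigma>). \<rho> \<union> \<sigma>) ` (pairings (interval j m) \<times> {\<sigma>\<in>pairings (rest j m). \<forall>i<j. \<not> isolated D i \<sigma>})"
      by (intro image_eqI[of _ _ "(\<rho>, \<sigma>)"]) auto
  next
    fix \<pi> assume "\<pi> \<in> (\<lambda>(\<rho>, \<sigma>). \<rho> \<union> \<sigma>) ` (pairings (interval j m) \<times> {\<sigma>\<in>pairings (rest j m). \<forall>i<j. \<not> isolated D i \<sigma>})"
    then obtain \<rho> \<sigma> where *: "\<pi> = \<rho> \<union> \<sigma>" "\<rho> \<in> pairings (interval j m)" "\<sigma> \<in> pairings (rest j m)" "\<forall>i<j. \<not> isolated D i \<sigma>" by auto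
    then have "\<pi> \<in> (\<lambda>(\<rho>, \<sigma>). \<rho> \<union> \<sigma>) ` (pairings (interval j m) \<times> pairings (rest j m))"
      by (intro image_eqI[of _ _ "(\<rho>, \<sigma>)"]) auto
    then show "\<pi> \<in> first_isolated j m"
      unfolding img using iso'[OF *(2)] *(1,4) by (auto simp: first_isolated_def)
  qed
qed

text \<open>A number between two positions of interval j has quotient j as well, so it cannot belong
  to the rest.\<close>

lemma interval_no_cross:
  assumes U: "U \<subseteq> interval j m" and V: "V \<subseteq> rest j m"
  shows "\<not> blocks_cross U V"
proof
  have mid: "t div D = j" if "p < t" "t < q" "p div D = j" "q div D = j" for p t q
  proof -
    show ?thesis
      using div_le_mono[OF less_imp_le[OF that(1)], of D] div_le_mono[OF less_imp_le[OF that(2)], of D] that(3,4)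
      by simp
  qed
  assume "blocks_cross U V"
  then obtain p t q s where "p < t" "t < q" "q < s" "{p, q} \<subseteq> U \<and> {t, s} \<subseteq> V \<or> {p, q} \<subseteq> V \<and> {t, s} \<subseteq> U"
    unfolding blocks_cross_def by blast
  then show False using U V mid[of p t q] mid[of t q s] by (auto simp: interval_def rest_def)
qed

lemma first_isolated_sum:
  assumes fin: "finite (positions D k m)"
  shows "(\<Sum>\<pi>\<in>first_isolated j m. pairing_weight W letter_side \<pi>) = word_moment W letter_side (interval j m) * rest_sum j m"
proof -
  have disj: "interval j m \<inter> rest j m = {}" by (auto simp: interval_def rest_def)
  have fin': "finite (interval j m)" "finite (rest j m)" using fin by (auto simp: interval_def rest_def)
  let ?R = "{\<sigma>\<in>pairings (rest j m). \<forall>i<j. \<not> isolated D i \<sigma>}"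
  have inj: "inj_on (\<lambda>(\<rho>, \<sigma>). \<rho> \<union> \<sigma>) (pairings (interval j m) \<times> ?R)"
    by (rule inj_on_subset[OF pairings_Un_inj[OF disj]]) auto
  have "(\<Sum>\<pi>\<in>first_isolated j m. pairing_weight W letter_side \<pi>) =
      (\<Sum>x\<in>pairings (interval j m) \<times> ?R. pairing_weight W letter_side (fst x \<union> snd x))"
    unfolding first_isolated_eq sum.reindex[OF inj] by (simp add: case_prod_beta)
  also have "\<dots> = (\<Sum>x\<in>pairings (interval j m) \<times> ?R. pairing_weight W letter_side (fst x) * pairing_weight W letter_side (snd x))"
  proof (rule sum.cong[OF refl])
    fix x assume "x \<in> pairings (interval j m) \<times> ?R"
    then have x: "fst x \<in> pairings (interval j m)" "snd x \<in> pairings (rest j m)" by auto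
    show "pairing_weight W letter_side (fst x \<union> snd x) = pairing_weight W letter_side (fst x) * pairing_weight W letter_side (snd x)"
    proof (rule K.pairing_weight_Un[OF letter_side_measurable abs_letter_side_le x disj fin'])
      fix U V and y :: "nat set \<Rightarrow> real"
      assume "U \<in> fst x" "V \<in> snd x" "blocks_cross U V"
      then have False using interval_no_cross[OF pairingsD(6)[OF x(1)] pairingsD(6)[OF x(2)]] by blast
      then show "W (y U) (y V) = 1" ..
    qed
  qed
  also have "\<dots> = (\<Sum>\<rho>\<in>pairings (interval j m). \<Sum>\<sigma>\<in>?R. pairing_weight W letter_side \<rho> * pairing_weight W letter_side \<sigma>)"
    by (simp add: sum.cartesian_product case_prod_beta)
  finally show ?thesis by (simp only: word_moment_def rest_sum_def sum_product)
qed

lemma word_moment_interval: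
  assumes "j < k" "m j < D"
  shows "word_moment W letter_side (interval j m) = word_moment W (\<lambda>_. side \<alpha> (b j)) {..<m j}"
proof -
  have "word_moment W letter_side (interval j m) = word_moment W (\<lambda>l. letter_side (j * D + l)) {..<m j}"
    unfolding interval_def positions_interval[where m = m, OF assms]
    by (intro K.word_moment_image letter_side_measurable) (simp add: strict_mono_on_def)
  also have "\<dots> = word_moment W (\<lambda>_. side \<alpha> (b j)) {..<m j}"
    using assms by (intro K.word_moment_cong) (simp add: letter_side_def)
  finally show ?thesis .
qed

text \<open>With the first isolated interval j and the other sizes fixed, the sum over
  \<open>m j\<close> is the expression that \<open>centred\<close> declares to be 0.\<close>

lemma alternating_centred_sum:
  fixes C :: "nat \<Rightarrow> nat \<Rightarrow> complex"
  assumes k: "k > 0" and alt: "\<And>j. Suc j < k \<Longrightarrow> b j \<noteq> b (Suc j)"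
    and centred: "\<And>j. j < k \<Longrightarrow> (\<Sum>x<D. C j x * of_real (word_moment W (\<lambda>_. side \<alpha> (b j)) {..<x})) = 0"
  shows "(\<Sum>m\<in>{..<k} \<rightarrow>\<^sub>E {..<D}. (\<Prod>j<k. C j (m j)) * of_real (word_moment W letter_side (positions D k m))) = 0"
proof -
  let ?A = "{..<k} \<rightarrow>\<^sub>E {..<D}"
  have mD: "m j < D" if "m \<in> ?A" "j < k" for m j using that by auto
  have fin: "finite (positions D k m)" if "m \<in> ?A" for m
    using positions_subset[of k m D] mD[OF that] finite_subset by blast
  have "(\<Sum>m\<in>?A. (\<Prod>j<k. C j (m j)) * of_real (word_moment W letter_side (positions D k m))) =
    (\<Sum>m\<in>?A. \<Sum>j<k. (\<Prod>i<k. C i (m i)) * (of_real (word_moment W (\<lambda>_. side \<alpha> (b j)) {..<m j}) * of_real (rest_sum j m)))"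
  proof (rule sum.cong[OF refl])
    fix m assume m: "m \<in> ?A"
    have "word_moment W letter_side (positions D k m) = (\<Sum>j<k. word_moment W (\<lambda>_. side \<alpha> (b j)) {..<m j} * rest_sum j m)"
    proof -
      have "word_moment W letter_side (positions D k m) = (\<Sum>j<k. \<Sum>\<pi>\<in>first_isolated j m. pairing_weight W letter_side \<pi>)"
        by (rule word_moment_first_isolated[OF k alt fin[OF m]])
      also have "\<dots> = (\<Sum>j<k. word_moment W (\<lambda>_. side \<alpha> (b j)) {..<m j} * rest_sum j m)"
        using mD[OF m] by (intro sum.cong refl) (simp add: first_isolated_sum[OF fin[OF m]] word_moment_interval)
      finally show ?thesis .
    qed
    then show "(\<Prod>j<k. C j (m j)) * of_real (word_moment W letter_side (positions D k m)) =
      (\<Sum>j<k. (\<Prod>i<k. C i (m i)) * (of_real (word_moment W (\<lambda>_. side \<alpha> (b j)) {..<m j}) * of_real (rest_sum j m)))"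
      by (simp add: sum_distrib_left)
  qed
  also have "\<dots> = (\<Sum>j<k. \<Sum>m\<in>?A. (\<Prod>i<k. C i (m i)) * (of_real (word_moment W (\<lambda>_. side \<alpha> (b j)) {..<m j}) * of_real (rest_sum j m)))"
    by (rule sum.swap)
  also have "\<dots> = (\<Sum>j<k. 0)"
  proof (rule sum.cong[OF refl])
    fix j assume "j \<in> {..<k}"
    then have j: "j < k" by simp
    have "(\<Sum>m\<in>?A. (\<Prod>i<k. C i (m i)) * (of_real (word_moment W (\<lambda>_. side \<alpha> (b j)) {..<m j}) * of_real (rest_sum j m))) =
      (\<Sum>m\<in>({..<k} - {j}) \<rightarrow>\<^sub>E {..<D}. \<Sum>x<D. (\<Prod>i<k. C i ((m(j := x)) i)) *
        (of_real (word_moment W (\<lambda>_. side \<alpha> (b j)) {..<(m(j := x)) j}) * of_real (rest_sum j (m(j := x)))))"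
      using j by (intro sum_PiE_split) auto
    also have "\<dots> = (\<Sum>m\<in>({..<k} - {j}) \<rightarrow>\<^sub>E {..<D}. (\<Prod>i\<in>{..<k} - {j}. C i (m i)) * of_real (rest_sum j m) *
        (\<Sum>x<D. C j x * of_real (word_moment W (\<lambda>_. side \<alpha> (b j)) {..<x})))"
    proof (rule sum.cong[OF refl])
      fix m
      have "(\<Prod>i<k. C i ((m(j := x)) i)) = C j x * (\<Prod>i\<in>{..<k} - {j}. C i (m i))" for x
      proof -
        have "(\<Prod>i<k. C i ((m(j := x)) i)) = C j ((m(j := x)) j) * (\<Prod>i\<in>{..<k} - {j}. C i ((m(j := x)) i))"
          using j by (intro prod.remove) auto
        also have "(\<Prod>i\<in>{..<k} - {j}. C i ((m(j := x)) i)) = (\<Prod>i\<in>{..<k} - {j}. C i (m i))"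
          by (intro prod.cong) auto
        finally show ?thesis by simp
      qed
      then show "(\<Sum>x<D. (\<Prod>i<k. C i ((m(j := x)) i)) *
        (of_real (word_moment W (\<lambda>_. side \<alpha> (b j)) {..<(m(j := x)) j}) * of_real (rest_sum j (m(j := x))))) =
        (\<Prod>i\<in>{..<k} - {j}. C i (m i)) * of_real (rest_sum j m) *
        (\<Sum>x<D. C j x * of_real (word_moment W (\<lambda>_. side \<alpha> (b j)) {..<x}))"
        by (simp add: rest_sum_upd sum_distrib_left mult_ac)
    qed
    also have "\<dots> = 0" by (simp add: centred[OF j])
    finally show "(\<Sum>m\<in>?A. (\<Prod>i<k. C i (m i)) * (of_real (word_moment W (\<lambda>_. side \<alpha> (b j)) {..<m j}) * of_real (rest_sum j m))) = 0" .
  qed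
  finally show ?thesis by simp
qed

end

end

section \<open>Alternating products and the state of the glued kernel\<close>

lemma length_interval_word: "length (interval_word b m k) = (\<Sum>j<k. m j)"
  by (induction k) auto

lemma prod_list_interval_words:
  fixes c :: "nat \<Rightarrow> nat \<Rightarrow> complex"
  shows "prod_list (map (\<lambda>j. \<Sum>x<D. Poly_Mapping.single (Letters (replicate x (b j))) (c j x)) [0..<k]) =
    (\<Sum>m\<in>{..<k} \<rightarrow>\<^sub>E {..<D}. Poly_Mapping.single (Letters (interval_word b m k)) (\<Prod>j<k. c j (m j)))"
proof (induction k)
  case 0
  then show ?case by (simp add: zero_free_monoid_def[symmetric])
next
  case (Suc k)
  let ?A = "{..<k} \<rightarrow>\<^sub>E {..<D}"
  have word: "interval_word b (m(k := x)) k = interval_word b m k" for m :: "nat \<Rightarrow> nat" and x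
  proof -
    have "interval_word b (m(k := x)) j = interval_word b m j" if "j \<le> k" for j
      using that by (induction j) auto
    then show ?thesis by simp
  qed
  have "(\<Sum>m\<in>{..<Suc k} \<rightarrow>\<^sub>E {..<D}. Poly_Mapping.single (Letters (interval_word b m (Suc k))) (\<Prod>j<Suc k. c j (m j))) =
    (\<Sum>m\<in>({..<Suc k} - {k}) \<rightarrow>\<^sub>E {..<D}. \<Sum>x<D.
      Poly_Mapping.single (Letters (interval_word b (m(k := x)) (Suc k))) (\<Prod>j<Suc k. c j ((m(k := x)) j)))"
    by (rule sum_PiE_split) auto
  also have "{..<Suc k} - {k} = {..<k}" by auto
  also have "(\<Sum>m\<in>?A. \<Sum>x<D. Poly_Mapping.single (Letters (interval_word b (m(k := x)) (Suc k))) (\<Prod>j<Suc k. c j ((m(k := x)) j))) =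
    (\<Sum>m\<in>?A. \<Sum>x<D. Poly_Mapping.single (Letters (interval_word b m k)) (\<Prod>j<k. c j (m j)) *
      Poly_Mapping.single (Letters (replicate x (b k))) (c k x))"
    by (intro sum.cong refl) (simp add: word single_Letters_mult)
  also have "\<dots> = (\<Sum>m\<in>?A. Poly_Mapping.single (Letters (interval_word b m k)) (\<Prod>j<k. c j (m j))) *
      (\<Sum>x<D. Poly_Mapping.single (Letters (replicate x (b k))) (c k x))"
    by (simp only: sum_product)
  also have "\<dots> = prod_list (map (\<lambda>j. \<Sum>x<D. Poly_Mapping.single (Letters (replicate x (b j))) (c j x)) [0..<Suc k])"
    by (simp add: Suc)
  finally show ?case ..
qed

text \<open>One coefficient function, padded by zeros, serves all large D, so finitely many
  polynomials can be given a common D.\<close>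

lemma subalgebra_gen_generator:
  assumes "P \<in> subalgebra_gen (generator b)"
  obtains n :: nat and c where "\<And>D. n < D \<Longrightarrow>
    P = (\<Sum>x<D. Poly_Mapping.single (Letters (replicate x b)) (c x))"
proof -
  obtain n c where P: "P = (\<Sum>i\<le>n. scalar (c i) * generator b ^ i)"
    using assms unfolding subalgebra_gen_def by blast
  define c' where "c' i = (if i \<le> n then c i else 0)" for i
  have "P = (\<Sum>x<D. Poly_Mapping.single (Letters (replicate x b)) (c' x))" if "n < D" for D
    unfolding P generator_power scalar_mult_single
    using that by (intro sum.mono_neutral_cong_left) (auto simp: c'_def)
  with that show ?thesis by blast
qed

context free_glue
begin

text \<open>Joint moments of the two coloured parts of the glued model, each multiplied by
  r.\<close>

definition word_state :: "real \<Rightarrow> bool list \<Rightarrow> real" where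
  "word_state r u = r ^ length u * K.letter_moment (side \<alpha>) u"

lemma word_state_replicate:
  "word_state r (replicate x b) = r ^ x * word_moment W (\<lambda>_. side \<alpha> b) {..<x}"
  unfolding word_state_def K.letter_moment_def
  using K.word_moment_cong[of "{..<x}" "\<lambda>k. side \<alpha> (replicate x b ! k)" "\<lambda>_. side \<alpha> b"] by simp

text \<open>Expanding each factor into monomials turns an alternating product into a sum over
  interval sizes, the form treated by \<open>alternating_centred_sum\<close>.\<close>

lemma freely_independent_word_state:
  "freely_independent (functional (word_state r)) (\<lambda>b. subalgebra_gen (generator b))"
  unfolding freely_independent_def
proof (intro allI impI)
  fix xs :: "(bool \<times> free_algebra) list"
  assume "xs \<noteq> []" and adj: "distinct_adj (map fst xs)"
    and xs: "\<forall>(b, P)\<in>set xs. P \<in> subalgebra_gen (generator b) \<and> functional (word_state r) P = 0"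
  define k where "k = length xs"
  define b where "b j = fst (xs ! j)" for j
  have k: "k > 0" using \<open>xs \<noteq> []\<close> by (simp add: k_def)
  have alt: "b j \<noteq> b (Suc j)" if "Suc j < k" for j
    using distinct_adj_nth[OF adj, of j] that by (simp add: b_def k_def)
  have mem: "snd (xs ! j) \<in> subalgebra_gen (generator (b j))" "functional (word_state r) (snd (xs ! j)) = 0"
    if "j < k" for j
    using xs nth_mem[of j xs] that by (auto simp: b_def k_def case_prod_beta)
  have "\<exists>n c. j < k \<longrightarrow> (\<forall>D>n. snd (xs ! j) = (\<Sum>x<D. Poly_Mapping.single (Letters (replicate x (b j))) (c x)))"
    for j :: nat
  proof (cases "j < k")
    case True
    show ?thesis by (rule subalgebra_gen_generator[OF mem(1)[OF True]]) blast
  qed simp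
  then obtain n c where nc: "\<And>j D. j < k \<Longrightarrow> (n j :: nat) < D \<Longrightarrow>
      snd (xs ! j) = (\<Sum>x<D. Poly_Mapping.single (Letters (replicate x (b j))) (c j x))"
    by metis
  \<comment> \<open>A strict bound for all degrees, used both as range of the sizes and as spacing
    of the intervals.\<close>
  define D where "D = Suc (\<Sum>j<k. n j)"
  have "n j < D" if "j < k" for j
    unfolding D_def less_Suc_eq_le using that by (intro member_le_sum) auto
  then have P: "snd (xs ! j) = (\<Sum>x<D. Poly_Mapping.single (Letters (replicate x (b j))) (c j x))"
    if "j < k" for j using nc that by blast
  \<comment> \<open>The powers of r split over the intervals and join the coefficients.\<close>
  define C where "C j x = c j x * of_real (r ^ x)" for j x
  have "map snd xs = map (\<lambda>j. snd (xs ! j)) [0..<k]"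
    by (rule nth_equalityI) (auto simp: k_def)
  also have "\<dots> = map (\<lambda>j. \<Sum>x<D. Poly_Mapping.single (Letters (replicate x (b j))) (c j x)) [0..<k]"
    using P by (intro map_cong) auto
  finally have "prod_list (map snd xs) =
      (\<Sum>m\<in>{..<k} \<rightarrow>\<^sub>E {..<D}. Poly_Mapping.single (Letters (interval_word b m k)) (\<Prod>j<k. c j (m j)))"
    by (simp only: prod_list_interval_words)
  then have "functional (word_state r) (prod_list (map snd xs)) =
      (\<Sum>m\<in>{..<k} \<rightarrow>\<^sub>E {..<D}. (\<Prod>j<k. c j (m j)) * of_real (word_state r (interval_word b m k)))"
    by (simp add: functional_sum functional_single)
  also have "\<dots> = (\<Sum>m\<in>{..<k} \<rightarrow>\<^sub>E {..<D}. (\<Prod>j<k. C j (m j)) *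
      of_real (word_moment W (\<lambda>t. side \<alpha> (b (t div D))) (positions D k m)))"
  proof (rule sum.cong[OF refl])
    fix m assume m: "m \<in> {..<k} \<rightarrow>\<^sub>E {..<D}"
    have mD: "m j < D" if "j < k" for j using m that by auto
    have "word_state r (interval_word b m k) = (\<Prod>j<k. r ^ m j) * word_moment W (\<lambda>t. side \<alpha> (b (t div D))) (positions D k m)"
      unfolding word_state_def length_interval_word
      using K.letter_moment_interval_word[of "side \<alpha>" k m D b, OF side_measurable mD] by (simp add: power_sum)
    then show "(\<Prod>j<k. c j (m j)) * of_real (word_state r (interval_word b m k)) =
      (\<Prod>j<k. C j (m j)) * of_real (word_moment W (\<lambda>t. side \<alpha> (b (t div D))) (positions D k m))"
      by (simp add: C_def prod.distrib)
  qed
  also have "\<dots> = 0"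
    unfolding letter_side_def[symmetric]
  proof (rule alternating_centred_sum[OF k])
    show "b j \<noteq> b (Suc j)" if "Suc j < k" for j by (rule alt[OF that])
  next
    fix j assume j: "j < k"
    have "0 = functional (word_state r) (snd (xs ! j))" using mem(2)[OF j] by simp
    also have "\<dots> = (\<Sum>x<D. c j x * of_real (word_state r (replicate x (b j))))"
      unfolding P[OF j] by (simp add: functional_sum functional_single)
    also have "\<dots> = (\<Sum>x<D. C j x * of_real (word_moment W (\<lambda>_. side \<alpha> (b j)) {..<x}))"
      by (simp add: C_def word_state_replicate mult.assoc)
    finally show "(\<Sum>x<D. C j x * of_real (word_moment W (\<lambda>_. side \<alpha> (b j)) {..<x})) = 0" ..
  qed
  finally show "functional (word_state r) (prod_list (map snd xs)) = 0" .
qed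

lemma state_word_state: "state (functional (word_state r))"
proof (rule state_functional)
  show "word_state r [] = 1"
    using K.kernel_moment_0 K.kernel_moment_lessThan[of 0]
    by (simp add: word_state_def K.letter_moment_def word_moment_def pairings_empty pairing_weight_def pairing_density_def)
  show "word_state r (rev u @ v) = word_state r (rev v @ u)" for u v
    by (simp add: word_state_def add.commute K.letter_moment_commute[OF side_measurable abs_side_le])
  show "0 \<le> (\<Sum>u\<in>F. \<Sum>v\<in>F. c u * c v * word_state r (rev u @ v))" if "finite F" for F and c :: "bool list \<Rightarrow> real"
    using K.letter_moment_positive[OF side_measurable abs_side_le that, of "\<lambda>u. c u * r ^ length u"]
    by (simp add: word_state_def power_add mult_ac)
qed

end

section \<open>Convolutions\<close>

subsection \<open>Splitting the unit interval\<close>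

lemma side_sum: "side \<alpha> True x + side \<alpha> False x = 1"
  by (simp add: side_def indicator_def)

context kernel
begin

text \<open>Insert the sum of the two sides, which is 1, at every position and expand; S collects
  the positions coloured \<open>True\<close>.\<close>

lemma kernel_moment_split:
  "kernel_moment w p = (\<Sum>S\<in>Pow {..<p}. word_moment w (\<lambda>i. side \<alpha> (i \<in> S)) {..<p})"
proof -
  have "pairing_weight w (\<lambda>_ _. 1) \<pi> = (\<Sum>S\<in>Pow {..<p}. pairing_weight w (\<lambda>i. side \<alpha> (i \<in> S)) \<pi>)"
    if \<pi>: "\<pi> \<in> pairings {..<p}" for \<pi>
  proof -
    have "pairing_density w (\<lambda>_ _. 1) \<pi> x = (\<Sum>S\<in>Pow {..<p}. pairing_density w (\<lambda>i. side \<alpha> (i \<in> S)) \<pi> x)" for x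
    proof -
      \<comment> \<open>Passing to a product over positions, where the product of sums can be
        expanded.\<close>
      have blocks: "(\<Prod>B\<in>\<pi>. \<Prod>i\<in>B. h i (x B)) = (\<Prod>i<p. h i (x (block \<pi> i)))" for h :: "nat \<Rightarrow> real \<Rightarrow> real"
      proof -
        have "(\<Prod>i<p. h i (x (block \<pi> i))) = (\<Prod>i\<in>\<Union>\<pi>. h i (x (block \<pi> i)))"
          by (simp add: pairingsD(1)[OF \<pi>])
        also have "\<dots> = (\<Prod>B\<in>\<pi>. \<Prod>i\<in>B. h i (x (block \<pi> i)))"
          using pairingsD(2,4)[OF \<pi>] by (subst prod.Union_disjoint) auto
        also have "\<dots> = (\<Prod>B\<in>\<pi>. \<Prod>i\<in>B. h i (x B))"
          by (intro prod.cong refl) (simp add: block_eq[OF \<pi>])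
        finally show ?thesis ..
      qed
      define E where "E = (\<Prod>(U, V)\<in>crossing_edges \<pi>. w (x U) (x V))"
      have dens: "pairing_density w (\<lambda>i. side \<alpha> (i \<in> S)) \<pi> x = (\<Prod>i<p. side \<alpha> (i \<in> S) (x (block \<pi> i))) * E" for S
        by (simp only: pairing_density_def blocks[of "\<lambda>i. side \<alpha> (i \<in> S)"] E_def)
      have "(1::real) = (\<Prod>i<p. side \<alpha> True (x (block \<pi> i)) + side \<alpha> False (x (block \<pi> i)))"
        by (simp add: side_sum)
      also have "\<dots> = (\<Sum>S\<in>Pow {..<p}. (\<Prod>i\<in>S. side \<alpha> True (x (block \<pi> i))) * (\<Prod>i\<in>{..<p} - S. side \<alpha> False (x (block \<pi> i))))"
        by (rule prod_add) simp
      also have "\<dots> = (\<Sum>S\<in>Pow {..<p}. \<Prod>i<p. side \<alpha> (i \<in> S) (x (block \<pi> i)))"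
      proof (rule sum.cong[OF refl])
        fix S assume "S \<in> Pow {..<p}"
        then have "(\<Prod>i<p. side \<alpha> (i \<in> S) (x (block \<pi> i))) =
            (\<Prod>i\<in>{..<p} - S. side \<alpha> (i \<in> S) (x (block \<pi> i))) * (\<Prod>i\<in>S. side \<alpha> (i \<in> S) (x (block \<pi> i)))"
          by (intro prod.subset_diff) auto
        also have "(\<Prod>i\<in>{..<p} - S. side \<alpha> (i \<in> S) (x (block \<pi> i))) = (\<Prod>i\<in>{..<p} - S. side \<alpha> False (x (block \<pi> i)))"
          by (intro prod.cong) auto
        also have "(\<Prod>i\<in>S. side \<alpha> (i \<in> S) (x (block \<pi> i))) = (\<Prod>i\<in>S. side \<alpha> True (x (block \<pi> i)))"
          by (intro prod.cong) auto
        finally show "(\<Prod>i\<in>S. side \<alpha> True (x (block \<pi> i))) * (\<Prod>i\<in>{..<p} - S. side \<alpha> False (x (block \<pi> i))) =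
            (\<Prod>i<p. side \<alpha> (i \<in> S) (x (block \<pi> i)))"
          by (simp only: mult.commute)
      qed
      finally have one: "1 = (\<Sum>S\<in>Pow {..<p}. \<Prod>i<p. side \<alpha> (i \<in> S) (x (block \<pi> i)))" .
      have "pairing_density w (\<lambda>_ _. 1) \<pi> x = 1 * E" by (simp add: pairing_density_def E_def)
      then show ?thesis by (simp only: dens sum_distrib_right[symmetric] one[symmetric])
    qed
    then have "pairing_weight w (\<lambda>_ _. 1) \<pi> =
        (\<integral>x. (\<Sum>S\<in>Pow {..<p}. pairing_density w (\<lambda>i. side \<alpha> (i \<in> S)) \<pi> x) \<partial>(\<Pi>\<^sub>M B\<in>\<pi>. uniform))"
      by (simp add: pairing_weight_def)
    also have "\<dots> = (\<Sum>S\<in>Pow {..<p}. pairing_weight w (\<lambda>i. side \<alpha> (i \<in> S)) \<pi>)"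
      unfolding pairing_weight_def
      by (intro Bochner_Integration.integral_sum integrable_pairing_density side_measurable abs_side_le)
    finally show ?thesis .
  qed
  then have "kernel_moment w p = (\<Sum>\<pi>\<in>pairings {..<p}. \<Sum>S\<in>Pow {..<p}. pairing_weight w (\<lambda>i. side \<alpha> (i \<in> S)) \<pi>)"
    by (simp add: kernel_moment_lessThan word_moment_def)
  then show ?thesis unfolding word_moment_def by (subst (asm) sum.swap)
qed

lemma sum_letter_moment_words:
  "(\<Sum>u\<in>words n. letter_moment (side \<alpha>) u) = kernel_moment w n"
  unfolding kernel_moment_split[of n \<alpha>]
proof (rule sum.reindex_bij_witness[where i = "\<lambda>S. map (\<lambda>k. k \<in> S) [0..<n]" and j = "\<lambda>u. {k. k < n \<and> u ! k}"])
  fix u assume "u \<in> words n"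
  then have len: "length u = n" by (simp add: words_def)
  show "map (\<lambda>k. k \<in> {k. k < n \<and> u ! k}) [0..<n] = u"
    by (rule nth_equalityI) (auto simp: len)
  show "word_moment w (\<lambda>i. side \<alpha> (i \<in> {k. k < n \<and> u ! k})) {..<n} = letter_moment (side \<alpha>) u"
    unfolding letter_moment_def len by (rule word_moment_cong) simp
qed (auto simp: words_def)

lemma word_moment_one: "finite A \<Longrightarrow> word_moment w (\<lambda>_ _. 1) A = kernel_moment w (card A)"
proof -
  assume "finite A"
  then obtain h where h: "bij_betw h {..<card A} A" "strict_mono_on {..<card A} h"
    by (rule ex_bij_betw_strict_mono_card)
  have "word_moment w (\<lambda>_ _. 1) (h ` {..<card A}) = word_moment w (\<lambda>_ _. 1) {..<card A}"
    using word_moment_image[of "\<lambda>_ _. 1", OF _ h(2)] by simp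
  then show ?thesis using h(1) by (simp add: bij_betw_def kernel_moment_lessThan)
qed

end

text \<open>A block with both colours would need its coordinate on both sides of \<alpha>, so its
  weight is 0. For the other pairings a nonzero vertex factor fixes the sides, as
  \<open>pairing_weight_Un\<close> requires.\<close>

lemma word_moment_glue_classical:
  assumes w0: "kernel w0" and w1: "kernel w1" and S: "S \<subseteq> {..<p}"
  shows "word_moment (glue \<alpha> 1 w0 w1) (\<lambda>i. side \<alpha> (i \<in> S)) {..<p} =
    word_moment (glue \<alpha> 1 w0 w1) (\<lambda>_. side \<alpha> True) S *
    word_moment (glue \<alpha> 1 w0 w1) (\<lambda>_. side \<alpha> False) ({..<p} - S)"
proof -
  define w where "w = glue \<alpha> 1 w0 w1"
  define f where "f i = side \<alpha> (i \<in> S)" for i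
  interpret kernel w unfolding w_def by (rule kernel_glue[OF w0 w1]) simp
  let ?T = "{..<p} - S"
  have disj: "S \<inter> ?T = {}" and un: "S \<union> ?T = {..<p}" using S by auto
  have fin: "finite S" "finite ?T" using S finite_subset by auto
  have zero: "pairing_weight w f \<pi> = 0"
    if \<pi>: "\<pi> \<in> pairings {..<p}" and U: "U \<in> \<pi>" "\<not> U \<subseteq> S" "\<not> U \<subseteq> ?T" for \<pi> U
  proof -
    obtain i j where ij: "i \<in> U" "i \<notin> S" "j \<in> U" "j \<in> S"
      using U pairingsD(6)[OF \<pi> U(1)] by auto
    have "(\<Prod>i\<in>U. f i (x U)) = 0" for x
    proof (cases "\<alpha> \<le> x U")
      case True
      then show ?thesis using ij pairingsD(4)[OF \<pi> U(1)]
        by (intro prod_zero bexI[of _ i]) (auto simp: f_def side_def)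
    next
      case False
      then show ?thesis using ij pairingsD(4)[OF \<pi> U(1)]
        by (intro prod_zero bexI[of _ j]) (auto simp: f_def side_def)
    qed
    then have "pairing_density w f \<pi> x = 0" for x
      using U(1) finite_pairing[OF \<pi>] prod_zero[of \<pi> "\<lambda>B. \<Prod>i\<in>B. f i (x B)"] by (auto simp: pairing_density_def)
    then show ?thesis by (simp add: pairing_weight_def)
  qed
  have "word_moment w f {..<p} = (\<Sum>\<pi>\<in>{\<pi>\<in>pairings (S \<union> ?T). \<forall>U\<in>\<pi>. U \<subseteq> S \<or> U \<subseteq> ?T}. pairing_weight w f \<pi>)"
    unfolding word_moment_def un using zero
    by (intro sum.mono_neutral_right) (auto simp: finite_pairings)
  also have "\<dots> = (\<Sum>x\<in>pairings S \<times> pairings ?T. pairing_weight w f (fst x \<union> snd x))"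
    unfolding pairings_Un_iff[OF disj, symmetric] sum.reindex[OF pairings_Un_inj[OF disj]]
    by (simp add: case_prod_beta)
  also have "\<dots> = (\<Sum>x\<in>pairings S \<times> pairings ?T. pairing_weight w f (fst x) * pairing_weight w f (snd x))"
  proof (rule sum.cong[OF refl])
    fix x assume "x \<in> pairings S \<times> pairings ?T"
    then have x: "fst x \<in> pairings S" "snd x \<in> pairings ?T" by auto
    show "pairing_weight w f (fst x \<union> snd x) = pairing_weight w f (fst x) * pairing_weight w f (snd x)"
    proof (rule pairing_weight_Un[OF _ _ x disj fin])
      fix U V and y :: "nat set \<Rightarrow> real"
      assume U: "U \<in> fst x" and V: "V \<in> snd x" and nz: "(\<Prod>B\<in>fst x \<union> snd x. \<Prod>i\<in>B. f i (y B)) \<noteq> 0"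
      have fx: "finite (fst x \<union> snd x)" using finite_pairing[OF x(1)] finite_pairing[OF x(2)] fin by simp
      have nz': "f i (y B) \<noteq> 0" if "B \<in> fst x \<union> snd x" "i \<in> B" for B i
      proof
        assume 0: "f i (y B) = 0"
        have finB: "finite B" using that(1) pairingsD(4)[OF x(1)] pairingsD(4)[OF x(2)] by auto
        have "(\<Prod>i\<in>B. f i (y B)) = 0" by (rule prod_zero[OF finB]) (use 0 that(2) in blast)
        then have "(\<Prod>B\<in>fst x \<union> snd x. \<Prod>i\<in>B. f i (y B)) = 0"
          by (intro prod_zero[OF fx]) (use that(1) in blast)
        with nz show False by simp
      qed
      obtain i where i: "i \<in> U" "i \<in> S" using pairingsD(5,6)[OF x(1) U] by blast
      obtain j where j: "j \<in> V" "j \<in> ?T" using pairingsD(5,6)[OF x(2) V] by blast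
      have "\<alpha> \<le> y U" using nz'[of U i] U i by (auto simp: f_def side_def indicator_def split: if_splits)
      moreover have "y V < \<alpha>" using nz'[of V j] V j by (auto simp: f_def side_def indicator_def split: if_splits)
      ultimately show "w (y U) (y V) = 1" by (simp add: w_def glue_def)
    qed (auto simp: f_def side_measurable abs_side_le)
  qed
  also have "\<dots> = word_moment w f S * word_moment w f ?T"
    by (simp add: word_moment_def sum_product sum.cartesian_product case_prod_beta)
  also have "word_moment w f S = word_moment w (\<lambda>_. side \<alpha> True) S"
    by (rule word_moment_cong) (simp add: f_def)
  also have "word_moment w f ?T = word_moment w (\<lambda>_. side \<alpha> False) ?T"
    by (rule word_moment_cong) (simp add: f_def)
  finally show ?thesis by (simp only: w_def f_def)
qed

subsection \<open>Moments of convolutions\<close>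

lemma (in pair_prob_space) integral_mult:
  fixes f :: "'a \<Rightarrow> real" and g :: "'b \<Rightarrow> real"
  assumes f: "integrable M1 f" and g: "integrable M2 g"
  shows "integrable (M1 \<Otimes>\<^sub>M M2) (\<lambda>z. f (fst z) * g (snd z))"
    and "(\<integral>z. f (fst z) * g (snd z) \<partial>(M1 \<Otimes>\<^sub>M M2)) = (\<integral>x. f x \<partial>M1) * (\<integral>y. g y \<partial>M2)"
proof -
  have [measurable]: "f \<in> borel_measurable M1" "g \<in> borel_measurable M2" using f g by auto
  show i: "integrable (M1 \<Otimes>\<^sub>M M2) (\<lambda>z. f (fst z) * g (snd z))"
  proof (rule Fubini_integrable)
    show "integrable M1 (\<lambda>x. \<integral>y. norm (f (fst (x, y)) * g (snd (x, y))) \<partial>M2)"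
      using f by (simp add: abs_mult)
  qed (use g in auto)
  show "(\<integral>z. f (fst z) * g (snd z) \<partial>(M1 \<Otimes>\<^sub>M M2)) = (\<integral>x. f x \<partial>M1) * (\<integral>y. g y \<partial>M2)"
    using integral_fst'[OF i] by simp
qed

text \<open>The binomial expansion is kept as a sum over subsets, to be compared term by term with
  \<open>kernel_moment_split\<close>.\<close>

lemma convolution_moments:
  fixes M N :: "real measure"
  assumes M: "real_distribution M" "\<And>n. integrable M (\<lambda>x. x ^ n)"
    and N: "real_distribution N" "\<And>n. integrable N (\<lambda>x. x ^ n)"
  shows "real_distribution (M \<star> N)" and "integrable (M \<star> N) (\<lambda>x. x ^ p)"
    and "(\<integral>x. x ^ p \<partial>(M \<star> N)) =
      (\<Sum>S\<in>Pow {..<p}. (\<integral>x. x ^ card ({..<p} - S) \<partial>M) * (\<integral>x. x ^ card S \<partial>N))"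
proof -
  interpret M: real_distribution M by fact
  interpret N: real_distribution N by fact
  interpret pair_prob_space M N ..
  have add: "(\<lambda>(x, y). x + y) \<in> M \<Otimes>\<^sub>M N \<rightarrow>\<^sub>M borel" by measurable
  have pw: "(\<lambda>x::real. x ^ p) \<in> borel_measurable borel" by measurable
  have mult: "integrable (M \<Otimes>\<^sub>M N) (\<lambda>z. fst z ^ a * snd z ^ b)"
    "(\<integral>z. fst z ^ a * snd z ^ b \<partial>(M \<Otimes>\<^sub>M N)) = (\<integral>x. x ^ a \<partial>M) * (\<integral>y. y ^ b \<partial>N)" for a b
    by (rule integral_mult[OF M(2) N(2)])+
  have expand: "(case z of (x, y) \<Rightarrow> x + y) ^ p = (\<Sum>S\<in>Pow {..<p}. fst z ^ card ({..<p} - S) * snd z ^ card S)"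
    for z :: "real \<times> real"
  proof -
    have "(snd z + fst z) ^ p = (\<Prod>i<p. snd z + fst z)" by simp
    also have "\<dots> = (\<Sum>S\<in>Pow {..<p}. (\<Prod>i\<in>S. snd z) * (\<Prod>i\<in>{..<p} - S. fst z))" by (rule prod_add) simp
    finally show ?thesis by (simp add: case_prod_beta add.commute mult.commute)
  qed
  show "real_distribution (M \<star> N)"
    unfolding convolution_def using add by (rule real_distribution_distr)
  show "integrable (M \<star> N) (\<lambda>x. x ^ p)"
    unfolding convolution_def integrable_distr_eq[OF add pw] expand
    by (intro Bochner_Integration.integrable_sum mult)
  show "(\<integral>x. x ^ p \<partial>(M \<star> N)) =
      (\<Sum>S\<in>Pow {..<p}. (\<integral>x. x ^ card ({..<p} - S) \<partial>M) * (\<integral>x. x ^ card S \<partial>N))"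
    unfolding convolution_def integral_distr[OF add pw] expand
    by (simp add: Bochner_Integration.integral_sum mult)
qed

subsection \<open>The two convolutions\<close>

context
  fixes w0 w1 :: "real \<Rightarrow> real \<Rightarrow> real" and s t r \<alpha> :: real
  assumes w0: "kernel w0" and w1: "kernel w1" and s: "s > 0" and t: "t > 0"
    and r: "r > 0" "0 < \<alpha>" "\<alpha> < 1" "r * sqrt \<alpha> = s" "r * sqrt (1 - \<alpha>) = t"
begin

interpretation w0: kernel w0 by (rule w0)
interpretation w1: kernel w1 by (rule w1)

lemma classical_convolution_kernel_measures:
  "(dilation s (kernel_measure w0) \<star> dilation t (kernel_measure w1)) = dilation r (kernel_measure (glue \<alpha> 1 w0 w1))"
proof -
  let ?w = "glue \<alpha> 1 w0 w1"
  interpret w: kernel ?w by (rule kernel_glue[OF w0 w1]) simp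
  note conv = convolution_moments[OF w0.dilation_kernel_measure(1,2) w1.dilation_kernel_measure(1,2)]
  show ?thesis
  proof (rule w.eq_dilation_kernel_measure[OF conv(1,2)])
    fix p
    have "r ^ p * kernel_moment ?w p = (\<Sum>S\<in>Pow {..<p}. r ^ p * word_moment ?w (\<lambda>i. side \<alpha> (i \<in> S)) {..<p})"
      by (simp add: w.kernel_moment_split[of p \<alpha>] sum_distrib_left)
    also have "\<dots> = (\<Sum>S\<in>Pow {..<p}. (s ^ card ({..<p} - S) * kernel_moment w0 (card ({..<p} - S))) *
        (t ^ card S * kernel_moment w1 (card S)))"
    proof (rule sum.cong[OF refl])
      fix S assume "S \<in> Pow {..<p}"
      then have S: "S \<subseteq> {..<p}" "finite S" using finite_subset by auto
      then have p: "p = card ({..<p} - S) + card S"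
        using card_mono[of "{..<p}" S] by (simp add: card_Diff_subset)
      have "word_moment ?w (\<lambda>i. side \<alpha> (i \<in> S)) {..<p} =
          sqrt (1 - \<alpha>) ^ card S * kernel_moment w1 (card S) *
          (sqrt \<alpha> ^ card ({..<p} - S) * kernel_moment w0 (card ({..<p} - S)))"
        using word_moment_glue_classical[OF w0 w1 S(1)] S r w0 w1
        by (simp add: word_moment_glue_True word_moment_glue_False w0.word_moment_one w1.word_moment_one)
      moreover have "r ^ p = r ^ card ({..<p} - S) * r ^ card S"
        using p by (metis power_add)
      ultimately show "r ^ p * word_moment ?w (\<lambda>i. side \<alpha> (i \<in> S)) {..<p} =
        (s ^ card ({..<p} - S) * kernel_moment w0 (card ({..<p} - S))) * (t ^ card S * kernel_moment w1 (card S))"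
        by (simp only: r(4,5)[symmetric] power_mult_distrib mult_ac)
    qed
    also have "\<dots> = (\<integral>x. x ^ p \<partial>(dilation s (kernel_measure w0) \<star> dilation t (kernel_measure w1)))"
      by (simp only: conv(3) w0.dilation_kernel_measure(3) w1.dilation_kernel_measure(3))
    finally show "(\<integral>x. x ^ p \<partial>(dilation s (kernel_measure w0) \<star> dilation t (kernel_measure w1))) =
        r ^ p * kernel_moment ?w p" ..
  qed
qed

text \<open>The glued state, scaled by r, is a witness for the definite description. Any other
  admissible state agrees with it on powers of the sum, by freeness and equality of the marginal
  laws, and these moments determine the law.\<close>

lemma free_convolution_kernel_measures:
  "dilation s (kernel_measure w0) \<boxplus> dilation t (kernel_measure w1) = dilation r (kernel_measure (glue \<alpha> 0 w0 w1))"
proof -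
  interpret free_glue \<alpha> w0 w1 by unfold_locales
  define \<phi> where "\<phi> = functional (word_state r)"
  let ?M = "dilation s (kernel_measure w0)" and ?N = "dilation t (kernel_measure w1)"
  let ?L = "dilation r (kernel_measure W)"
  define Q where "Q \<phi>' L \<longleftrightarrow> state \<phi>' \<and>
     freely_independent \<phi>' (\<lambda>b. subalgebra_gen (generator b)) \<and>
     has_law \<phi>' (generator False) ?M \<and> has_law \<phi>' (generator True) ?N \<and>
     has_law \<phi>' (generator False + generator True) L" for \<phi>' L
  have gF: "\<phi> (generator False ^ n) = of_real (s ^ n * kernel_moment w0 n)" for n
    using word_moment_glue_False[OF w0, of "{..<n}" \<alpha> 0 w1] r
    by (simp add: \<phi>_def functional_generator_power word_state_replicate W_def w0.word_moment_one
        r(4)[symmetric] power_mult_distrib)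
  have gT: "\<phi> (generator True ^ n) = of_real (t ^ n * kernel_moment w1 n)" for n
    using word_moment_glue_True[OF w1, of "{..<n}" \<alpha> 0 w0] r
    by (simp add: \<phi>_def functional_generator_power word_state_replicate W_def w1.word_moment_one
        r(5)[symmetric] power_mult_distrib)
  have gS: "\<phi> ((generator False + generator True) ^ n) = of_real (r ^ n * kernel_moment W n)" for n
  proof -
    have "(\<Sum>u\<in>words n. word_state r u) = (\<Sum>u\<in>words n. r ^ n * K.letter_moment (side \<alpha>) u)"
      by (intro sum.cong) (auto simp: word_state_def words_def)
    then show ?thesis
      by (simp add: \<phi>_def functional_generator_sum_power sum_distrib_left[symmetric] K.sum_letter_moment_words)
  qed
  have Q: "Q \<phi> ?L"
    unfolding Q_def has_law_def gF gT gS
    by (simp add: \<phi>_def state_word_state freely_independent_word_state w0.dilation_kernel_measure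
        w1.dilation_kernel_measure K.dilation_kernel_measure)
  have law: "\<phi>' (generator False ^ n) = of_real (\<integral>x. x ^ n \<partial>?M)"
    "\<phi>' (generator True ^ n) = of_real (\<integral>x. x ^ n \<partial>?N)"
    "\<phi>' ((generator False + generator True) ^ n) = of_real (\<integral>x. x ^ n \<partial>L)" if "Q \<phi>' L" for \<phi>' L n
    using that unfolding Q_def has_law_def by blast+
  have uniq: "L = ?L" if L: "Q \<phi>' L" for \<phi>' L
  proof (rule K.eq_dilation_kernel_measure)
    show "real_distribution L" "integrable L (\<lambda>x. x ^ p)" for p
      using L unfolding Q_def has_law_def by blast+
    fix p
    have "\<phi> (generator b ^ n) = \<phi>' (generator b ^ n)" for b n
      by (cases b) (simp_all only: law[OF Q] law[OF L])
    moreover have "linear_unital \<phi>" "linear_unital \<phi>'"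
      "freely_independent \<phi> (\<lambda>b. subalgebra_gen (generator b))"
      "freely_independent \<phi>' (\<lambda>b. subalgebra_gen (generator b))"
      using L Q state_linear_unital unfolding Q_def by blast+
    ultimately have "\<phi> ((generator False + generator True) ^ p) = \<phi>' ((generator False + generator True) ^ p)"
      using free_sum_moments_unique[of \<phi> \<phi>' p] by blast
    also have "\<dots> = of_real (\<integral>x. x ^ p \<partial>L)" by (rule law(3)[OF L])
    finally have "complex_of_real (\<integral>x. x ^ p \<partial>L) = complex_of_real (r ^ p * kernel_moment W p)"
      unfolding gS ..
    then show "(\<integral>x. x ^ p \<partial>L) = r ^ p * kernel_moment W p" by (simp only: of_real_eq_iff)
  qed
  have "?M \<boxplus> ?N = (THE L. \<exists>\<phi>'. Q \<phi>' L)" by (simp only: free_convolution_def Q_def)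
  also have "\<dots> = ?L"
  proof (rule the_equality)
    show "\<exists>\<phi>'. Q \<phi>' ?L" using Q by blast
    show "L = ?L" if "\<exists>\<phi>'. Q \<phi>' L" for L using that uniq by blast
  qed
  finally show ?thesis by (simp only: W_def)
qed

end

theorem proposition2p4:
  fixes w w' :: "real \<Rightarrow> real \<Rightarrow> real" and s t :: real
  assumes "unit_kernel w" and "unit_kernel w'" and "s > 0" and "t > 0"
  shows "\<exists>wc wf r rf. unit_kernel wc \<and> unit_kernel wf \<and> r > 0 \<and> rf > 0 \<and>
     (dilation s (kernel_measure w) \<star> dilation t (kernel_measure w'))
       = dilation r (kernel_measure wc) \<and>
     dilation s (kernel_measure w) \<boxplus> dilation t (kernel_measure w')
       = dilation rf (kernel_measure wf)"
proof -
  let ?w0 = "extend_kernel w" and ?w1 = "extend_kernel w'"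
  have k: "kernel ?w0" "kernel ?w1" using assms by (auto intro: kernel_extend_kernel)
  have eq: "kernel_measure w = kernel_measure ?w0" "kernel_measure w' = kernel_measure ?w1"
    by (intro kernel_measure_cong; simp add: kernel_moment_extend_kernel)+
  \<comment> \<open>Each kernel measure has variance 1 and both convolutions add variances; \<alpha>
    is the share of the first summand.\<close>
  define r where "r = sqrt (s\<^sup>2 + t\<^sup>2)"
  define \<alpha> where "\<alpha> = s\<^sup>2 / r\<^sup>2"
  have pos: "s\<^sup>2 > 0" "t\<^sup>2 > 0" using assms by simp_all
  have r2: "r\<^sup>2 = s\<^sup>2 + t\<^sup>2" using add_pos_pos[OF pos] by (simp add: r_def)
  have r: "r > 0" using add_pos_pos[OF pos] by (simp only: r_def real_sqrt_gt_0_iff)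
  have \<alpha>: "0 < \<alpha>" "\<alpha> < 1" "1 - \<alpha> = t\<^sup>2 / r\<^sup>2"
    using pos add_pos_pos[OF pos] unfolding \<alpha>_def r2 by (auto simp: field_simps)
  have "r * sqrt \<alpha> = s" "r * sqrt (1 - \<alpha>) = t"
    using r assms unfolding \<alpha>(3) by (simp_all add: \<alpha>_def real_sqrt_divide)
  note c = classical_convolution_kernel_measures[OF k assms(3,4) r \<alpha>(1,2) this]
    free_convolution_kernel_measures[OF k assms(3,4) r \<alpha>(1,2) this]
  have "unit_kernel (glue \<alpha> 1 ?w0 ?w1)" "unit_kernel (glue \<alpha> 0 ?w0 ?w1)"
    by (intro kernel_unit_kernel kernel_glue k; simp)+
  with c r show ?thesis unfolding eq by blast
qed

end
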